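(* Let $L>0$, $\mathcal{M}>0$ and $\hat k>0$ be given. If $\mathcal{M}L\in\left(\frac34\pi,\,\pi\right)$ and the time delay $\tau>0$ is sufficiently large (that is, there exists $\tau_0>0$ such that the following holds for all $\tau\ge\tau_0$), then there is no value of $k\in(-\hat k,\hat k)$ such that the closed loop system $$(\delta_+)_t+(\delta_+)_x+\mathcal{M}\,\delta_-=0,\qquad (\delta_-)_t-(\delta_-)_x+\mathcal{M}\,\delta_+=0\qquad (t\ge 0,\ x\in(0,L)),$$ with the boundary condition $\delta_-(t,L)=\delta_+(t,L)$ for $t\ge0$ and the delayed feedback law $$\delta_+(t,0)=k\,\delta_-(t-\tau,0)\qquad (t\ge 2\tau)$$ is exponentially stable.
   Context: The unknowns $\delta_+,\delta_-$ are real-valued functions of $t\ge0$ and $x\in(0,L)$, with initial states $\delta_+(0,\cdot),\delta_-(0,\cdot)\in H^1(0,L)$. The system is completed by a compatible starting phase on $[0,2\tau)$: for $t\in[0,2\tau)$ one prescribes $\delta_+(t,0)=k\,\delta_-(t-\zeta(t),0)$, where $\zeta$ is a chosen smooth nonnegative function with $\zeta(0)=0$, $\zeta(2\tau)=\tau$, $\zeta'(2\tau)=0$ and $\zeta(t)\le t$ for all $t\in[0,2\tau]$. Exponential stability means: there exist constants $C>0$ and $\mu>0$ such that for all initial states in $(H^1(0,L))^2$ compatible with the boundary conditions the corresponding solution satisfies $\|(\delta_+(t,\cdot),\delta_-(t,\cdot))\|_{(L^2(0,L))^2}\le C e^{-\mu t}\|(\delta_+(0,\cdot),\delta_-(0,\cdot))\|_{(L^2(0,L))^2}$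 for all $t\ge0$. *)

theory Defs
  imports "HOL-Analysis.Analysis"
begin

text \<open>\<open>C\<^sup>\<infinity>\<close> functions on a subset of the real line; at the end points of a closed
  interval the derivatives are one-sided.\<close>

definition smooth_real_on :: "real set \<Rightarrow> (real \<Rightarrow> real) \<Rightarrow> bool" where
  "smooth_real_on S f \<longleftrightarrow>
     (\<exists>D :: nat \<Rightarrow> real \<Rightarrow> real.
        (\<forall>x\<in>S. D 0 x = f x) \<and>
        (\<forall>n. \<forall>x\<in>S. (D n has_real_derivative D (Suc n) x) (at x within S)))"

definition test_function :: "real \<Rightarrow> (real \<Rightarrow> real) \<Rightarrow> bool" where
  "test_function L \<phi> \<longleftrightarrow>
     smooth_real_on UNIV \<phi> \<and> (\<exists>a b. 0 < a \<and> b < L \<and> (\<forall>x. x \<notin> {a..b} \<longrightarrow> \<phi> x = 0))"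

definition in_L2 :: "real \<Rightarrow> (real \<Rightarrow> real) \<Rightarrow> bool" where
  "in_L2 L u \<longleftrightarrow>
     u \<in> borel_measurable (lebesgue_on {0<..<L}) \<and>
     integrable (lebesgue_on {0<..<L}) (\<lambda>x. (u x)\<^sup>2)"

definition L2_norm :: "real \<Rightarrow> (real \<Rightarrow> real) \<Rightarrow> real" where
  "L2_norm L u = sqrt (\<integral>x. (u x)\<^sup>2 \<partial>lebesgue_on {0<..<L})"

definition L2_norm_pair :: "real \<Rightarrow> (real \<Rightarrow> real) \<Rightarrow> (real \<Rightarrow> real) \<Rightarrow> real" where
  "L2_norm_pair L u v = sqrt ((L2_norm L u)\<^sup>2 + (L2_norm L v)\<^sup>2)"

definition weak_derivative :: "real \<Rightarrow> (real \<Rightarrow> real) \<Rightarrow> (real \<Rightarrow> real) \<Rightarrow> bool" where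
  "weak_derivative L u v \<longleftrightarrow>
     (\<forall>\<phi>. test_function L \<phi> \<longrightarrow>
        (\<integral>x. u x * deriv \<phi> x \<partial>lebesgue_on {0<..<L}) =
        - (\<integral>x. v x * \<phi> x \<partial>lebesgue_on {0<..<L}))"

text \<open>\<open>u\<close> is the representative in \<open>H\<^sup>1(0,L)\<close> that is continuous on \<open>[0,L]\<close>, so that the
  values \<open>u 0\<close> and \<open>u L\<close> are the boundary traces; \<open>v\<close> is the weak derivative of \<open>u\<close>.\<close>

definition H1_with_derivative :: "real \<Rightarrow> (real \<Rightarrow> real) \<Rightarrow> (real \<Rightarrow> real) \<Rightarrow> bool" where
  "H1_with_derivative L u v \<longleftrightarrow>
     continuous_on {0..L} u \<and> in_L2 L u \<and> in_L2 L v \<and> weak_derivative L u v"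

definition in_H1 :: "real \<Rightarrow> (real \<Rightarrow> real) \<Rightarrow> bool" where
  "in_H1 L u \<longleftrightarrow> (\<exists>v. H1_with_derivative L u v)"

text \<open>Continuity and differentiability of \<open>t \<mapsto> u t\<close>, \<open>t \<ge> 0\<close>, as a curve in \<open>L\<^sup>2(0,L)\<close>.\<close>

definition L2_continuous :: "real \<Rightarrow> (real \<Rightarrow> real \<Rightarrow> real) \<Rightarrow> bool" where
  "L2_continuous L u \<longleftrightarrow>
     (\<forall>t\<ge>0. in_L2 L (u t)) \<and>
     (\<forall>t\<ge>0. ((\<lambda>s. L2_norm L (\<lambda>x. u s x - u t x)) \<longlongrightarrow> 0) (at t within {0..}))"

definition L2_time_derivative ::
  "real \<Rightarrow> (real \<Rightarrow> real \<Rightarrow> real) \<Rightarrow> (real \<Rightarrow> real \<Rightarrow> real) \<Rightarrow> bool" where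
  "L2_time_derivative L u w \<longleftrightarrow>
     (\<forall>t\<ge>0. ((\<lambda>s. L2_norm L (\<lambda>x. (u s x - u t x) / (s - t) - w t x)) \<longlongrightarrow> 0)
        (at t within {0..}))"

text \<open>\<open>u \<in> C([0,\<infinity>); H\<^sup>1(0,L)) \<inter> C\<^sup>1([0,\<infinity>); L\<^sup>2(0,L))\<close>
  with partial derivatives \<open>ut\<close> and \<open>ux\<close>.\<close>

definition H1_evolution ::
  "real \<Rightarrow> (real \<Rightarrow> real \<Rightarrow> real) \<Rightarrow> (real \<Rightarrow> real \<Rightarrow> real) \<Rightarrow> (real \<Rightarrow> real \<Rightarrow> real) \<Rightarrow> bool" where
  "H1_evolution L u ut ux \<longleftrightarrow>
     (\<forall>t\<ge>0. H1_with_derivative L (u t) (ux t)) \<and>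
     L2_continuous L u \<and> L2_continuous L ux \<and>
     L2_continuous L ut \<and> L2_time_derivative L u ut"

definition solves_pde ::
  "real \<Rightarrow> real \<Rightarrow> (real \<Rightarrow> real \<Rightarrow> real) \<Rightarrow> (real \<Rightarrow> real \<Rightarrow> real) \<Rightarrow> bool" where
  "solves_pde L M \<delta>p \<delta>m \<longleftrightarrow>
     (\<exists>\<delta>pt \<delta>px \<delta>mt \<delta>mx.
        H1_evolution L \<delta>p \<delta>pt \<delta>px \<and> H1_evolution L \<delta>m \<delta>mt \<delta>mx \<and>
        (\<forall>t\<ge>0. AE x in lebesgue_on {0<..<L}.
           \<delta>pt t x + \<delta>px t x + M * \<delta>m t x = 0 \<and>
           \<delta>mt t x - \<delta>mx t x + M * \<delta>p t x = 0))"

definition starting_delay :: "real \<Rightarrow> (real \<Rightarrow> real) \<Rightarrow> bool" where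
  "starting_delay \<tau> \<zeta> \<longleftrightarrow>
     smooth_real_on {0..2 * \<tau>} \<zeta> \<and>
     \<zeta> 0 = 0 \<and> \<zeta> (2 * \<tau>) = \<tau> \<and>
     (\<zeta> has_real_derivative 0) (at (2 * \<tau>) within {0..2 * \<tau>}) \<and>
     (\<forall>t\<in>{0..2 * \<tau>}. 0 \<le> \<zeta> t \<and> \<zeta> t \<le> t)"

definition closed_loop_solution ::
  "real \<Rightarrow> real \<Rightarrow> real \<Rightarrow> real \<Rightarrow> (real \<Rightarrow> real) \<Rightarrow>
   (real \<Rightarrow> real \<Rightarrow> real) \<Rightarrow> (real \<Rightarrow> real \<Rightarrow> real) \<Rightarrow> bool" where
  "closed_loop_solution L M k \<tau> \<zeta> \<delta>p \<delta>m \<longleftrightarrow>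
     solves_pde L M \<delta>p \<delta>m \<and>
     (\<forall>t\<ge>0. \<delta>m t L = \<delta>p t L) \<and>
     (\<forall>t\<in>{0..<2 * \<tau>}. \<delta>p t 0 = k * \<delta>m (t - \<zeta> t) 0) \<and>
     (\<forall>t\<ge>2 * \<tau>. \<delta>p t 0 = k * \<delta>m (t - \<tau>) 0)"

text \<open>Since \<open>\<zeta> 0 = 0\<close>, the feedback at \<open>t = 0\<close> reads \<open>\<delta>\<^sub>+(0,0) = k \<delta>\<^sub>-(0,0)\<close>.\<close>

definition compatible_initial_state ::
  "real \<Rightarrow> real \<Rightarrow> (real \<Rightarrow> real) \<Rightarrow> (real \<Rightarrow> real) \<Rightarrow> bool" where
  "compatible_initial_state L k p0 m0 \<longleftrightarrow>
     in_H1 L p0 \<and> in_H1 L m0 \<and> m0 L = p0 L \<and> p0 0 = k * m0 0"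

definition exponentially_stable ::
  "real \<Rightarrow> real \<Rightarrow> real \<Rightarrow> real \<Rightarrow> (real \<Rightarrow> real) \<Rightarrow> bool" where
  "exponentially_stable L M k \<tau> \<zeta> \<longleftrightarrow>
     (\<exists>C>0. \<exists>\<mu>>0. \<forall>p0 m0. compatible_initial_state L k p0 m0 \<longrightarrow>
        (\<forall>\<delta>p \<delta>m. closed_loop_solution L M k \<tau> \<zeta> \<delta>p \<delta>m \<and>
             (\<forall>x\<in>{0..L}. \<delta>p 0 x = p0 x \<and> \<delta>m 0 x = m0 x) \<longrightarrow>
           (\<forall>t\<ge>0. L2_norm_pair L (\<delta>p t) (\<delta>m t) \<le> C * exp (- \<mu> * t) * L2_norm_pair L p0 m0)))"

end

theory Submission
  imports Defs
begin

text \<open>The idea is to read the system sideways. With \<open>y = L - x\<close> as evolution variable, a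
  solution is determined by its trace \<open>h\<close> at the reflecting end \<open>x = L\<close>,
  where both components agree: Riemann's method represents \<open>\<delta>\<^sub>+\<close> as
  \<open>h(t + y)\<close> and \<open>\<delta>\<^sub>-\<close> as \<open>h(t - y)\<close>, each plus
  an integral of \<open>h\<close> over \<open>[t - y, t + y]\<close> against a kernel made of Bessel
  functions (\<open>wave_transport\<close>). Every \<open>C\<^sup>1\<close> function
  \<open>h\<close> on the line gives a classical, hence an \<open>H\<^sup>1\<close>, solution in
  this way (\<open>solves_pde_flat_output\<close>), and the closed loop becomes one scalar equation

      \<open>advanced L \<alpha> h s = k * retarded L \<beta> h (\<Theta> s)\<close>  for  \<open>s \<ge> 0\<close>,

  where \<open>\<Theta> s = s - \<zeta> s\<close> during the starting phase and
  \<open>\<Theta> s = s - \<tau>\<close> afterwards. The left side is the state at the inlet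
  \<open>x = 0\<close> and has leading term \<open>h(s + L)\<close>; the right side is what left
  there at time \<open>\<Theta> s\<close> and has leading term \<open>h(\<Theta> s - L)\<close>. Two
  differential inequalities in \<open>y\<close> show that the \<open>L\<^sup>2\<close> norm of the
  state at time \<open>t\<close> is equivalent to the \<open>L\<^sup>2\<close> norm of
  \<open>h\<close> on the window \<open>[t - L, t + L]\<close> (\<open>energy_equiv_window\<close>).
  Exponential stability therefore gives a constant \<open>C\<close> that bounds every later window
  of every solution \<open>h\<close> by \<open>C\<close> times its first window, and this bound is
  refuted.

  The instability of the late phase is an unstable real mode. The function
  \<open>exp (\<nu> * t)\<close> solves the equation with lag \<open>\<tau>\<close> exactly when
  \<open>P \<nu> = k * exp (- \<nu> * \<tau>) * Q \<nu>\<close>, with \<open>P\<close> and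
  \<open>Q\<close> the responses of the two sides at time \<open>0\<close>. The steady response
  \<open>P 0\<close> equals \<open>cos (M * L) + sin (M * L)\<close>, which is negative because
  \<open>M * L\<close> lies between \<open>3/4 \<pi>\<close> and \<open>\<pi>\<close>, whereas
  \<open>P \<nu>\<close> is positive for large \<open>\<nu>\<close>. At two fixed points
  \<open>\<nu>\<close> on either side of the sign change a long delay makes the right side
  negligible, uniformly in \<open>k\<close>, so the intermediate value theorem gives a root
  \<open>\<nu> > 0\<close> (\<open>unstable_root\<close>).

  The mode has lag \<open>\<tau>\<close>, but the lag of the starting phase is the arbitrary function
  \<open>\<zeta>\<close>, so one must still find an initial state that leads into the mode, or
  another reason for instability. If \<open>k = 0\<close>, the mode itself is a solution. If
  \<open>k\<close> is nonzero and the derivative of \<open>\<Theta>\<close> is positive on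
  \<open>[0, 2 \<tau>]\<close>, then the equation can also be solved backwards in time, because time
  reversal exchanges its advanced and its retarded side; the mode is continued backwards to time
  \<open>0\<close> (\<open>invertible_delay_not_stable\<close>). Otherwise let \<open>s1\<close> be
  the first point where that derivative is not positive. If \<open>s1 > 0\<close>, the controller
  plays back the past in slow motion just before \<open>s1\<close>: a signal that enters there was
  emitted during a much shorter time, so its echo in the past has a squared norm smaller by a factor
  of the order of the derivative of \<open>\<Theta>\<close>, and the amplification is unbounded
  (\<open>folding_delay_not_stable\<close>). If \<open>s1 = 0\<close>, the same slow motion acts on
  a short signal that leaves at time \<open>0\<close>, and stretches it on reentry
  (\<open>flat_start_not_stable\<close>). In these cases the uniform bound fails already in the
  starting phase.

  Solutions are kept of class \<open>C\<^sup>1\<close> throughout, so that the equation and its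
  derivative must both hold wherever two pieces are joined. Signals with prescribed support that
  satisfy these two conditions exist for dimension reasons (\<open>compatible_bump\<close>).\<close>

section \<open>A power series for the Bessel function\<close>

definition bessel_coeff :: "real \<Rightarrow> nat \<Rightarrow> real" where
  "bessel_coeff M n = (- (M\<^sup>2) / 4) ^ n / (fact n)\<^sup>2"

text \<open>This is \<open>J\<^sub>0(M \<surd>z)\<close> for \<open>z \<ge> 0\<close>. As a power series in
  \<open>z\<close> it is entire, so the kernels below are smooth also where the argument
  \<open>y\<^sup>2 - (r - t)\<^sup>2\<close> of the square root vanishes.\<close>

definition bessel :: "real \<Rightarrow> real \<Rightarrow> real" where
  "bessel M z = (\<Sum>n. bessel_coeff M n * z ^ n)"

definition bessel1 :: "real \<Rightarrow> real \<Rightarrow> real" where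
  "bessel1 M z = (\<Sum>n. diffs (bessel_coeff M) n * z ^ n)"

definition bessel2 :: "real \<Rightarrow> real \<Rightarrow> real" where
  "bessel2 M z = (\<Sum>n. diffs (diffs (bessel_coeff M)) n * z ^ n)"

lemma summable_bessel: "summable (\<lambda>n. bessel_coeff M n * z ^ n)"
proof (rule summable_comparison_test_ev[OF _ summable_exp])
  show "\<forall>\<^sub>F n in sequentially. norm (bessel_coeff M n * z ^ n) \<le> inverse (fact n) * (M\<^sup>2 / 4 * \<bar>z\<bar>) ^ n"
  proof (intro always_eventually allI)
    fix n :: nat
    have "(1::real) \<le> fact n" by (simp add: fact_ge_1)
    then have "1 / (fact n)\<^sup>2 \<le> (1::real) / fact n"
      by (simp add: power2_eq_square field_simps)
    then have "(M\<^sup>2 / 4 * \<bar>z\<bar>) ^ n * (1 / (fact n)\<^sup>2) \<le> (M\<^sup>2 / 4 * \<bar>z\<bar>) ^ n * (1 / fact n)"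
      by (intro mult_left_mono) auto
    moreover have "norm (bessel_coeff M n * z ^ n) = (M\<^sup>2 / 4 * \<bar>z\<bar>) ^ n * (1 / (fact n)\<^sup>2)"
      by (simp add: bessel_coeff_def abs_mult power_abs power_mult_distrib power_divide)
    ultimately show "norm (bessel_coeff M n * z ^ n) \<le> inverse (fact n) * (M\<^sup>2 / 4 * \<bar>z\<bar>) ^ n"
      by (simp add: inverse_eq_divide mult.commute)
  qed
qed

lemma summable_bessel1: "summable (\<lambda>n. diffs (bessel_coeff M) n * z ^ n)"
  by (rule termdiff_converges_all) (rule summable_bessel)

lemma summable_bessel2: "summable (\<lambda>n. diffs (diffs (bessel_coeff M)) n * z ^ n)"
  by (rule termdiff_converges_all) (rule summable_bessel1)

lemma DERIV_bessel: "(bessel M has_real_derivative bessel1 M z) (at z)"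
  unfolding bessel_def[abs_def] bessel1_def
  by (rule termdiffs_strong_converges_everywhere) (rule summable_bessel)

lemma DERIV_bessel1: "(bessel1 M has_real_derivative bessel2 M z) (at z)"
  unfolding bessel1_def[abs_def] bessel2_def
  by (rule termdiffs_strong_converges_everywhere) (rule summable_bessel1)

lemma isCont_bessel2: "isCont (bessel2 M) z"
proof -
  have "(bessel2 M has_real_derivative (\<Sum>n. diffs (diffs (diffs (bessel_coeff M))) n * z ^ n)) (at z)"
    unfolding bessel2_def[abs_def]
    by (rule termdiffs_strong_converges_everywhere) (rule summable_bessel2)
  then show ?thesis by (rule DERIV_isCont)
qed

lemma bessel_0: "bessel M 0 = 1"
  unfolding bessel_def powser_zero by (simp add: bessel_coeff_def)

lemma bessel_neg: "bessel (- M) = bessel M" "bessel1 (- M) = bessel1 M" "bessel2 (- M) = bessel2 M"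
proof -
  have "bessel_coeff (- M) = bessel_coeff M" by (simp add: bessel_coeff_def[abs_def])
  then show "bessel (- M) = bessel M" "bessel1 (- M) = bessel1 M" "bessel2 (- M) = bessel2 M"
    by (simp_all add: bessel_def[abs_def] bessel1_def[abs_def] bessel2_def[abs_def])
qed

text \<open>Bessel's equation of order \<open>0\<close>, in the variable \<open>z\<close>: comparing
  coefficients it is the recursion
  \<open>(n + 1)\<^sup>2 a\<^sub>n\<^sub>+\<^sub>1 = - (M\<^sup>2 / 4) a\<^sub>n\<close>.\<close>

lemma bessel_ode: "z * bessel2 M z + bessel1 M z = - (M\<^sup>2 / 4) * bessel M z"
proof -
  let ?a = "bessel_coeff M"
  have rec: "real (Suc n) * real (Suc n) * ?a (Suc n) = - (M\<^sup>2 / 4) * ?a n" for n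
    by (simp add: bessel_coeff_def fact_Suc power2_eq_square field_simps del: of_nat_Suc)
  have 1: "(\<lambda>n. diffs (diffs ?a) n * z ^ n) sums bessel2 M z"
    unfolding bessel2_def by (rule summable_sums) (rule summable_bessel2)
  have "(\<lambda>n. z * (diffs (diffs ?a) n * z ^ n)) sums (z * bessel2 M z)"
    by (rule sums_mult) (rule 1)
  then have "(\<lambda>n. real (Suc n) * diffs ?a (Suc n) * z ^ Suc n) sums (z * bessel2 M z)"
    by (simp add: diffs_def algebra_simps)
  then have 2: "(\<lambda>n. real n * diffs ?a n * z ^ n) sums (z * bessel2 M z)"
    using sums_Suc_iff[of "\<lambda>n. real n * diffs ?a n * z ^ n" "z * bessel2 M z"] by simp
  have 3: "(\<lambda>n. diffs ?a n * z ^ n) sums bessel1 M z"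
    unfolding bessel1_def by (rule summable_sums) (rule summable_bessel1)
  have "(\<lambda>n. real n * diffs ?a n * z ^ n + diffs ?a n * z ^ n) sums (z * bessel2 M z + bessel1 M z)"
    by (rule sums_add[OF 2 3])
  also have "(\<lambda>n. real n * diffs ?a n * z ^ n + diffs ?a n * z ^ n) = (\<lambda>n. - (M\<^sup>2 / 4) * (?a n * z ^ n))"
  proof
    fix n
    have "real n * diffs ?a n * z ^ n + diffs ?a n * z ^ n = (real (Suc n) * real (Suc n) * ?a (Suc n)) * z ^ n"
      by (simp add: diffs_def algebra_simps)
    then show "real n * diffs ?a n * z ^ n + diffs ?a n * z ^ n = - (M\<^sup>2 / 4) * (?a n * z ^ n)"
      unfolding rec by (simp only: mult.assoc)
  qed
  finally have "(\<lambda>n. - (M\<^sup>2 / 4) * (?a n * z ^ n)) sums (z * bessel2 M z + bessel1 M z)" .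
  moreover have "(\<lambda>n. - (M\<^sup>2 / 4) * (?a n * z ^ n)) sums (- (M\<^sup>2 / 4) * bessel M z)"
    unfolding bessel_def by (intro sums_mult summable_sums summable_bessel)
  ultimately show ?thesis by (rule sums_unique2)
qed

lemmas DERIV_bessel_chain [derivative_intros] =
  DERIV_chain2[OF DERIV_bessel] DERIV_chain2[OF DERIV_bessel1]

lemma continuous_on_bessel [continuous_intros]:
  assumes "continuous_on S f"
  shows "continuous_on S (\<lambda>x. bessel M (f x))" "continuous_on S (\<lambda>x. bessel1 M (f x))"
    "continuous_on S (\<lambda>x. bessel2 M (f x))"
proof -
  have "continuous_on UNIV (bessel M)" "continuous_on UNIV (bessel1 M)" "continuous_on UNIV (bessel2 M)"
    using DERIV_isCont[OF DERIV_bessel] DERIV_isCont[OF DERIV_bessel1] isCont_bessel2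
    by (auto intro!: continuous_at_imp_continuous_on)
  then show "continuous_on S (\<lambda>x. bessel M (f x))" "continuous_on S (\<lambda>x. bessel1 M (f x))"
    "continuous_on S (\<lambda>x. bessel2 M (f x))"
    using assms by (auto intro: continuous_on_compose2)
qed

section \<open>Riemann's method in the space direction\<close>

text \<open>Differentiating the system once more shows that both components satisfy the Klein-Gordon equation
  with \<open>y\<close> as time, whose Riemann function is \<open>J\<^sub>0\<close> of the Lorentz
  distance. The kernel of the component with data \<open>h\<close> combines a derivative of this
  function and, for the coupling, \<open>N / 2\<close> times the function itself. The integration
  variable is scaled to \<open>r = t + y * s\<close>, so that the domain \<open>[-1, 1]\<close> does
  not depend on \<open>y\<close>.\<close>

definition riemann_kernel :: "real \<Rightarrow> real \<Rightarrow> real \<Rightarrow> real" where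
  "riemann_kernel N y s =
     y * (1 + s) * bessel1 N (y\<^sup>2 * (1 - s\<^sup>2)) + N / 2 * bessel N (y\<^sup>2 * (1 - s\<^sup>2))"

definition riemann_kernel_y :: "real \<Rightarrow> real \<Rightarrow> real \<Rightarrow> real" where
  "riemann_kernel_y N y s = (1 + s) * bessel1 N (y\<^sup>2 * (1 - s\<^sup>2))
     + y * (1 + s) * (2 * y * (1 - s\<^sup>2)) * bessel2 N (y\<^sup>2 * (1 - s\<^sup>2))
     + N / 2 * (2 * y * (1 - s\<^sup>2)) * bessel1 N (y\<^sup>2 * (1 - s\<^sup>2))"

definition riemann_kernel_s :: "real \<Rightarrow> real \<Rightarrow> real \<Rightarrow> real" where
  "riemann_kernel_s N y s = y * bessel1 N (y\<^sup>2 * (1 - s\<^sup>2))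
     - y * (1 + s) * (2 * s * y\<^sup>2) * bessel2 N (y\<^sup>2 * (1 - s\<^sup>2))
     - N / 2 * (2 * s * y\<^sup>2) * bessel1 N (y\<^sup>2 * (1 - s\<^sup>2))"

lemma DERIV_riemann_kernel_y:
  "((\<lambda>y. riemann_kernel N y s) has_real_derivative riemann_kernel_y N y s) (at y within A)"
  unfolding riemann_kernel_def riemann_kernel_y_def
  by (auto intro!: derivative_eq_intros simp: field_simps)

lemma DERIV_riemann_kernel_s:
  "(riemann_kernel N y has_real_derivative riemann_kernel_s N y s) (at s within A)"
  unfolding riemann_kernel_def[abs_def] riemann_kernel_s_def
  by (auto intro!: derivative_eq_intros simp: field_simps)

text \<open>The transport equation for the kernels. The left side is the derivative along the characteristic in
  the scaled variables; the second derivative of the Bessel function that it contains is removed by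
  Bessel's equation.\<close>

lemma riemann_kernel_transport:
  "(1 - s) * riemann_kernel_s N y s + y * riemann_kernel_y N y s = N * y * riemann_kernel (- N) y (- s)"
proof -
  define J J1 J2 where "J = bessel N (y\<^sup>2 * (1 - s\<^sup>2))" and "J1 = bessel1 N (y\<^sup>2 * (1 - s\<^sup>2))"
    and "J2 = bessel2 N (y\<^sup>2 * (1 - s\<^sup>2))"
  have ode: "y\<^sup>2 * (1 - s\<^sup>2) * J2 = - (N\<^sup>2 / 4) * J - J1"
    using bessel_ode[of "y\<^sup>2 * (1 - s\<^sup>2)" N] by (simp add: J_def J1_def J2_def)
  have "(1 - s) * riemann_kernel_s N y s + y * riemann_kernel_y N y s
      = 2 * y * J1 + 2 * y * (y\<^sup>2 * (1 - s\<^sup>2) * J2) + N * y\<^sup>2 * (1 - s) * J1"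
    unfolding riemann_kernel_s_def riemann_kernel_y_def J1_def[symmetric] J2_def[symmetric]
    by (simp add: algebra_simps power2_eq_square power3_eq_cube)
  also have "\<dots> = N * y * (y * (1 - s) * J1 - N / 2 * J)"
    unfolding ode by (simp add: field_simps power2_eq_square)
  also have "\<dots> = N * y * riemann_kernel (- N) y (- s)"
    by (simp add: riemann_kernel_def J_def J1_def bessel_neg)
  finally show ?thesis .
qed

lemma continuous_on_riemann_kernel [continuous_intros]:
  assumes "continuous_on S f" "continuous_on S g"
  shows "continuous_on S (\<lambda>x. riemann_kernel N (f x) (g x))"
    "continuous_on S (\<lambda>x. riemann_kernel_y N (f x) (g x))"
    "continuous_on S (\<lambda>x. riemann_kernel_s N (f x) (g x))"
  unfolding riemann_kernel_def riemann_kernel_y_def riemann_kernel_s_def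
  by (intro continuous_intros assms)+

text \<open>The component that moves towards \<open>x = L\<close> (\<open>N = M\<close>) as a function of its
  trace \<open>h\<close> at \<open>y = 0\<close>. The other component is obtained by reversing time
  and changing the sign of \<open>N\<close>, because this symmetry exchanges the two equations.\<close>

definition wave :: "real \<Rightarrow> (real \<Rightarrow> real) \<Rightarrow> real \<Rightarrow> real \<Rightarrow> real" where
  "wave N h t y = h (t + y) + integral {-1..1} (\<lambda>s. y * riemann_kernel N y s * h (t + y * s))"

definition wave_y :: "real \<Rightarrow> (real \<Rightarrow> real) \<Rightarrow> (real \<Rightarrow> real) \<Rightarrow> real \<Rightarrow> real \<Rightarrow> real" where
  "wave_y N h h' t y = h' (t + y) + integral {-1..1}
     (\<lambda>s. (riemann_kernel N y s + y * riemann_kernel_y N y s) * h (t + y * s)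
        + y * riemann_kernel N y s * (s * h' (t + y * s)))"

lemma continuous_on_UNIV_compose:
  fixes h :: "real \<Rightarrow> real"
  assumes "continuous_on UNIV h" "continuous_on S f" shows "continuous_on S (\<lambda>x. h (f x))"
  using assms by (auto intro: continuous_on_compose2)

lemma continuous_on_integral_param:
  fixes f :: "'a::topological_space \<Rightarrow> real \<Rightarrow> real"
  assumes "continuous_on (U \<times> {a..b}) (\<lambda>(x, t). f x t)"
  shows "continuous_on U (\<lambda>x. integral {a..b} (f x))"
proof -
  have "continuous_on U (\<lambda>x. integral (cbox a b) (f x))"
    by (rule integral_continuous_on_param) (use assms in simp)
  then show ?thesis by simp
qed

lemma continuous_on_wave:
  assumes "continuous_on UNIV h" "continuous_on S f" "continuous_on S g"
  shows "continuous_on S (\<lambda>x. wave N h (f x) (g x))"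
proof -
  have "continuous_on (S \<times> {-1..1}) (\<lambda>z. g (fst z) * riemann_kernel N (g (fst z)) (snd z) * h (f (fst z) + g (fst z) * snd z))"
    by (intro continuous_intros continuous_on_UNIV_compose[OF assms(1)]
        continuous_on_compose2[OF assms(2)] continuous_on_compose2[OF assms(3)]) auto
  then show ?thesis unfolding wave_def
    by (intro continuous_intros continuous_on_integral_param continuous_on_UNIV_compose[OF assms(1)] assms)
      (simp add: case_prod_beta)
qed

lemma continuous_on_wave_y:
  assumes "continuous_on UNIV h" "continuous_on UNIV h'" "continuous_on S f" "continuous_on S g"
  shows "continuous_on S (\<lambda>x. wave_y N h h' (f x) (g x))"
proof -
  have "continuous_on (S \<times> {-1..1}) (\<lambda>z. (riemann_kernel N (g (fst z)) (snd z)
      + g (fst z) * riemann_kernel_y N (g (fst z)) (snd z)) * h (f (fst z) + g (fst z) * snd z)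
      + g (fst z) * riemann_kernel N (g (fst z)) (snd z) * (snd z * h' (f (fst z) + g (fst z) * snd z)))"
    by (intro continuous_intros continuous_on_UNIV_compose[OF assms(1)] continuous_on_UNIV_compose[OF assms(2)]
        continuous_on_compose2[OF assms(3)] continuous_on_compose2[OF assms(4)]) auto
  then show ?thesis unfolding wave_y_def
    by (intro continuous_intros continuous_on_integral_param continuous_on_UNIV_compose[OF assms(2)] assms)
      (simp add: case_prod_beta)
qed

text \<open>The derivative is carried as a second function, because it is itself used as data of the equation.\<close>

definition C1 :: "(real \<Rightarrow> real) \<Rightarrow> (real \<Rightarrow> real) \<Rightarrow> bool" where
  "C1 h h' \<longleftrightarrow> (\<forall>t. (h has_real_derivative h' t) (at t)) \<and> continuous_on UNIV h'"

lemma C1_deriv: "C1 h h' \<Longrightarrow> (h has_real_derivative h' t) (at t within S)"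
  unfolding C1_def by (auto intro: has_field_derivative_at_within)

lemma C1_cont': "C1 h h' \<Longrightarrow> continuous_on UNIV h'"
  unfolding C1_def by simp

lemma C1_cont: "C1 h h' \<Longrightarrow> continuous_on UNIV h"
  unfolding C1_def by (auto intro!: continuous_at_imp_continuous_on DERIV_isCont)

lemma DERIV_wave_t:
  assumes "C1 h h'"
  shows "((\<lambda>t. wave N h t y) has_real_derivative wave N h' t y) (at t)"
proof -
  note h = C1_cont[OF assms] and h' = C1_cont'[OF assms]
  have d: "((\<lambda>t. h (t + c)) has_real_derivative h' (t + c)) (at t within A)" for c t A
    by (rule DERIV_chain2[OF C1_deriv[OF assms], THEN DERIV_cong]) (auto intro!: derivative_eq_intros)
  have "((\<lambda>t. integral (cbox (-1) 1) (\<lambda>s. y * riemann_kernel N y s * h (t + y * s)))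
      has_real_derivative integral (cbox (-1) 1) (\<lambda>s. y * riemann_kernel N y s * h' (t + y * s))) (at t within UNIV)"
  proof (rule leibniz_rule_field_derivative)
    show "((\<lambda>t. y * riemann_kernel N y s * h (t + y * s)) has_real_derivative
        y * riemann_kernel N y s * h' (t + y * s)) (at t within UNIV)" for t s
      by (rule DERIV_cmult[OF d])
    show "(\<lambda>s. y * riemann_kernel N y s * h (t + y * s)) integrable_on cbox (- 1) 1" for t
      by (intro integrable_continuous continuous_intros continuous_on_UNIV_compose[OF h])
    show "continuous_on (UNIV \<times> cbox (-1) 1) (\<lambda>(t, s). y * riemann_kernel N y s * h' (t + y * s))"
      unfolding case_prod_beta by (intro continuous_intros continuous_on_UNIV_compose[OF h'])
  qed auto
  then show ?thesis
    unfolding wave_def by (intro DERIV_add d) simp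
qed

lemma DERIV_wave_y:
  assumes "C1 h h'"
  shows "((\<lambda>y. wave N h t y) has_real_derivative wave_y N h h' t y) (at y)"
proof -
  note h = C1_cont[OF assms] and h' = C1_cont'[OF assms]
  have d: "((\<lambda>y. h (t + y * s)) has_real_derivative s * h' (t + y * s)) (at y within A)" for s y A
    by (rule DERIV_chain2[OF C1_deriv[OF assms], THEN DERIV_cong]) (auto intro!: derivative_eq_intros)
  have "((\<lambda>y. integral (cbox (-1) 1) (\<lambda>s. y * riemann_kernel N y s * h (t + y * s)))
      has_real_derivative integral (cbox (-1) 1)
      (\<lambda>s. (riemann_kernel N y s + y * riemann_kernel_y N y s) * h (t + y * s)
        + y * riemann_kernel N y s * (s * h' (t + y * s)))) (at y within UNIV)"
  proof (rule leibniz_rule_field_derivative)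
    show "((\<lambda>y. y * riemann_kernel N y s * h (t + y * s)) has_real_derivative
        (riemann_kernel N y s + y * riemann_kernel_y N y s) * h (t + y * s)
        + y * riemann_kernel N y s * (s * h' (t + y * s))) (at y within UNIV)" for y s
      by (rule DERIV_cong[OF DERIV_mult[OF DERIV_mult[OF DERIV_ident DERIV_riemann_kernel_y] d]])
        (simp add: algebra_simps)
    show "(\<lambda>s. y * riemann_kernel N y s * h (t + y * s)) integrable_on cbox (- 1) 1" for y
      by (intro integrable_continuous continuous_intros continuous_on_UNIV_compose[OF h])
    show "continuous_on (UNIV \<times> cbox (-1) 1) (\<lambda>(y, s). (riemann_kernel N y s + y * riemann_kernel_y N y s) * h (t + y * s)
        + y * riemann_kernel N y s * (s * h' (t + y * s)))"
      unfolding case_prod_beta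
      by (intro continuous_intros continuous_on_UNIV_compose[OF h'] continuous_on_UNIV_compose[OF h])
  qed auto
  then show ?thesis
    unfolding wave_def wave_y_def using d[of 1] by (intro DERIV_add) simp_all
qed

text \<open>This is one of the two equations; the other one is the same statement for the reflected trace and
  \<open>- N\<close>. After differentiation under the integral sign, the terms with
  \<open>h'\<close> carry the factor \<open>1 - s\<close> and are integrated by parts; the boundary
  term at \<open>s = 1\<close> vanishes, the one at \<open>s = -1\<close> is the leading term
  \<open>h(t - y)\<close> of the coupling, and the remaining integrand is zero by the transport
  equation for the kernel.\<close>

lemma wave_transport:
  assumes "C1 h h'"
  shows "wave N h' t y - wave_y N h h' t y + N * wave (- N) (\<lambda>r. h (- r)) (- t) y = 0"
proof -
  note h = C1_cont[OF assms] and h' = C1_cont'[OF assms]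
  define K Ks Ky where "K = riemann_kernel N y" and "Ks = riemann_kernel_s N y" and "Ky = riemann_kernel_y N y"
  have d: "((\<lambda>s. h (t + y * s)) has_real_derivative y * h' (t + y * s)) (at s within A)" for s A
    by (rule DERIV_chain2[OF C1_deriv[OF assms], THEN DERIV_cong]) (auto intro!: derivative_eq_intros)
  have "((\<lambda>s. (1 - s) * K s * h (t + y * s)) has_real_derivative
      ((1 - s) * Ks s - K s) * h (t + y * s) + (1 - s) * K s * (y * h' (t + y * s))) (at s within {-1..1})" for s
    unfolding K_def Ks_def
    by (rule DERIV_cong[OF DERIV_mult[OF DERIV_mult[OF DERIV_diff[OF DERIV_const DERIV_ident] DERIV_riemann_kernel_s] d]])
      (simp add: algebra_simps)
  then have "((\<lambda>s. ((1 - s) * Ks s - K s) * h (t + y * s) + (1 - s) * K s * (y * h' (t + y * s)))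
      has_integral (1 - 1) * K 1 * h (t + y * 1) - (1 - (-1)) * K (-1) * h (t + y * (-1))) {-1..1}"
    by (intro fundamental_theorem_of_calculus) (auto simp: has_real_derivative_iff_has_vector_derivative)
  moreover have "K (-1) = N / 2" by (simp add: K_def riemann_kernel_def bessel_0)
  ultimately have 1: "((\<lambda>s. ((1 - s) * Ks s - K s) * h (t + y * s) + (1 - s) * K s * (y * h' (t + y * s)))
      has_integral - N * h (t - y)) {-1..1}"
    by simp
  have i1: "((\<lambda>s. y * K s * h' (t + y * s)) has_integral wave N h' t y - h' (t + y)) {-1..1}"
    unfolding wave_def K_def
    by (simp, intro integrable_integral integrable_continuous_real continuous_intros continuous_on_UNIV_compose[OF h'])
  have i2: "((\<lambda>s. (K s + y * Ky s) * h (t + y * s) + y * K s * (s * h' (t + y * s)))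
      has_integral wave_y N h h' t y - h' (t + y)) {-1..1}"
    unfolding wave_y_def K_def Ky_def
    by (simp, intro integrable_integral integrable_continuous_real continuous_intros
        continuous_on_UNIV_compose[OF h'] continuous_on_UNIV_compose[OF h])
  have "((\<lambda>s. y * riemann_kernel (- N) y s * h (- (- t + y * s)))
      has_integral wave (- N) (\<lambda>r. h (- r)) (- t) y - h (t - y)) {-1..1}"
    unfolding wave_def
    by (simp, intro integrable_integral integrable_continuous_real continuous_intros continuous_on_UNIV_compose[OF h])
  then have "((\<lambda>s. (\<lambda>s. y * riemann_kernel (- N) y s * h (- (- t + y * s))) (- s))
      has_integral wave (- N) (\<lambda>r. h (- r)) (- t) y - h (t - y)) {-1..1}"
    by (subst has_integral_reflect_real[symmetric]) simp
  then have i3: "((\<lambda>s. y * riemann_kernel (- N) y (- s) * h (t + y * s))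
      has_integral wave (- N) (\<lambda>r. h (- r)) (- t) y - h (t - y)) {-1..1}"
    by (simp add: add.commute)
  have "((\<lambda>s. y * K s * h' (t + y * s) - ((K s + y * Ky s) * h (t + y * s) + y * K s * (s * h' (t + y * s)))
      + N * (y * riemann_kernel (- N) y (- s) * h (t + y * s)))
      has_integral (wave N h' t y - h' (t + y)) - (wave_y N h h' t y - h' (t + y))
        + N * (wave (- N) (\<lambda>r. h (- r)) (- t) y - h (t - y))) {-1..1}"
    by (intro has_integral_add has_integral_diff has_integral_mult_right i1 i2 i3)
  also have "(\<lambda>s. y * K s * h' (t + y * s) - ((K s + y * Ky s) * h (t + y * s) + y * K s * (s * h' (t + y * s)))
      + N * (y * riemann_kernel (- N) y (- s) * h (t + y * s)))
      = (\<lambda>s. ((1 - s) * Ks s - K s) * h (t + y * s) + (1 - s) * K s * (y * h' (t + y * s)))"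
  proof
    fix s
    have "N * y * riemann_kernel (- N) y (- s) * h (t + y * s) = ((1 - s) * Ks s + y * Ky s) * h (t + y * s)"
      using riemann_kernel_transport[of s N y] by (simp add: K_def Ks_def Ky_def)
    then show "y * K s * h' (t + y * s) - ((K s + y * Ky s) * h (t + y * s) + y * K s * (s * h' (t + y * s)))
      + N * (y * riemann_kernel (- N) y (- s) * h (t + y * s))
      = ((1 - s) * Ks s - K s) * h (t + y * s) + (1 - s) * K s * (y * h' (t + y * s))"
      by (simp add: algebra_simps)
  qed
  finally have "wave N h' t y - h' (t + y) - (wave_y N h h' t y - h' (t + y))
        + N * (wave (- N) (\<lambda>r. h (- r)) (- t) y - h (t - y)) = - N * h (t - y)"
    using 1 by (rule has_integral_unique)
  then show ?thesis by (simp add: algebra_simps)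
qed

section \<open>Classical solutions are solutions in the Sobolev sense\<close>

lemmas integral_eqI = Henstock_Kurzweil_Integration.integral_cong

lemma lebesgue_on_open_interval_continuous:
  fixes f :: "real \<Rightarrow> real"
  assumes "continuous_on {0..L} f"
  shows "integrable (lebesgue_on {0<..<L}) f"
    and "integral\<^sup>L (lebesgue_on {0<..<L}) f = integral {0..L} f"
proof -
  have "f absolutely_integrable_on {0..L}"
    by (rule absolutely_integrable_continuous_real) (rule assms)
  then have "f absolutely_integrable_on {0<..<L}"
    by (rule set_integrable_subset) auto
  then show i: "integrable (lebesgue_on {0<..<L}) f"
    by (simp add: integrable_restrict_space set_integrable_def)
  show "integral\<^sup>L (lebesgue_on {0<..<L}) f = integral {0..L} f"
    by (simp add: lebesgue_integral_eq_integral[OF i] integral_open_interval_real)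
qed

lemma in_L2_continuous: "continuous_on {0..L} f \<Longrightarrow> in_L2 L f"
  unfolding in_L2_def
  by (auto intro!: lebesgue_on_open_interval_continuous(1) continuous_intros
      borel_measurable_integrable[OF lebesgue_on_open_interval_continuous(1)])

lemma L2_norm_continuous:
  "continuous_on {0..L} f \<Longrightarrow> L2_norm L f = sqrt (integral {0..L} (\<lambda>x. (f x)\<^sup>2))"
  unfolding L2_norm_def
  by (subst lebesgue_on_open_interval_continuous(2)) (auto intro!: continuous_intros)

lemma L2_norm_le_sup:
  assumes "continuous_on {0..L} f" "\<And>x. x \<in> {0..L} \<Longrightarrow> \<bar>f x\<bar> \<le> e" "0 \<le> e" "0 \<le> L"
  shows "L2_norm L f \<le> e * sqrt L"
proof -
  have "integral {0..L} (\<lambda>x. (f x)\<^sup>2) \<le> integral {0..L} (\<lambda>x. e\<^sup>2)"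
  proof (rule integral_le)
    show "(\<lambda>x. (f x)\<^sup>2) integrable_on {0..L}"
      by (intro integrable_continuous_real continuous_intros assms)
    show "(f x)\<^sup>2 \<le> e\<^sup>2" if "x \<in> {0..L}" for x
      using power_mono[OF assms(2)[OF that], of 2] by simp
  qed auto
  also have "\<dots> = e\<^sup>2 * L" using assms by simp
  finally show ?thesis
    unfolding L2_norm_continuous[OF assms(1)]
    using assms(3,4) by (intro real_le_lsqrt) (auto simp: power_mult_distrib)
qed

lemma L2_norm_nonneg: "0 \<le> L2_norm L f"
  unfolding L2_norm_def by simp

lemma H1_with_derivative_classical:
  fixes u v :: "real \<Rightarrow> real"
  assumes u: "continuous_on {0..L} u" and v: "continuous_on {0..L} v" and L: "0 \<le> L"
    and D: "\<And>x. x \<in> {0<..<L} \<Longrightarrow> (u has_real_derivative v x) (at x)"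
  shows "H1_with_derivative L u v"
  unfolding H1_with_derivative_def weak_derivative_def
proof (intro conjI allI impI u in_L2_continuous v)
  fix \<phi> assume "test_function L \<phi>"
  then obtain D a b where
    D0: "\<And>x. D 0 x = \<phi> x" and Dn: "\<And>n x. (D n has_real_derivative D (Suc n) x) (at x)"
    and ab: "0 < a" "b < L" "\<And>x. x \<notin> {a..b} \<Longrightarrow> \<phi> x = 0"
    unfolding test_function_def smooth_real_on_def by auto
  have "D 0 = \<phi>" using D0 by auto
  then have d\<phi>: "(\<phi> has_real_derivative D 1 x) (at x)" for x using Dn[of 0 x] by simp
  then have der: "deriv \<phi> = D 1" by (auto intro: DERIV_imp_deriv)
  have c1: "continuous_on S (D 1)" for S
    using Dn[of 1] by (auto intro!: continuous_at_imp_continuous_on DERIV_isCont)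
  have c0: "continuous_on S \<phi>" for S
    using d\<phi> by (auto intro!: continuous_at_imp_continuous_on DERIV_isCont)
  have "((\<lambda>x. v x * \<phi> x + u x * D 1 x) has_integral u L * \<phi> L - u 0 * \<phi> 0) {0..L}"
  proof (rule fundamental_theorem_of_calculus_interior[OF L])
    show "continuous_on {0..L} (\<lambda>x. u x * \<phi> x)" by (intro continuous_intros u c0)
    fix x assume "x \<in> {0<..<L}"
    then show "((\<lambda>x. u x * \<phi> x) has_vector_derivative v x * \<phi> x + u x * D 1 x) (at x)"
      unfolding has_real_derivative_iff_has_vector_derivative[symmetric]
      by (intro DERIV_cong[OF DERIV_mult[OF D d\<phi>]]) (auto simp: algebra_simps)
  qed
  moreover have "\<phi> L = 0" "\<phi> 0 = 0" using ab by auto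
  ultimately have "integral {0..L} (\<lambda>x. v x * \<phi> x + u x * D 1 x) = 0" by auto
  moreover have "integral {0..L} (\<lambda>x. v x * \<phi> x + u x * D 1 x)
      = integral {0..L} (\<lambda>x. v x * \<phi> x) + integral {0..L} (\<lambda>x. u x * D 1 x)"
    by (intro integral_add integrable_continuous_real continuous_intros u v c0 c1)
  ultimately show "(\<integral>x. u x * deriv \<phi> x \<partial>lebesgue_on {0<..<L})
      = - (\<integral>x. v x * \<phi> x \<partial>lebesgue_on {0<..<L})"
    unfolding der
    by (subst (1 2) lebesgue_on_open_interval_continuous(2))
      (auto intro!: continuous_intros u v c0 c1[unfolded One_nat_def])
qed

text \<open>Joint continuity on the compact set \<open>[t - 1, t + 1] \<times> [0, L]\<close> makes the
  convergence in time uniform in \<open>x\<close>, so that it implies convergence in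
  \<open>L\<^sup>2\<close>.\<close>

lemma uniform_in_space:
  fixes F :: "real \<Rightarrow> real \<Rightarrow> real"
  assumes "continuous_on (UNIV \<times> {0..L}) (\<lambda>(t, x). F t x)" "0 < e"
  obtains d where "0 < d" "\<And>s x. \<bar>s - t\<bar> < d \<Longrightarrow> x \<in> {0..L} \<Longrightarrow> \<bar>F s x - F t x\<bar> < e"
proof -
  have "uniformly_continuous_on ({t - 1..t + 1} \<times> {0..L}) (\<lambda>(t, x). F t x)"
    by (intro compact_uniformly_continuous continuous_on_subset[OF assms(1)] compact_Times) auto
  then obtain d where d: "d > 0" "\<And>p q. p \<in> {t - 1..t + 1} \<times> {0..L} \<Longrightarrow> q \<in> {t - 1..t + 1} \<times> {0..L} \<Longrightarrow>
      dist q p < d \<Longrightarrow> dist ((\<lambda>(t, x). F t x) q) ((\<lambda>(t, x). F t x) p) < e"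
    unfolding uniformly_continuous_on_def using assms(2) by metis
  show thesis
  proof (rule that[of "min d 1"])
    fix s x assume s: "\<bar>s - t\<bar> < min d 1" and x: "x \<in> {0..L}"
    have "dist (s, x) (t, x) < d" using s by (simp add: dist_Pair_Pair dist_real_def)
    moreover have "s \<in> {t - 1..t + 1}" using s by (auto simp: abs_less_iff)
    ultimately show "\<bar>F s x - F t x\<bar> < e"
      using d(2)[of "(t, x)" "(s, x)"] x by (simp add: dist_real_def)
  qed (use d in auto)
qed

lemma continuous_on_slice:
  assumes "continuous_on (UNIV \<times> {0..L}) (\<lambda>(t, x). F t x)"
  shows "continuous_on {0..L} (F (t::real) :: real \<Rightarrow> real)"
proof -
  have "continuous_on {0..L} (\<lambda>x. (\<lambda>(t, x). F t x) (t, x))"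
    by (rule continuous_on_compose2[OF assms]) (auto intro!: continuous_intros)
  then show ?thesis by simp
qed

lemma L2_continuous_classical:
  fixes F :: "real \<Rightarrow> real \<Rightarrow> real"
  assumes F: "continuous_on (UNIV \<times> {0..L}) (\<lambda>(t, x). F t x)" and L: "0 < L"
  shows "L2_continuous L F"
  unfolding L2_continuous_def
proof (intro conjI allI impI in_L2_continuous continuous_on_slice[OF F])
  fix t :: real
  show "((\<lambda>s. L2_norm L (\<lambda>x. F s x - F t x)) \<longlongrightarrow> 0) (at t within {0..})"
    unfolding tendsto_iff
  proof (intro allI impI)
    fix e :: real assume "0 < e"
    define e' where "e' = e / (2 * sqrt L)"
    have e': "0 < e'" "e' * sqrt L < e" using \<open>0 < e\<close> L by (auto simp: e'_def)
    obtain d where d: "0 < d" "\<And>s x. \<bar>s - t\<bar> < d \<Longrightarrow> x \<in> {0..L} \<Longrightarrow> \<bar>F s x - F t x\<bar> < e'"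
      using uniform_in_space[OF F e'(1)] by blast
    have "L2_norm L (\<lambda>x. F s x - F t x) < e" if "\<bar>s - t\<bar> < d" for s
    proof -
      have "L2_norm L (\<lambda>x. F s x - F t x) \<le> e' * sqrt L"
        using d(2)[OF that] e' L
        by (intro L2_norm_le_sup continuous_intros continuous_on_slice[OF F]) (auto intro: less_imp_le)
      then show ?thesis using e' by simp
    qed
    then show "\<forall>\<^sub>F s in at t within {0..}. dist (L2_norm L (\<lambda>x. F s x - F t x)) 0 < e"
      unfolding eventually_at using d(1) L2_norm_nonneg
      by (intro exI[of _ d]) (auto simp: dist_real_def)
  qed
qed

text \<open>The mean value theorem turns the difference quotient at \<open>x\<close> into a value of
  \<open>ut\<close> at an intermediate time, which depends on \<open>x\<close>; uniformity in space
  is what makes this harmless.\<close>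

lemma L2_time_derivative_classical:
  fixes u ut :: "real \<Rightarrow> real \<Rightarrow> real"
  assumes u: "continuous_on (UNIV \<times> {0..L}) (\<lambda>(t, x). u t x)"
    and ut: "continuous_on (UNIV \<times> {0..L}) (\<lambda>(t, x). ut t x)" and L: "0 < L"
    and D: "\<And>t x. x \<in> {0..L} \<Longrightarrow> ((\<lambda>t. u t x) has_real_derivative ut t x) (at t)"
  shows "L2_time_derivative L u ut"
  unfolding L2_time_derivative_def
proof (intro allI impI)
  fix t :: real
  show "((\<lambda>s. L2_norm L (\<lambda>x. (u s x - u t x) / (s - t) - ut t x)) \<longlongrightarrow> 0) (at t within {0..})"
    unfolding tendsto_iff
  proof (intro allI impI)
    fix e :: real assume "0 < e"
    define e' where "e' = e / (2 * sqrt L)"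
    have e': "0 < e'" "e' * sqrt L < e" using \<open>0 < e\<close> L by (auto simp: e'_def)
    obtain d where d: "0 < d" "\<And>s x. \<bar>s - t\<bar> < d \<Longrightarrow> x \<in> {0..L} \<Longrightarrow> \<bar>ut s x - ut t x\<bar> < e'"
      using uniform_in_space[OF ut e'(1)] by blast
    have "L2_norm L (\<lambda>x. (u s x - u t x) / (s - t) - ut t x) < e" if "\<bar>s - t\<bar> < d" "s \<noteq> t" for s
    proof -
      have "\<bar>(u s x - u t x) / (s - t) - ut t x\<bar> \<le> e'" if x: "x \<in> {0..L}" for x
      proof -
        obtain r where r: "\<bar>r - t\<bar> < d" "(u s x - u t x) / (s - t) = ut r x"
        proof (cases "s < t")
          case True
          then obtain r where "s < r" "r < t" "u t x - u s x = (t - s) * ut r x"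
            using MVT2[of s t "\<lambda>t. u t x" "\<lambda>t. ut t x"] D[OF x] by auto
          then show thesis using True that[of r] \<open>\<bar>s - t\<bar> < d\<close>
            by (auto simp: field_simps)
        next
          case False
          then obtain r where "t < r" "r < s" "u s x - u t x = (s - t) * ut r x"
            using MVT2[of t s "\<lambda>t. u t x" "\<lambda>t. ut t x"] D[OF x] \<open>s \<noteq> t\<close> by auto
          then show thesis using False that[of r] \<open>\<bar>s - t\<bar> < d\<close> by (auto simp: field_simps)
        qed
        then show ?thesis using d(2)[OF r(1) x] by simp
      qed
      then have "L2_norm L (\<lambda>x. (u s x - u t x) / (s - t) - ut t x) \<le> e' * sqrt L"
        using e' L \<open>s \<noteq> t\<close>
        by (intro L2_norm_le_sup continuous_intros continuous_on_slice[OF u] continuous_on_slice[OF ut]) auto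
      then show ?thesis using e' by simp
    qed
    then show "\<forall>\<^sub>F s in at t within {0..}. dist (L2_norm L (\<lambda>x. (u s x - u t x) / (s - t) - ut t x)) 0 < e"
      unfolding eventually_at using d(1) L2_norm_nonneg
      by (intro exI[of _ d]) (auto simp: dist_real_def)
  qed
qed

lemma H1_evolution_classical:
  fixes u ut ux :: "real \<Rightarrow> real \<Rightarrow> real"
  assumes "continuous_on (UNIV \<times> {0..L}) (\<lambda>(t, x). u t x)"
    and "continuous_on (UNIV \<times> {0..L}) (\<lambda>(t, x). ut t x)"
    and "continuous_on (UNIV \<times> {0..L}) (\<lambda>(t, x). ux t x)" and "0 < L"
    and "\<And>t x. ((\<lambda>t. u t x) has_real_derivative ut t x) (at t)"
    and "\<And>t x. (u t has_real_derivative ux t x) (at x)"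
  shows "H1_evolution L u ut ux"
  unfolding H1_evolution_def
  using assms by (auto intro!: H1_with_derivative_classical L2_continuous_classical
      L2_time_derivative_classical continuous_on_slice)

definition delta_plus :: "real \<Rightarrow> real \<Rightarrow> (real \<Rightarrow> real) \<Rightarrow> real \<Rightarrow> real \<Rightarrow> real" where
  "delta_plus L M h t x = wave M h t (L - x)"

definition delta_minus :: "real \<Rightarrow> real \<Rightarrow> (real \<Rightarrow> real) \<Rightarrow> real \<Rightarrow> real \<Rightarrow> real" where
  "delta_minus L M h t x = wave (- M) (\<lambda>r. h (- r)) (- t) (L - x)"

lemma C1_reflect:
  assumes "C1 h h'" shows "C1 (\<lambda>r. h (- r)) (\<lambda>r. - h' (- r))"
  unfolding C1_def
proof (intro conjI allI)
  show "((\<lambda>r. h (- r)) has_real_derivative - h' (- t)) (at t)" for t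
    by (rule DERIV_chain2[OF C1_deriv[OF assms], THEN DERIV_cong]) (auto intro!: derivative_eq_intros)
  show "continuous_on UNIV (\<lambda>r. - h' (- r))"
    by (intro continuous_intros continuous_on_UNIV_compose[OF C1_cont'[OF assms]])
qed

text \<open>At \<open>y = 0\<close> both components equal \<open>h t\<close>, so the reflection condition at
  \<open>x = L\<close> is built in.\<close>

lemma solves_pde_flat_output:
  assumes h: "C1 h h'" and L: "0 < L"
  shows "solves_pde L M (delta_plus L M h) (delta_minus L M h)"
proof -
  define g g' where "g = (\<lambda>r. h (- r))" and "g' = (\<lambda>r. - h' (- r))"
  have g: "C1 g g'" unfolding g_def g'_def by (rule C1_reflect[OF h])
  define pt px mt mx where "pt = (\<lambda>t x. wave M h' t (L - x))"
    and "px = (\<lambda>t x. - wave_y M h h' t (L - x))"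
    and "mt = (\<lambda>t x. - wave (- M) g' (- t) (L - x))"
    and "mx = (\<lambda>t x. - wave_y (- M) g g' (- t) (L - x))"
  note c = continuous_on_wave[OF C1_cont[OF h]] continuous_on_wave[OF C1_cont'[OF h]]
    continuous_on_wave[OF C1_cont[OF g]] continuous_on_wave[OF C1_cont'[OF g]]
    continuous_on_wave_y[OF C1_cont[OF h] C1_cont'[OF h]]
    continuous_on_wave_y[OF C1_cont[OF g] C1_cont'[OF g]]
  have "H1_evolution L (delta_plus L M h) pt px"
  proof (rule H1_evolution_classical)
    show "((\<lambda>t. delta_plus L M h t x) has_real_derivative pt t x) (at t)" for t x
      unfolding delta_plus_def pt_def by (rule DERIV_wave_t[OF h])
    show "(delta_plus L M h t has_real_derivative px t x) (at x)" for t x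
      unfolding delta_plus_def[abs_def] px_def
      by (rule DERIV_chain2[OF DERIV_wave_y[OF h], THEN DERIV_cong]) (auto intro!: derivative_eq_intros)
  qed (unfold delta_plus_def pt_def px_def case_prod_beta, (intro continuous_intros c L)+)
  moreover have "H1_evolution L (delta_minus L M h) mt mx"
  proof (rule H1_evolution_classical)
    show "((\<lambda>t. delta_minus L M h t x) has_real_derivative mt t x) (at t)" for t x
      unfolding delta_minus_def mt_def g_def[symmetric]
      by (rule DERIV_chain2[OF DERIV_wave_t[OF g], THEN DERIV_cong]) (auto intro!: derivative_eq_intros)
    show "(delta_minus L M h t has_real_derivative mx t x) (at x)" for t x
      unfolding delta_minus_def[abs_def] mx_def g_def[symmetric]
      by (rule DERIV_chain2[OF DERIV_wave_y[OF g], THEN DERIV_cong]) (auto intro!: derivative_eq_intros)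
  qed (unfold delta_minus_def mt_def mx_def case_prod_beta g_def[symmetric], (intro continuous_intros c L)+)
  moreover have "pt t x + px t x + M * delta_minus L M h t x = 0" for t x
    using wave_transport[OF h, of M t "L - x"] by (simp add: pt_def px_def delta_minus_def)
  moreover have "mt t x - mx t x + M * delta_plus L M h t x = 0" for t x
    using wave_transport[OF g, of "- M" "- t" "L - x"] by (simp add: mt_def mx_def delta_plus_def g_def)
  ultimately show ?thesis unfolding solves_pde_def by blast
qed

lemma wave_0: "wave N h t 0 = h t"
  by (simp add: wave_def)

lemma closed_loop_solution_flat_output:
  assumes h: "C1 h h'" and L: "0 < L"
    and start: "\<And>s. s \<in> {0..<2 * \<tau>} \<Longrightarrow> wave M h s L = k * wave (- M) (\<lambda>r. h (- r)) (- (s - \<zeta> s)) L"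
    and late: "\<And>s. s \<ge> 2 * \<tau> \<Longrightarrow> wave M h s L = k * wave (- M) (\<lambda>r. h (- r)) (- (s - \<tau>)) L"
  shows "closed_loop_solution L M k \<tau> \<zeta> (delta_plus L M h) (delta_minus L M h)"
  unfolding closed_loop_solution_def
  using solves_pde_flat_output[OF h L] start late
  by (auto simp: delta_plus_def delta_minus_def wave_0)

section \<open>Primitives and integral inequalities\<close>

text \<open>The primitive that vanishes at \<open>0\<close>, on the whole line. Many integrals below have moving
  end points, and are differentiated as differences of values of this function.\<close>

definition prim :: "(real \<Rightarrow> real) \<Rightarrow> real \<Rightarrow> real" where
  "prim f x = integral {0..x} f - integral {x..0} f"

lemma DERIV_prim:
  assumes f: "continuous_on UNIV f"
  shows "(prim f has_real_derivative f x) (at x)"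
proof -
  define n where "n = \<bar>x\<bar> + 1"
  have int: "f integrable_on {a..b}" for a b
    by (rule integrable_continuous_real) (rule continuous_on_subset[OF f], simp)
  have eq: "prim f y = integral {-n..y} f - integral {-n..0} f" if "y \<in> {-n<..<n}" for y
  proof (cases "0 \<le> y")
    case True
    have "integral {-n..0} f + integral {0..y} f = integral {-n..y} f"
      by (rule Henstock_Kurzweil_Integration.integral_combine) (use True that int in auto)
    moreover have "integral {y..0} f = 0" using True by (cases "y = 0") auto
    ultimately show ?thesis by (simp add: prim_def)
  next
    case False
    have "integral {-n..y} f + integral {y..0} f = integral {-n..0} f"
      by (rule Henstock_Kurzweil_Integration.integral_combine) (use False that int in auto)
    then show ?thesis using False by (simp add: prim_def)
  qed
  have x: "x \<in> {-n<..<n}" by (auto simp: n_def)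
  have "((\<lambda>y. integral {-n..y} f) has_real_derivative f x) (at x within {-n..n})"
    by (rule integral_has_real_derivative) (use x in \<open>auto intro: continuous_on_subset[OF f]\<close>)
  then have "((\<lambda>y. integral {-n..y} f) has_real_derivative f x) (at x)"
    using x by (simp add: at_within_Icc_at)
  then have "((\<lambda>y. integral {-n..y} f - integral {-n..0} f) has_real_derivative f x) (at x)"
    by (auto intro!: derivative_eq_intros)
  then show ?thesis
    by (rule has_field_derivative_transform_within_open[of _ _ _ "{-n<..<n}"]) (use x eq in auto)
qed

lemma prim_0 [simp]: "prim f 0 = 0" by (simp add: prim_def)

lemma C1_prim: "continuous_on UNIV f \<Longrightarrow> C1 (prim f) f"
  unfolding C1_def using DERIV_prim by auto

lemma has_integral_C1:
  assumes "C1 G g" "a \<le> b" shows "(g has_integral G b - G a) {a..b}"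
  using assms by (intro fundamental_theorem_of_calculus)
    (auto simp: has_real_derivative_iff_has_vector_derivative[symmetric] intro: C1_deriv)

lemma integral_prim:
  "continuous_on UNIV f \<Longrightarrow> a \<le> b \<Longrightarrow> integral {a..b} f = prim f b - prim f a"
  using has_integral_C1[OF C1_prim] by blast

lemma prim_mono:
  fixes f :: "real \<Rightarrow> real"
  assumes "continuous_on UNIV f" "\<And>x. 0 \<le> f x" "a \<le> b"
  shows "prim f a \<le> prim f b"
proof (rule DERIV_nonneg_imp_nondecreasing[OF assms(3)])
  fix x show "\<exists>z. (prim f has_real_derivative z) (at x) \<and> 0 \<le> z"
    using DERIV_prim[OF assms(1), of x] assms(2)[of x] by blast
qed

lemma integral_scaled:
  fixes f :: "real \<Rightarrow> real"
  assumes "continuous_on UNIV f" "0 \<le> y"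
  shows "integral {-1..1} (\<lambda>s. y * f (t + y * s)) = integral {t - y..t + y} f"
proof -
  have "((\<lambda>s. prim f (t + y * s)) has_real_derivative y * f (t + y * s)) (at s within {-1..1})" for s
    by (rule has_field_derivative_at_within,
        rule DERIV_chain2[OF DERIV_prim[OF assms(1)], THEN DERIV_cong]) (auto intro!: derivative_eq_intros)
  then have "((\<lambda>s. y * f (t + y * s)) has_integral prim f (t + y * 1) - prim f (t + y * (-1))) {-1..1}"
    by (intro fundamental_theorem_of_calculus) (auto simp: has_real_derivative_iff_has_vector_derivative)
  then have "integral {-1..1} (\<lambda>s. y * f (t + y * s)) = prim f (t + y) - prim f (t - y)"
    by (simp add: integral_unique del: integral_mult_right Henstock_Kurzweil_Integration.integral_mult_right)
  then show ?thesis
    using integral_prim[OF assms(1), of "t - y" "t + y"] assms(2) by linarith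
qed

text \<open>Cauchy-Schwarz against the constant function: \<open>f\<close> minus its mean has a nonnegative
  squared norm.\<close>

lemma integral_power2_le:
  fixes f :: "real \<Rightarrow> real"
  assumes f: "continuous_on {a..b} f" and ab: "a \<le> b"
  shows "(integral {a..b} f)\<^sup>2 \<le> (b - a) * integral {a..b} (\<lambda>x. (f x)\<^sup>2)"
proof (cases "a = b")
  case False
  define c where "c = integral {a..b} f / (b - a)"
  have i: "f integrable_on {a..b}" "(\<lambda>x. (f x)\<^sup>2) integrable_on {a..b}"
    by (auto intro!: integrable_continuous_real continuous_intros f)
  have "((\<lambda>x. (f x)\<^sup>2 - 2 * c * f x + c\<^sup>2) has_integral
      integral {a..b} (\<lambda>x. (f x)\<^sup>2) - 2 * c * integral {a..b} f + (b - a) * c\<^sup>2) {a..b}"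
    using has_integral_const_real[of "c\<^sup>2" a b] ab
    by (intro has_integral_add has_integral_diff has_integral_mult_right integrable_integral i) auto
  moreover have "0 \<le> (f x)\<^sup>2 - 2 * c * f x + c\<^sup>2" for x
    using zero_le_power2[of "f x - c"] by (simp add: power2_diff algebra_simps)
  ultimately have "0 \<le> integral {a..b} (\<lambda>x. (f x)\<^sup>2) - 2 * c * integral {a..b} f + (b - a) * c\<^sup>2"
    by (rule has_integral_nonneg)
  moreover have "integral {a..b} f = c * (b - a)" using False ab by (simp add: c_def)
  ultimately have "0 \<le> integral {a..b} (\<lambda>x. (f x)\<^sup>2) - c\<^sup>2 * (b - a)"
    by (simp add: power2_eq_square algebra_simps)
  then have "(b - a) * (c\<^sup>2 * (b - a)) \<le> (b - a) * integral {a..b} (\<lambda>x. (f x)\<^sup>2)"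
    using ab by (intro mult_left_mono) auto
  moreover have "(integral {a..b} f)\<^sup>2 = (b - a) * (c\<^sup>2 * (b - a))"
    unfolding \<open>integral {a..b} f = c * (b - a)\<close> by (simp add: power2_eq_square)
  ultimately show ?thesis by simp
qed auto

section \<open>The norm of the state and the window of the trace\<close>

lemma riemann_kernel_bounded:
  obtains B where "0 < B" "\<And>N y s. \<bar>N\<bar> = \<bar>M\<bar> \<Longrightarrow> y \<in> {0..L} \<Longrightarrow> s \<in> {-1..1} \<Longrightarrow> \<bar>riemann_kernel N y s\<bar> \<le> B"
proof -
  have "\<exists>B. \<forall>y\<in>{0..L}. \<forall>s\<in>{-1..1}. \<bar>riemann_kernel N y s\<bar> \<le> B" for N
  proof -
    have "compact ((\<lambda>z. riemann_kernel N (fst z) (snd z)) ` ({0..L} \<times> {-1..1}))"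
      by (intro compact_continuous_image continuous_intros compact_Times) auto
    then obtain B where B: "\<And>z. z \<in> (\<lambda>z. riemann_kernel N (fst z) (snd z)) ` ({0..L} \<times> {-1..1}) \<Longrightarrow> norm z \<le> B"
      by (meson bounded_iff compact_imp_bounded)
    have "\<bar>riemann_kernel N y s\<bar> \<le> B" if "y \<in> {0..L}" "s \<in> {-1..1}" for y s
    proof -
      have "riemann_kernel N y s \<in> (\<lambda>z. riemann_kernel N (fst z) (snd z)) ` ({0..L} \<times> {-1..1})"
        using that by (intro image_eqI[of _ _ "(y, s)"]) auto
      then show ?thesis using B by force
    qed
    then show ?thesis by blast
  qed
  from this[of M] this[of "- M"] obtain B1 B2 where B:
    "\<And>y s. y \<in> {0..L} \<Longrightarrow> s \<in> {-1..1} \<Longrightarrow> \<bar>riemann_kernel M y s\<bar> \<le> B1"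
    "\<And>y s. y \<in> {0..L} \<Longrightarrow> s \<in> {-1..1} \<Longrightarrow> \<bar>riemann_kernel (- M) y s\<bar> \<le> B2"
    by metis
  then show thesis
  proof (intro that[of "max (max B1 B2) 1"])
    fix N y s :: real assume "\<bar>N\<bar> = \<bar>M\<bar>" "y \<in> {0..L}" "s \<in> {-1..1}"
    then show "\<bar>riemann_kernel N y s\<bar> \<le> max (max B1 B2) 1"
      using B[of y s] by (auto simp: abs_eq_iff)
  qed simp
qed

lemma wave_remainder_le:
  assumes h: "continuous_on UNIV h" and B: "\<And>s. s \<in> {-1..1} \<Longrightarrow> \<bar>riemann_kernel N y s\<bar> \<le> B" and y: "0 \<le> y"
  shows "(wave N h t y - h (t + y))\<^sup>2 \<le> 2 * B\<^sup>2 * y * integral {t - y..t + y} (\<lambda>r. (h r)\<^sup>2)"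
proof -
  have h2: "continuous_on UNIV (\<lambda>r. (h r)\<^sup>2)" by (intro continuous_intros h)
  have "(wave N h t y - h (t + y))\<^sup>2 = (integral {-1..1} (\<lambda>s. y * riemann_kernel N y s * h (t + y * s)))\<^sup>2"
    by (simp add: wave_def)
  also have "\<dots> \<le> (1 - (-1)) * integral {-1..1} (\<lambda>s. (y * riemann_kernel N y s * h (t + y * s))\<^sup>2)"
    by (intro integral_power2_le continuous_intros continuous_on_UNIV_compose[OF h]) auto
  also have "integral {-1..1} (\<lambda>s. (y * riemann_kernel N y s * h (t + y * s))\<^sup>2)
      \<le> integral {-1..1} (\<lambda>s. B\<^sup>2 * y * (y * (h (t + y * s))\<^sup>2))"
  proof (rule integral_le)
    show "(y * riemann_kernel N y s * h (t + y * s))\<^sup>2 \<le> B\<^sup>2 * y * (y * (h (t + y * s))\<^sup>2)" if "s \<in> {-1..1}" for s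
    proof -
      have "(riemann_kernel N y s)\<^sup>2 \<le> B\<^sup>2" using power_mono[OF B[OF that], of 2] by simp
      then have "(riemann_kernel N y s)\<^sup>2 * (y\<^sup>2 * (h (t + y * s))\<^sup>2) \<le> B\<^sup>2 * (y\<^sup>2 * (h (t + y * s))\<^sup>2)"
        by (rule mult_right_mono) auto
      then show ?thesis by (simp add: power2_eq_square algebra_simps)
    qed
  qed (intro integrable_continuous_real continuous_intros continuous_on_UNIV_compose[OF h])+
  also have "\<dots> = B\<^sup>2 * y * integral {t - y..t + y} (\<lambda>r. (h r)\<^sup>2)"
    using integral_scaled[OF h2 y, of t] by simp
  finally show ?thesis by (simp add: algebra_simps)
qed

text \<open>The squared \<open>L\<^sup>2\<close> norm of the part of the trace that determines the state at time
  \<open>t\<close>.\<close>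

definition window :: "real \<Rightarrow> (real \<Rightarrow> real) \<Rightarrow> real \<Rightarrow> real" where
  "window L h t = integral {t - L..t + L} (\<lambda>r. (h r)\<^sup>2)"

abbreviation prim_sq :: "(real \<Rightarrow> real) \<Rightarrow> real \<Rightarrow> real" where
  "prim_sq h \<equiv> prim (\<lambda>r. (h r)\<^sup>2)"

lemma window_prim:
  assumes "continuous_on UNIV h" "0 \<le> L"
  shows "window L h t = prim_sq h (t + L) - prim_sq h (t - L)"
  unfolding window_def by (rule integral_prim) (use assms in \<open>auto intro!: continuous_intros\<close>)

lemma window_mono:
  assumes "continuous_on UNIV h" "0 \<le> y" "y \<le> L"
  shows "window y h t \<le> window L h t"
proof -
  have "continuous_on UNIV (\<lambda>r. (h r)\<^sup>2)" by (intro continuous_intros assms)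
  then have "prim_sq h (t + y) \<le> prim_sq h (t + L)"
    "prim_sq h (t - L) \<le> prim_sq h (t - y)"
    using assms by (auto intro!: prim_mono)
  then show ?thesis using assms by (simp add: window_prim)
qed

lemma window_nonneg: "0 \<le> window L h t"
  unfolding window_def by (cases "(\<lambda>r. (h r)\<^sup>2) integrable_on {t - L..t + L}")
    (auto intro!: integral_nonneg simp: not_integrable_integral)

lemma window_reflect: "window L (\<lambda>r. h (- r)) (- t) = window L h t"
proof -
  have "integral {- (t + L)..- (t - L)} (\<lambda>r. (h (- r))\<^sup>2) = integral {t - L..t + L} (\<lambda>r. (h r)\<^sup>2)"
    by (rule Henstock_Kurzweil_Integration.integral_reflect_real)
  then show ?thesis by (simp add: window_def)
qed

definition energy_density :: "real \<Rightarrow> (real \<Rightarrow> real) \<Rightarrow> real \<Rightarrow> real \<Rightarrow> real" where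
  "energy_density M h t y = (wave M h t y)\<^sup>2 + (wave (- M) (\<lambda>r. h (- r)) (- t) y)\<^sup>2"

lemma continuous_energy_density:
  assumes "continuous_on UNIV h" shows "continuous_on S (energy_density M h t)"
proof -
  have "continuous_on UNIV (\<lambda>r. h (- r))"
    by (intro continuous_on_UNIV_compose[OF assms] continuous_intros)
  then show ?thesis unfolding energy_density_def[abs_def]
    by (intro continuous_intros continuous_on_wave assms)
qed

lemma L2_norm_pair_flat_output:
  assumes h: "continuous_on UNIV h" and L: "0 \<le> L"
  shows "(L2_norm_pair L (delta_plus L M h t) (delta_minus L M h t))\<^sup>2 = prim (energy_density M h t) L"
proof -
  have c1: "continuous_on S (\<lambda>x. wave M h t (L - x))" for S
    by (intro continuous_on_wave[OF h] continuous_intros)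
  have c2: "continuous_on S (\<lambda>x. wave (- M) (\<lambda>r. h (- r)) (- t) (L - x))" for S
    by (intro continuous_on_wave continuous_intros continuous_on_UNIV_compose[OF h])
  have n: "0 \<le> integral {0..L} (\<lambda>x. (wave M h t (L - x))\<^sup>2)"
    "0 \<le> integral {0..L} (\<lambda>x. (wave (- M) (\<lambda>r. h (- r)) (- t) (L - x))\<^sup>2)"
    by (auto intro!: integral_nonneg integrable_continuous_real continuous_intros c1 c2)
  have "(L2_norm_pair L (delta_plus L M h t) (delta_minus L M h t))\<^sup>2 =
      integral {0..L} (\<lambda>x. (wave M h t (L - x))\<^sup>2) + integral {0..L} (\<lambda>x. (wave (- M) (\<lambda>r. h (- r)) (- t) (L - x))\<^sup>2)"
    unfolding L2_norm_pair_def delta_plus_def[abs_def] delta_minus_def[abs_def]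
    using n by (simp add: L2_norm_continuous[OF c1] L2_norm_continuous[OF c2])
  also have "\<dots> = integral {0..L} (\<lambda>x. energy_density M h t (L - x))"
    unfolding energy_density_def
    by (rule integral_add[symmetric]) (auto intro!: integrable_continuous_real continuous_intros c1 c2)
  also have "\<dots> = prim (energy_density M h t) L"
  proof -
    have "((\<lambda>x. energy_density M h t (L - x)) has_integral
        (- prim (energy_density M h t) (L - L)) - (- prim (energy_density M h t) (L - 0))) {0..L}"
    proof (rule fundamental_theorem_of_calculus[OF L])
      fix x
      show "((\<lambda>x. - prim (energy_density M h t) (L - x)) has_vector_derivative energy_density M h t (L - x)) (at x within {0..L})"
        unfolding has_real_derivative_iff_has_vector_derivative[symmetric]
        by (rule has_field_derivative_at_within,
            rule DERIV_cong[OF DERIV_minus[OF DERIV_chain2[OF DERIV_prim[OF continuous_energy_density[OF h]]]]])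
          (auto intro!: derivative_eq_intros)
    qed
    then show ?thesis by (simp add: integral_unique)
  qed
  finally show ?thesis .
qed

lemma square_sum2_le: "(a + b)\<^sup>2 \<le> 2 * a\<^sup>2 + 2 * (b::real)\<^sup>2"
proof -
  have "0 \<le> (a - b)\<^sup>2" by simp
  then show ?thesis by (simp add: power2_eq_square algebra_simps)
qed

text \<open>With \<open>E y\<close> the energy of the state between \<open>x = L - y\<close> and
  \<open>x = L\<close>, and \<open>H y\<close> the window of radius \<open>y\<close>, the
  derivatives of \<open>E\<close> and \<open>H\<close> are the sums of the squares of the two
  components and of their leading terms, respectively. The remainders are integrals over the window,
  so each derivative is at most twice the other one plus a multiple of \<open>H\<close>. One bound
  follows directly since \<open>H\<close> increases, the other one from Gronwall's inequality.\<close>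

lemma energy_equiv_window:
  assumes L: "0 < L"
  obtains C where "0 < C"
    "\<And>h t. continuous_on UNIV h \<Longrightarrow> prim (energy_density M h t) L \<le> C * window L h t"
    "\<And>h t. continuous_on UNIV h \<Longrightarrow> window L h t \<le> C * prim (energy_density M h t) L"
proof -
  obtain B where B: "0 < B" "\<And>N y s. \<bar>N\<bar> = \<bar>M\<bar> \<Longrightarrow> y \<in> {0..L} \<Longrightarrow> s \<in> {-1..1} \<Longrightarrow> \<bar>riemann_kernel N y s\<bar> \<le> B"
    using riemann_kernel_bounded by blast
  define K where "K = 2 * B\<^sup>2 * L"
  have K: "0 < K" using B L by (simp add: K_def)
  have rem1: "(wave N h t y - h (t + y))\<^sup>2 \<le> K * window y h t"
    if "continuous_on UNIV h" "y \<in> {0..L}" "\<bar>N\<bar> = \<bar>M\<bar>" for N h t y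
  proof -
    have "(wave N h t y - h (t + y))\<^sup>2 \<le> 2 * B\<^sup>2 * y * window y h t"
      using wave_remainder_le[OF that(1) B(2)[OF that(3,2)], of t] that by (auto simp: window_def)
    also have "\<dots> \<le> K * window y h t"
      unfolding K_def using that window_nonneg[of y h t] by (intro mult_right_mono mult_left_mono) auto
    finally show ?thesis .
  qed
  have rem2: "(wave (- M) (\<lambda>r. h (- r)) (- t) y - h (t - y))\<^sup>2 \<le> K * window y h t"
    if "continuous_on UNIV h" "y \<in> {0..L}" for h t y
  proof -
    have "continuous_on UNIV (\<lambda>r. h (- r))"
      by (intro continuous_on_UNIV_compose[OF that(1)] continuous_intros)
    from rem1[OF this that(2), of "- M" "- t"] show ?thesis by (simp add: window_reflect)
  qed
  have DW: "((\<lambda>y. prim_sq h (t + y) - prim_sq h (t - y)) has_real_derivative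
      (h (t + y))\<^sup>2 + (h (t - y))\<^sup>2) (at y)" if "continuous_on UNIV h" for h t y
  proof -
    have c: "continuous_on UNIV (\<lambda>r. (h r)\<^sup>2)" by (intro continuous_intros that)
    show ?thesis
      by (rule DERIV_cong[OF DERIV_diff[OF DERIV_chain2[OF DERIV_prim[OF c]] DERIV_chain2[OF DERIV_prim[OF c]]]])
        (auto intro!: derivative_eq_intros)
  qed
  have comb: "a \<le> 2 * p + 2 * u \<Longrightarrow> b \<le> 2 * m + 2 * v \<Longrightarrow> u \<le> w \<Longrightarrow> v \<le> w \<Longrightarrow>
      a + b \<le> 2 * (p + m) + 4 * w" for a b p m u v w :: real
    by (simp add: algebra_simps)
  define C where "C = max (2 + 4 * K * L) (2 * exp (4 * K * L))"
  show thesis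
  proof (rule that[of C])
    show "0 < C" using K L by (simp add: C_def less_max_iff_disj)
    fix h :: "real \<Rightarrow> real" and t assume h: "continuous_on UNIV h"
    define H where "H = (\<lambda>y. prim_sq h (t + y) - prim_sq h (t - y))"
    define E where "E = prim (energy_density M h t)"
    have H: "H y = window y h t" if "0 \<le> y" for y
      using window_prim[OF h that] by (simp add: H_def)
    have DH: "(H has_real_derivative (h (t + y))\<^sup>2 + (h (t - y))\<^sup>2) (at y)" for y
      unfolding H_def by (rule DW[OF h])
    have DE: "(E has_real_derivative energy_density M h t y) (at y)" for y
      unfolding E_def by (rule DERIV_prim[OF continuous_energy_density[OF h]])
    have H0: "H 0 = 0" "E 0 = 0" by (simp_all add: H_def E_def)
    have E0: "0 \<le> E L"
    proof -
      have "E 0 \<le> E L"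
      proof (rule DERIV_nonneg_imp_nondecreasing[where f = E])
        fix y show "\<exists>z. (E has_real_derivative z) (at y) \<and> 0 \<le> z"
          using DE[of y] by (intro exI[of _ "energy_density M h t y"]) (simp add: energy_density_def)
      qed (use L in simp)
      then show ?thesis using H0 by simp
    qed
    have low: "(h (t + y))\<^sup>2 + (h (t - y))\<^sup>2 \<le> 2 * energy_density M h t y + 4 * K * H y"
      and up: "energy_density M h t y \<le> 2 * ((h (t + y))\<^sup>2 + (h (t - y))\<^sup>2) + 4 * K * H y"
      if y: "y \<in> {0..L}" for y
    proof -
      define p m where "p = wave M h t y" and "m = wave (- M) (\<lambda>r. h (- r)) (- t) y"
      have r: "(p - h (t + y))\<^sup>2 \<le> K * H y" "(m - h (t - y))\<^sup>2 \<le> K * H y"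
        using rem1[OF h y, of M t] rem2[OF h y, of t] y H[of y] by (auto simp: p_def m_def)
      have "(h (t + y))\<^sup>2 \<le> 2 * p\<^sup>2 + 2 * (p - h (t + y))\<^sup>2"
        using square_sum2_le[of p "h (t + y) - p"] by (simp add: power2_commute)
      moreover have "(h (t - y))\<^sup>2 \<le> 2 * m\<^sup>2 + 2 * (m - h (t - y))\<^sup>2"
        using square_sum2_le[of m "h (t - y) - m"] by (simp add: power2_commute)
      ultimately show "(h (t + y))\<^sup>2 + (h (t - y))\<^sup>2 \<le> 2 * energy_density M h t y + 4 * K * H y"
        unfolding energy_density_def p_def[symmetric] m_def[symmetric] mult.assoc
        using r by (rule comb)
      show "energy_density M h t y \<le> 2 * ((h (t + y))\<^sup>2 + (h (t - y))\<^sup>2) + 4 * K * H y"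
        using r square_sum2_le[of "h (t + y)" "p - h (t + y)"] square_sum2_le[of "h (t - y)" "m - h (t - y)"]
        unfolding energy_density_def p_def[symmetric] m_def[symmetric] mult.assoc by simp
    qed
    have HL: "H y \<le> H L" if "y \<in> {0..L}" for y
      using window_mono[OF h, of y L t] that by (auto simp: H)
    have "E L - 2 * H L - 4 * K * H L * L \<le> E 0 - 2 * H 0 - 4 * K * H L * 0"
    proof (rule DERIV_nonpos_imp_nonincreasing[where f = "\<lambda>y. E y - 2 * H y - 4 * K * H L * y"])
      show "0 \<le> L" using L by simp
      fix y assume y: "0 \<le> y" "y \<le> L"
      have "((\<lambda>y. E y - 2 * H y - 4 * K * H L * y) has_real_derivative
          energy_density M h t y - 2 * ((h (t + y))\<^sup>2 + (h (t - y))\<^sup>2) - 4 * K * H L) (at y)"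
        using DE DH by (auto intro!: derivative_eq_intros)
      moreover have "energy_density M h t y - 2 * ((h (t + y))\<^sup>2 + (h (t - y))\<^sup>2) - 4 * K * H L \<le> 0"
      proof -
        have "4 * K * H y \<le> 4 * K * H L" using HL[of y] y K by (intro mult_left_mono) auto
        then show ?thesis using up[of y] y by auto
      qed
      ultimately show "\<exists>z. ((\<lambda>y. E y - 2 * H y - 4 * K * H L * y) has_real_derivative z) (at y) \<and> z \<le> 0"
        by blast
    qed
    then have "E L \<le> (2 + 4 * K * L) * H L" using H0 by (simp add: algebra_simps)
    also have "\<dots> \<le> C * H L"
      using window_nonneg[of L h t] L by (intro mult_right_mono) (auto simp: C_def H)
    finally show "prim (energy_density M h t) L \<le> C * window L h t"
      using L by (simp add: E_def H)
    \<comment> \<open>Gronwall: the weight absorbs the term \<open>4 K H\<close> in the bound of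
      \<open>H'\<close> by the energy density.\<close>
    have "exp (- (4 * K) * L) * H L - 2 * E L \<le> exp (- (4 * K) * 0) * H 0 - 2 * E 0"
    proof (rule DERIV_nonpos_imp_nonincreasing[where f = "\<lambda>y. exp (- (4 * K) * y) * H y - 2 * E y"])
      show "0 \<le> L" using L by simp
      fix y assume y: "0 \<le> y" "y \<le> L"
      define e where "e = exp (- (4 * K) * y)"
      have "((\<lambda>y. exp (- (4 * K) * y) * H y - 2 * E y) has_real_derivative
          e * ((h (t + y))\<^sup>2 + (h (t - y))\<^sup>2 - 4 * K * H y) - 2 * energy_density M h t y) (at y)"
        unfolding e_def by (auto intro!: derivative_eq_intros DE DH simp: algebra_simps)
      moreover have "e * ((h (t + y))\<^sup>2 + (h (t - y))\<^sup>2 - 4 * K * H y) - 2 * energy_density M h t y \<le> 0"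
      proof -
        have "e * ((h (t + y))\<^sup>2 + (h (t - y))\<^sup>2 - 4 * K * H y) \<le> e * (2 * energy_density M h t y)"
          using low[of y] y by (intro mult_left_mono) (auto simp: e_def)
        also have "\<dots> \<le> 1 * (2 * energy_density M h t y)"
          using y K by (intro mult_right_mono) (auto simp: e_def energy_density_def)
        finally show ?thesis by simp
      qed
      ultimately show "\<exists>z. ((\<lambda>y. exp (- (4 * K) * y) * H y - 2 * E y) has_real_derivative z) (at y) \<and> z \<le> 0"
        by blast
    qed
    then have "H L * exp (- (4 * K * L)) \<le> 2 * E L" using H0 by (simp add: mult.commute)
    then have "H L / exp (4 * K * L) \<le> 2 * E L" unfolding exp_minus divide_inverse .
    then have "H L \<le> 2 * exp (4 * K * L) * E L" by (simp add: divide_le_eq mult_ac)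
    also have "\<dots> \<le> C * E L"
      using E0 by (intro mult_right_mono) (auto simp: C_def)
    finally show "window L h t \<le> C * prim (energy_density M h t) L"
      using L by (simp add: E_def H)
  qed
qed

definition inlet :: "real \<Rightarrow> real \<Rightarrow> (real \<Rightarrow> real) \<Rightarrow> real \<Rightarrow> real" where
  "inlet L M h s = wave M h s L"

definition outlet :: "real \<Rightarrow> real \<Rightarrow> (real \<Rightarrow> real) \<Rightarrow> real \<Rightarrow> real" where
  "outlet L M h t = wave (- M) (\<lambda>r. h (- r)) (- t) L"

text \<open>All that is used of stability: it is tested on the classical solutions given by
  \<open>C\<^sup>1\<close> traces.\<close>

lemma exponentially_stable_window:
  assumes st: "exponentially_stable L M k \<tau> \<zeta>" and L: "0 < L" and \<tau>: "0 < \<tau>" and \<zeta>: "\<zeta> 0 = 0"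
  obtains C \<mu> where "0 < C" "0 < \<mu>"
    "\<And>h h' T. C1 h h' \<Longrightarrow> (\<And>s. s \<in> {0..<2 * \<tau>} \<Longrightarrow> inlet L M h s = k * outlet L M h (s - \<zeta> s)) \<Longrightarrow>
      (\<And>s. 2 * \<tau> \<le> s \<Longrightarrow> inlet L M h s = k * outlet L M h (s - \<tau>)) \<Longrightarrow> 0 \<le> T \<Longrightarrow>
      window L h T \<le> C * exp (- \<mu> * T) * window L h 0"
proof -
  obtain C \<mu> where C: "0 < C" "0 < \<mu>" and dec: "\<And>p0 m0 \<delta>p \<delta>m t. compatible_initial_state L k p0 m0 \<Longrightarrow>
      closed_loop_solution L M k \<tau> \<zeta> \<delta>p \<delta>m \<Longrightarrow> \<forall>x\<in>{0..L}. \<delta>p 0 x = p0 x \<and> \<delta>m 0 x = m0 x \<Longrightarrow> 0 \<le> t \<Longrightarrow>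
      L2_norm_pair L (\<delta>p t) (\<delta>m t) \<le> C * exp (- \<mu> * t) * L2_norm_pair L p0 m0"
    using st unfolding exponentially_stable_def by blast
  obtain A where A: "0 < A"
    "\<And>h t. continuous_on UNIV h \<Longrightarrow> prim (energy_density M h t) L \<le> A * window L h t"
    "\<And>h t. continuous_on UNIV h \<Longrightarrow> window L h t \<le> A * prim (energy_density M h t) L"
    using energy_equiv_window[OF L, of M] by blast
  show thesis
  proof (rule that[of "A * C\<^sup>2 * A" "2 * \<mu>"])
    fix h h' :: "real \<Rightarrow> real" and T :: real
    assume h: "C1 h h'" and T: "0 \<le> T"
      and start: "\<And>s. s \<in> {0..<2 * \<tau>} \<Longrightarrow> inlet L M h s = k * outlet L M h (s - \<zeta> s)"
      and late: "\<And>s. 2 * \<tau> \<le> s \<Longrightarrow> inlet L M h s = k * outlet L M h (s - \<tau>)"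
    let ?p = "delta_plus L M h" and ?m = "delta_minus L M h"
    have sol: "closed_loop_solution L M k \<tau> \<zeta> ?p ?m"
      using start late by (intro closed_loop_solution_flat_output[OF h L]) (auto simp: inlet_def outlet_def)
    have "compatible_initial_state L k (?p 0) (?m 0)"
    proof -
      have "in_H1 L (?p 0)" "in_H1 L (?m 0)"
        using sol unfolding closed_loop_solution_def solves_pde_def H1_evolution_def in_H1_def
        by (meson order_refl)+
      moreover have "?m 0 L = ?p 0 L" by (simp add: delta_plus_def delta_minus_def wave_0)
      moreover have "?p 0 0 = k * ?m 0 0"
        using start[of 0] \<tau> \<zeta> by (simp add: inlet_def outlet_def delta_plus_def delta_minus_def)
      ultimately show ?thesis by (simp add: compatible_initial_state_def)
    qed
    from dec[OF this sol _ T] have le: "L2_norm_pair L (?p T) (?m T) \<le> C * exp (- \<mu> * T) * L2_norm_pair L (?p 0) (?m 0)"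
      by simp
    note ch = C1_cont[OF h]
    have n: "0 \<le> L2_norm_pair L u v" for u v by (simp add: L2_norm_pair_def)
    have "window L h T \<le> A * (L2_norm_pair L (?p T) (?m T))\<^sup>2"
      using A(3)[OF ch, of T] L by (simp add: L2_norm_pair_flat_output[OF ch])
    also have "\<dots> \<le> A * (C * exp (- \<mu> * T) * L2_norm_pair L (?p 0) (?m 0))\<^sup>2"
      using A(1) le n by (intro mult_left_mono power_mono) auto
    also have "\<dots> = A * C\<^sup>2 * exp (- (2 * \<mu>) * T) * prim (energy_density M h 0) L"
    proof -
      have "(exp (- \<mu> * T))\<^sup>2 = exp (- (2 * \<mu>) * T)" by (simp add: power2_eq_square exp_add[symmetric])
      then show ?thesis using L by (simp add: power_mult_distrib L2_norm_pair_flat_output[OF ch] del: exp_minus)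
    qed
    also have "\<dots> \<le> A * C\<^sup>2 * exp (- (2 * \<mu>) * T) * (A * window L h 0)"
      using A(1) A(2)[OF ch, of 0] by (intro mult_left_mono) auto
    finally show "window L h T \<le> A * C\<^sup>2 * A * exp (- (2 * \<mu>) * T) * window L h 0"
      by (simp add: algebra_simps)
  qed (use A C in auto)
qed

section \<open>Solving the advanced and retarded equation\<close>

text \<open>Banach's theorem in the space of continuous functions that vanish up to \<open>t0\<close>, with the
  norm \<open>sup \<bar>z\<bar> / \<omega>\<close>. To use the bounded continuous functions with the
  supremum norm, a function \<open>z\<close> is represented by \<open>z / \<omega>\<close>.\<close>

lemma causal_fixed_point:
  fixes \<Psi> :: "(real \<Rightarrow> real) \<Rightarrow> real \<Rightarrow> real" and \<omega> :: "real \<Rightarrow> real"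
  assumes \<omega>: "continuous_on UNIV \<omega>" "\<And>t. 0 < \<omega> t"
    and cont: "\<And>z. continuous_on UNIV z \<Longrightarrow> (\<And>t. t \<le> t0 \<Longrightarrow> z t = 0) \<Longrightarrow> continuous_on UNIV (\<Psi> z)"
    and causal: "\<And>z t. continuous_on UNIV z \<Longrightarrow> (\<And>t. t \<le> t0 \<Longrightarrow> z t = 0) \<Longrightarrow> t \<le> t0 \<Longrightarrow> \<Psi> z t = 0"
    and base: "\<And>t. \<bar>\<Psi> (\<lambda>_. 0) t\<bar> \<le> b * \<omega> t"
    and lip: "\<And>z w d t. continuous_on UNIV z \<Longrightarrow> (\<And>t. t \<le> t0 \<Longrightarrow> z t = 0) \<Longrightarrow>
      continuous_on UNIV w \<Longrightarrow> (\<And>t. t \<le> t0 \<Longrightarrow> w t = 0) \<Longrightarrow> 0 \<le> d \<Longrightarrow>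
      (\<And>t. \<bar>z t - w t\<bar> \<le> d * \<omega> t) \<Longrightarrow> \<bar>\<Psi> z t - \<Psi> w t\<bar> \<le> d / 2 * \<omega> t"
  obtains z where "continuous_on UNIV z" "\<And>t. t \<le> t0 \<Longrightarrow> z t = 0" "\<And>t. z t = \<Psi> z t"
proof -
  define X where "X = PiC {..t0} (\<lambda>_. {0 :: real})"
  have X: "Z \<in> X \<longleftrightarrow> (\<forall>t\<le>t0. apply_bcontfun Z t = 0)" for Z :: "real \<Rightarrow>\<^sub>C real"
    by (auto simp: X_def mem_PiC_iff Pi_iff)
  define z where "z = (\<lambda>(Z :: real \<Rightarrow>\<^sub>C real) t. \<omega> t * apply_bcontfun Z t)"
  have z: "continuous_on UNIV (z Z)" for Z
    unfolding z_def by (intro continuous_intros \<omega>) auto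
  have z0: "z Z t = 0" if "Z \<in> X" "t \<le> t0" for Z t
    using that by (simp add: z_def X)
  have c0: "continuous_on UNIV (\<lambda>_. 0 :: real)" by simp
  have bd: "(\<lambda>t. \<Psi> (z Z) t / \<omega> t) \<in> bcontfun" if Z: "Z \<in> X" for Z
    unfolding bcontfun_def
  proof (intro CollectI conjI)
    show "continuous_on UNIV (\<lambda>t. \<Psi> (z Z) t / \<omega> t)"
      using \<omega>(2) by (intro continuous_intros cont z z0[OF Z] \<omega>(1)) (auto simp: less_imp_neq[symmetric])
    obtain d where d: "\<And>t. \<bar>apply_bcontfun Z t\<bar> \<le> d"
      using bounded_apply_bcontfun[of Z] unfolding bounded_iff by auto
    have "0 \<le> d" using d[of 0] by simp
    have "\<bar>z Z t - 0\<bar> \<le> d * \<omega> t" for t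
      using mult_right_mono[OF d[of t], of "\<omega> t"] \<omega>(2)[of t] by (simp add: z_def abs_mult mult.commute)
    from lip[OF z z0[OF Z] c0 refl \<open>0 \<le> d\<close> this]
    have "\<bar>\<Psi> (z Z) t - \<Psi> (\<lambda>_. 0) t\<bar> \<le> d / 2 * \<omega> t" for t .
    then have "\<bar>\<Psi> (z Z) t\<bar> \<le> (b + d / 2) * \<omega> t" for t
    proof -
      have "\<bar>\<Psi> (z Z) t\<bar> \<le> d / 2 * \<omega> t + b * \<omega> t"
        using \<open>\<bar>\<Psi> (z Z) t - \<Psi> (\<lambda>_. 0) t\<bar> \<le> d / 2 * \<omega> t\<close> base[of t] by linarith
      then show ?thesis by (simp add: algebra_simps)
    qed
    then show "bounded (range (\<lambda>t. \<Psi> (z Z) t / \<omega> t))"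
      unfolding bounded_iff using \<omega>(2)
      by (intro exI[of _ "b + d / 2"]) (auto simp: abs_divide divide_le_eq abs_of_pos)
  qed
  define F where "F = (\<lambda>Z. Bcontfun (\<lambda>t. \<Psi> (z Z) t / \<omega> t))"
  have F: "apply_bcontfun (F Z) t = \<Psi> (z Z) t / \<omega> t" if "Z \<in> X" for Z t
    unfolding F_def using Bcontfun_inverse[OF bd[OF that]] by simp
  have "\<exists>!Z. Z \<in> X \<and> F Z = Z"
  proof (rule Banach_fix[of X "1 / 2" F])
    show "complete X"
      unfolding X_def complete_eq_closed by (rule closed_PiC) simp
    show "X \<noteq> {}" using X[of "const_bcontfun 0"] by (auto simp: const_bcontfun.rep_eq)
    show "F ` X \<subseteq> X"
      using F causal[OF z z0] by (auto simp: X)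
    show "dist (F Z) (F W) \<le> 1 / 2 * dist Z W" if "Z \<in> X" "W \<in> X" for Z W
    proof (rule dist_bound)
      fix t
      have "\<bar>z Z r - z W r\<bar> \<le> dist Z W * \<omega> r" for r
      proof -
        have "\<bar>apply_bcontfun Z r - apply_bcontfun W r\<bar> \<le> dist Z W"
          using dist_bounded[of Z r W] by (simp add: dist_real_def)
        then have "\<omega> r * \<bar>apply_bcontfun Z r - apply_bcontfun W r\<bar> \<le> \<omega> r * dist Z W"
          using \<omega>(2)[of r] by (intro mult_left_mono) auto
        moreover have "\<bar>z Z r - z W r\<bar> = \<omega> r * \<bar>apply_bcontfun Z r - apply_bcontfun W r\<bar>"
          using \<omega>(2)[of r] by (simp add: z_def right_diff_distrib[symmetric] abs_mult)
        ultimately show ?thesis by (simp add: mult.commute)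
      qed
      from lip[OF z z0[OF that(1)] z z0[OF that(2)] zero_le_dist this]
      have "\<bar>\<Psi> (z Z) t - \<Psi> (z W) t\<bar> / \<omega> t \<le> dist Z W / 2"
        using \<omega>(2)[of t] by (simp add: divide_le_eq)
      then show "dist (apply_bcontfun (F Z) t) (apply_bcontfun (F W) t) \<le> 1 / 2 * dist Z W"
        using \<omega>(2)[of t] by (simp add: F that dist_real_def diff_divide_distrib[symmetric] abs_divide)
    qed
  qed auto
  then obtain Z where Z: "Z \<in> X" "F Z = Z" by auto
  show thesis
  proof (rule that[of "z Z"])
    show "z Z t = \<Psi> (z Z) t" for t
    proof -
      have "apply_bcontfun Z t = \<Psi> (z Z) t / \<omega> t" using F[OF Z(1), of t] Z(2) by simp
      then show ?thesis using \<omega>(2)[of t] by (simp add: z_def[abs_def] field_simps)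
    qed
  qed (use z z0[OF Z(1)] in auto)
qed

abbreviation conv :: "real \<Rightarrow> (real \<Rightarrow> real) \<Rightarrow> (real \<Rightarrow> real) \<Rightarrow> real \<Rightarrow> real" where
  "conv L \<alpha> h s \<equiv> integral {-1..1} (\<lambda>x. \<alpha> x * h (s + L * x))"

text \<open>The general form of the two boundary values at \<open>x = 0\<close>, with arbitrary kernels; this
  class of pairs is closed under the time reversal \<open>retarded_reflect\<close>.\<close>

definition advanced :: "real \<Rightarrow> (real \<Rightarrow> real) \<Rightarrow> (real \<Rightarrow> real) \<Rightarrow> real \<Rightarrow> real" where
  "advanced L \<alpha> h s = h (s + L) + conv L \<alpha> h s"

definition retarded :: "real \<Rightarrow> (real \<Rightarrow> real) \<Rightarrow> (real \<Rightarrow> real) \<Rightarrow> real \<Rightarrow> real" where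
  "retarded L \<beta> h t = h (t - L) + conv L \<beta> h t"

lemma continuous_on_conv:
  fixes \<alpha> h :: "real \<Rightarrow> real"
  assumes "continuous_on UNIV \<alpha>" "continuous_on UNIV h" "continuous_on S f"
  shows "continuous_on S (\<lambda>x. conv L \<alpha> h (f x))"
proof -
  have "continuous_on (S \<times> {-1..1}) (\<lambda>z. \<alpha> (snd z) * h (f (fst z) + L * snd z))"
    by (intro continuous_intros continuous_on_UNIV_compose[OF assms(1)] continuous_on_UNIV_compose[OF assms(2)]
        continuous_on_compose2[OF assms(3)]) auto
  then show ?thesis by (intro continuous_on_integral_param) (simp add: case_prod_beta)
qed

lemma continuous_on_advanced:
  assumes "continuous_on UNIV \<alpha>" "continuous_on UNIV h" "continuous_on S f"
  shows "continuous_on S (\<lambda>x. advanced L \<alpha> h (f x))" "continuous_on S (\<lambda>x. retarded L \<alpha> h (f x))"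
  unfolding advanced_def retarded_def
  by (intro continuous_intros continuous_on_conv[OF assms] continuous_on_UNIV_compose[OF assms(2)] assms(3))+

lemma conv_add:
  fixes \<alpha> h g :: "real \<Rightarrow> real"
  assumes "continuous_on UNIV \<alpha>" "continuous_on UNIV h" "continuous_on UNIV g"
  shows "integral {-1..1} (\<lambda>r. \<alpha> r * (h (s + L * r) + g (s + L * r)))
    = conv L \<alpha> h s + conv L \<alpha> g s"
proof -
  have "(\<lambda>r. \<alpha> r * u (s + L * r)) integrable_on {-1..1}" if "continuous_on UNIV u" for u :: "real \<Rightarrow> real"
    by (intro integrable_continuous_real continuous_intros continuous_on_UNIV_compose[OF that]
        continuous_on_subset[OF assms(1)]) auto
  from integral_add[OF this[OF assms(2)] this[OF assms(3)]] show ?thesis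
    by (simp add: distrib_left)
qed

lemma advanced_add:
  fixes \<alpha> h g :: "real \<Rightarrow> real"
  assumes "continuous_on UNIV \<alpha>" "continuous_on UNIV h" "continuous_on UNIV g"
  shows "advanced L \<alpha> (\<lambda>t. h t + g t) s = advanced L \<alpha> h s + advanced L \<alpha> g s"
    "retarded L \<alpha> (\<lambda>t. h t + g t) s = retarded L \<alpha> h s + retarded L \<alpha> g s"
  unfolding advanced_def retarded_def conv_add[OF assms] by auto

text \<open>Both operators look only at the window \<open>[s - L, s + L]\<close>.\<close>

lemma advanced_cong:
  assumes "0 \<le> L" "\<And>t. s - L \<le> t \<Longrightarrow> t \<le> s + L \<Longrightarrow> h t = g t"
  shows "advanced L \<alpha> h s = advanced L \<alpha> g s" "retarded L \<alpha> h s = retarded L \<alpha> g s"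
proof -
  have "conv L \<alpha> h s = conv L \<alpha> g s"
  proof (rule integral_eqI)
    fix x :: real assume "x \<in> {-1..1}"
    then have "- L \<le> L * x" "L * x \<le> L"
      using assms(1) mult_left_mono[of "-1" x L] mult_left_mono[of x 1 L] by auto
    then have "h (s + L * x) = g (s + L * x)" by (intro assms(2)) auto
    then show "\<alpha> x * h (s + L * x) = \<alpha> x * g (s + L * x)" by simp
  qed
  then show "advanced L \<alpha> h s = advanced L \<alpha> g s" "retarded L \<alpha> h s = retarded L \<alpha> g s"
    using assms by (simp_all add: advanced_def retarded_def)
qed

lemma advanced_zero:
  assumes "0 \<le> L" "\<And>t. s - L \<le> t \<Longrightarrow> t \<le> s + L \<Longrightarrow> h t = 0"
  shows "advanced L \<alpha> h s = 0" "retarded L \<alpha> h s = 0"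
proof -
  have "advanced L \<alpha> (\<lambda>_. 0) s = 0" "retarded L \<alpha> (\<lambda>_. 0) s = 0"
    by (simp_all add: advanced_def retarded_def)
  then show "advanced L \<alpha> h s = 0" "retarded L \<alpha> h s = 0"
    using advanced_cong[OF assms(1), of s h "\<lambda>_. 0" \<alpha>, OF assms(2)] by simp_all
qed

lemma exp_conv_le:
  fixes q :: real
  assumes "0 < q"
  shows "integral {-1..1} (\<lambda>x. exp (q * (x - 1))) \<le> 1 / q"
proof -
  have "((\<lambda>x. exp (q * (x - 1))) has_integral exp (q * (1 - 1)) / q - exp (q * (-1 - 1)) / q) {-1..1}"
  proof (rule fundamental_theorem_of_calculus[where f = "\<lambda>x. exp (q * (x - 1)) / q"])
    fix x
    show "((\<lambda>x. exp (q * (x - 1)) / q) has_vector_derivative exp (q * (x - 1))) (at x within {-1..1})"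
      unfolding has_real_derivative_iff_has_vector_derivative[symmetric]
      using assms by (auto intro!: derivative_eq_intros)
  qed auto
  then have "integral {-1..1} (\<lambda>x. exp (q * (x - 1))) = exp (q * (1 - 1)) / q - exp (q * (-1 - 1)) / q"
    by (rule integral_unique)
  then show ?thesis using assms by simp
qed

text \<open>A weight \<open>exp (q * t)\<close> makes the integral operators small of order
  \<open>1 / q\<close>. This is what turns the Volterra structure of the equation into a
  contraction.\<close>

lemma conv_weighted_le:
  fixes \<alpha> z :: "real \<Rightarrow> real"
  assumes \<alpha>: "continuous_on UNIV \<alpha>" "\<And>x. x \<in> {-1..1} \<Longrightarrow> \<bar>\<alpha> x\<bar> \<le> K" "0 \<le> K"
    and z: "continuous_on UNIV z" "\<And>r. \<bar>z r\<bar> \<le> d * exp (q * r)" "0 \<le> d" and q: "0 < q" and L: "0 < L"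
  shows "\<bar>conv L \<alpha> z s\<bar> \<le> K / (q * L) * (d * exp (q * (s + L)))"
proof -
  have c: "continuous_on {-1..1} (\<lambda>x. \<alpha> x * z (s + L * x))"
    by (intro continuous_intros continuous_on_UNIV_compose[OF z(1)] continuous_on_subset[OF \<alpha>(1)]) auto
  have "norm (conv L \<alpha> z s)
      \<le> integral {-1..1} (\<lambda>x. K * (d * exp (q * (s + L))) * exp (q * L * (x - 1)))"
  proof (rule integral_norm_bound_integral)
    show "(\<lambda>x. \<alpha> x * z (s + L * x)) integrable_on {-1..1}" by (rule integrable_continuous_real[OF c])
    show "(\<lambda>x. K * (d * exp (q * (s + L))) * exp (q * L * (x - 1))) integrable_on {-1..1}"
      by (intro integrable_continuous_real continuous_intros)
    fix x :: real assume x: "x \<in> {-1..1}"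
    have "q * (s + L * x) = q * (s + L) + q * L * (x - 1)" by (simp add: algebra_simps)
    then have "exp (q * (s + L * x)) = exp (q * (s + L)) * exp (q * L * (x - 1))" by (simp add: exp_add)
    then have "\<bar>\<alpha> x\<bar> * \<bar>z (s + L * x)\<bar> \<le> K * (d * (exp (q * (s + L)) * exp (q * L * (x - 1))))"
      using z(2)[of "s + L * x"] \<alpha>(2)[OF x] by (intro mult_mono) (auto simp: \<alpha>(3))
    then show "norm (\<alpha> x * z (s + L * x)) \<le> K * (d * exp (q * (s + L))) * exp (q * L * (x - 1))"
      by (simp add: abs_mult mult_ac)
  qed
  also have "\<dots> = K * (d * exp (q * (s + L))) * integral {-1..1} (\<lambda>x. exp (q * L * (x - 1)))"
    by simp
  also have "\<dots> \<le> K * (d * exp (q * (s + L))) * (1 / (q * L))"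
    using q L by (intro mult_left_mono exp_conv_le) (auto simp: \<alpha>(3) z(3))
  also have "\<dots> = K / (q * L) * (d * exp (q * (s + L)))" by simp
  finally show ?thesis by simp
qed

lemma compact_kernel_bound:
  fixes \<alpha> :: "real \<Rightarrow> real"
  assumes "continuous_on UNIV \<alpha>"
  obtains K where "0 < K" "\<And>x. x \<in> {-1..1} \<Longrightarrow> \<bar>\<alpha> x\<bar> \<le> K"
proof -
  have "bounded (\<alpha> ` {-1..1})"
    by (intro compact_imp_bounded compact_continuous_image continuous_on_subset[OF assms]) auto
  then obtain K where "\<forall>y\<in>\<alpha> ` {-1..1}. norm y \<le> K" unfolding bounded_iff by blast
  then have K: "\<bar>\<alpha> x\<bar> \<le> K" if "x \<in> {-1..1}" for x using that by auto
  show thesis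
  proof (rule that[of "max K 1"])
    show "\<bar>\<alpha> x\<bar> \<le> max K 1" if "x \<in> {-1..1}" for x
      using K[OF that] by (rule max.coboundedI1)
  qed simp
qed

text \<open>The equation that the correction \<open>z\<close> of the derivative of a solution has to satisfy.
  The coefficient \<open>c\<close> is the time at which the equation is imposed, frozen outside of
  the interval of interest: \<open>c s = max S0 s\<close> for continuation to the whole half line,
  and a clamped \<open>c\<close> when \<open>\<Theta>\<close> is meaningful on a bounded interval
  only. Since \<open>c s\<close> and \<open>\<Theta> s\<close> do not exceed \<open>s\<close> for
  \<open>s \<ge> S0\<close>, the right side at \<open>s\<close> involves \<open>z\<close> up to
  \<open>s + L\<close> only, where the value at the end enters through an integral.\<close>

lemma volterra_solution:
  fixes c \<Theta> A R \<alpha> \<beta> :: "real \<Rightarrow> real"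
  assumes L: "0 < L" and \<alpha>: "continuous_on UNIV \<alpha>" and \<beta>: "continuous_on UNIV \<beta>"
    and c: "continuous_on UNIV c" "\<And>s. c s \<le> max S0 s"
    and \<Theta>: "continuous_on UNIV \<Theta>" "\<And>s. \<Theta> s \<le> c s"
    and A: "continuous_on UNIV A" "\<And>s. \<bar>A s\<bar> \<le> a"
    and R: "continuous_on UNIV R" "\<And>s. \<bar>R s\<bar> \<le> b" "\<And>s. s \<le> S0 \<Longrightarrow> R s = 0"
  obtains z where "continuous_on UNIV z" "\<And>t. t \<le> S0 + L \<Longrightarrow> z t = 0"
    "\<And>s. z (s + L) = R s - conv L \<alpha> z (c s) + A s * retarded L \<beta> z (\<Theta> s)"
proof -
  obtain Ka where Ka: "0 < Ka" "\<And>x. x \<in> {-1..1} \<Longrightarrow> \<bar>\<alpha> x\<bar> \<le> Ka" using compact_kernel_bound[OF \<alpha>] by blast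
  obtain Kb where Kb: "0 < Kb" "\<And>x. x \<in> {-1..1} \<Longrightarrow> \<bar>\<beta> x\<bar> \<le> Kb" using compact_kernel_bound[OF \<beta>] by blast
  have a: "0 \<le> a" using A(2)[of 0] by linarith
  have b: "0 \<le> b" using R(2)[of 0] by linarith
  \<comment> \<open>The rate at which the three contributions to the Lipschitz constant add up to
    \<open>1 / 2\<close>.\<close>
  define q where "q = 2 * (Ka + a + a * Kb) / L"
  have q: "0 < q" using Ka(1) Kb(1) a L by (auto simp: q_def add_pos_nonneg)
  have qL: "(Ka + a + a * Kb) / (q * L) = 1 / 2"
  proof -
    have "q * L = 2 * (Ka + a + a * Kb)" using L by (simp add: q_def)
    moreover have "0 < Ka + a + a * Kb" using Ka(1) Kb(1) a by (simp add: add_pos_nonneg)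
    ultimately show ?thesis by simp
  qed
  define \<omega> where "\<omega> = (\<lambda>t. exp (q * t))"
  define \<Psi> where "\<Psi> = (\<lambda>z t. R (t - L) - conv L \<alpha> z (c (t - L))
      + A (t - L) * retarded L \<beta> z (\<Theta> (t - L)))"
  let ?z0 = "\<lambda>z. \<forall>t\<le>S0 + L. z t = (0::real)"
  have van: "conv L \<alpha> z (c s) = 0" "retarded L \<beta> z (\<Theta> s) = 0"
    if "?z0 z" "s \<le> S0" for z s
  proof -
    have le: "c s \<le> S0" using c(2)[of s] that by simp
    have le1: "\<Theta> s \<le> S0" using le \<Theta>(2)[of s] by simp
    have "advanced L \<alpha> z (c s) = 0"
      by (rule advanced_zero(1)) (use L le that(1) in auto)
    moreover have "z (c s + L) = 0" using that(1) le by simp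
    ultimately show "conv L \<alpha> z (c s) = 0" by (simp add: advanced_def)
    show "retarded L \<beta> z (\<Theta> s) = 0"
      by (rule advanced_zero(2)) (use L le1 that(1) in auto)
  qed
  obtain z where z: "continuous_on UNIV z" "\<And>t. t \<le> S0 + L \<Longrightarrow> z t = 0" "\<And>t. z t = \<Psi> z t"
  proof (rule causal_fixed_point[of \<omega> "S0 + L" \<Psi> "b * exp (- q * (S0 + L))"])
    show "continuous_on UNIV \<omega>" "0 < \<omega> t" for t
      by (auto simp: \<omega>_def intro!: continuous_intros)
  next
    fix z :: "real \<Rightarrow> real" assume z: "continuous_on UNIV z" "\<And>t. t \<le> S0 + L \<Longrightarrow> z t = 0"
    show "continuous_on UNIV (\<Psi> z)"
      unfolding \<Psi>_def
      by (intro continuous_intros continuous_on_UNIV_compose[OF R(1)] continuous_on_UNIV_compose[OF A(1)]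
          continuous_on_conv[OF \<alpha> z(1)] continuous_on_advanced(2)[OF \<beta> z(1)] continuous_on_UNIV_compose[OF c(1)]
          continuous_on_UNIV_compose[OF \<Theta>(1)])
    show "\<Psi> z t = 0" if "t \<le> S0 + L" for t
      using van[of z "t - L"] R(3)[of "t - L"] z(2) that by (simp add: \<Psi>_def)
  next
    fix t
    have "\<Psi> (\<lambda>_. 0) t = R (t - L)" by (simp add: \<Psi>_def retarded_def)
    moreover have "\<bar>R (t - L)\<bar> \<le> b * (exp (- q * (S0 + L)) * exp (q * t))"
    proof (cases "t \<le> S0 + L")
      case True
      then show ?thesis using R(3)[of "t - L"] b by simp
    next
      case False
      then have "0 \<le> q * (t - (S0 + L))" using q by simp
      then have "1 \<le> exp (- q * (S0 + L)) * exp (q * t)"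
        by (simp add: exp_add[symmetric] algebra_simps)
      then have "b * 1 \<le> b * (exp (- q * (S0 + L)) * exp (q * t))" using b by (intro mult_left_mono)
      then show ?thesis using R(2)[of "t - L"] by simp
    qed
    ultimately show "\<bar>\<Psi> (\<lambda>_. 0) t\<bar> \<le> b * exp (- q * (S0 + L)) * \<omega> t" by (simp add: \<omega>_def)
  next
    fix z w :: "real \<Rightarrow> real" and d t :: real
    assume z: "continuous_on UNIV z" "\<And>t. t \<le> S0 + L \<Longrightarrow> z t = 0"
      and w: "continuous_on UNIV w" "\<And>t. t \<le> S0 + L \<Longrightarrow> w t = 0" and d: "0 \<le> d"
      and zw: "\<And>t. \<bar>z t - w t\<bar> \<le> d * \<omega> t"
    show "\<bar>\<Psi> z t - \<Psi> w t\<bar> \<le> d / 2 * \<omega> t"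
    proof (cases "t \<le> S0 + L")
      case True
      then show ?thesis using van[of z "t - L"] van[of w "t - L"] z(2) w(2) d by (simp add: \<Psi>_def \<omega>_def)
    next
      case False
      define s where "s = t - L"
      have cs: "c s \<le> s" using c(2)[of s] False by (simp add: s_def)
      have Ts: "\<Theta> s \<le> s" using \<Theta>(2)[of s] cs by simp
      define u where "u = (\<lambda>r. z r + - w r)"
      have mw: "continuous_on UNIV (\<lambda>r. - w r)" by (intro continuous_intros w)
      have u: "continuous_on UNIV u" "\<And>r. \<bar>u r\<bar> \<le> d * exp (q * r)"
        using zw by (auto simp: u_def \<omega>_def intro!: continuous_intros z w)
      have mono: "d * exp (q * (x + L)) \<le> d * \<omega> t" if "x \<le> s" for x
        using that q d by (intro mult_left_mono) (auto simp: \<omega>_def s_def)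
      have I1: "\<bar>conv L \<alpha> u (c s)\<bar> \<le> Ka / (q * L) * (d * \<omega> t)"
        by (rule order_trans[OF conv_weighted_le[OF \<alpha> Ka(2) less_imp_le[OF Ka(1)] u d q L]])
          (assumption, rule mult_left_mono[OF mono[OF cs]], use Ka q L in simp)
      have I2: "\<bar>conv L \<beta> u (\<Theta> s)\<bar> \<le> Kb / (q * L) * (d * \<omega> t)"
        by (rule order_trans[OF conv_weighted_le[OF \<beta> Kb(2) less_imp_le[OF Kb(1)] u d q L]])
          (assumption, rule mult_left_mono[OF mono[OF Ts]], use Kb q L in simp)
      have I3: "\<bar>u (\<Theta> s - L)\<bar> \<le> 1 / (q * L) * (d * \<omega> t)"
      proof -
        have "\<Theta> s - L \<le> t - L" using Ts L by (simp add: s_def)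
        then have "q * (\<Theta> s - L) \<le> q * (t - L)" using q by (intro mult_left_mono) auto
        then have "q * (\<Theta> s - L) \<le> q * t - q * L" by (simp add: right_diff_distrib)
        then have "exp (q * (\<Theta> s - L)) \<le> exp (q * t - q * L)" by simp
        also have "\<dots> = \<omega> t / exp (q * L)" by (simp add: \<omega>_def exp_diff)
        also have "\<dots> \<le> \<omega> t / (q * L)"
        proof (rule divide_left_mono)
          show "q * L \<le> exp (q * L)" using exp_ge_add_one_self[of "q * L"] by linarith
        qed (use q L in \<open>auto simp: \<omega>_def\<close>)
        finally have "d * exp (q * (\<Theta> s - L)) \<le> d * (\<omega> t / (q * L))" using d by (intro mult_left_mono)
        then show ?thesis using u(2)[of "\<Theta> s - L"] by simp
      qed
      have neg: "integral {-1..1} (\<lambda>x. \<gamma> x * - w (r + L * x)) = - conv L \<gamma> w r" for \<gamma> r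
        by simp
      have "\<Psi> z t - \<Psi> w t = - conv L \<alpha> u (c s)
          + A s * (u (\<Theta> s - L) + conv L \<beta> u (\<Theta> s))"
        unfolding \<Psi>_def s_def[symmetric] u_def conv_add[OF \<alpha> z(1) mw] conv_add[OF \<beta> z(1) mw] retarded_def neg
        by (simp add: algebra_simps)
      also have "\<bar>\<dots>\<bar> \<le> Ka / (q * L) * (d * \<omega> t) + a * (1 / (q * L) * (d * \<omega> t) + Kb / (q * L) * (d * \<omega> t))"
      proof -
        have "\<bar>u (\<Theta> s - L) + conv L \<beta> u (\<Theta> s)\<bar>
            \<le> 1 / (q * L) * (d * \<omega> t) + Kb / (q * L) * (d * \<omega> t)"
          using I2 I3 by linarith
        then have "\<bar>A s * (u (\<Theta> s - L) + conv L \<beta> u (\<Theta> s))\<bar>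
            \<le> a * (1 / (q * L) * (d * \<omega> t) + Kb / (q * L) * (d * \<omega> t))"
          unfolding abs_mult using a by (intro mult_mono A) auto
        then show ?thesis using I1 by linarith
      qed
      also have "\<dots> = (Ka + a + a * Kb) / (q * L) * (d * \<omega> t)"
        by (simp add: add_divide_distrib algebra_simps)
      finally show ?thesis unfolding qL by simp
    qed
  qed auto
  show thesis
  proof (rule that[OF z(1,2)])
    fix s
    show "z (s + L) = R s - conv L \<alpha> z (c s) + A s * retarded L \<beta> z (\<Theta> s)"
      using z(3)[of "s + L"] by (simp add: \<Psi>_def)
  qed
qed

lemma DERIV_advanced:
  assumes h: "C1 h h'" and \<alpha>: "continuous_on UNIV \<alpha>"
  shows "(advanced L \<alpha> h has_real_derivative advanced L \<alpha> h' s) (at s)"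
    and "(retarded L \<alpha> h has_real_derivative retarded L \<alpha> h' s) (at s)"
proof -
  have d: "((\<lambda>s. h (s + c)) has_real_derivative h' (s + c)) (at s within A)" for c s A
    by (rule DERIV_chain2[OF C1_deriv[OF h], THEN DERIV_cong]) (auto intro!: derivative_eq_intros)
  have I: "((\<lambda>s. integral (cbox (-1) 1) (\<lambda>x. \<alpha> x * h (s + L * x)))
      has_real_derivative integral (cbox (-1) 1) (\<lambda>x. \<alpha> x * h' (s + L * x))) (at s within UNIV)"
  proof (rule leibniz_rule_field_derivative)
    show "((\<lambda>s. \<alpha> x * h (s + L * x)) has_real_derivative \<alpha> x * h' (s + L * x)) (at s within UNIV)" for s x
      by (rule DERIV_cmult[OF d])
    show "(\<lambda>x. \<alpha> x * h (s + L * x)) integrable_on cbox (- 1) 1" for s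
      by (intro integrable_continuous continuous_intros continuous_on_UNIV_compose[OF C1_cont[OF h]]
          continuous_on_subset[OF \<alpha>]) auto
    show "continuous_on (UNIV \<times> cbox (-1) 1) (\<lambda>(s, x). \<alpha> x * h' (s + L * x))"
      unfolding case_prod_beta
      by (intro continuous_intros continuous_on_UNIV_compose[OF C1_cont'[OF h]] continuous_on_UNIV_compose[OF \<alpha>])
  qed auto
  show "(advanced L \<alpha> h has_real_derivative advanced L \<alpha> h' s) (at s)"
    unfolding advanced_def[abs_def] using I by (intro DERIV_add d) simp
  show "(retarded L \<alpha> h has_real_derivative retarded L \<alpha> h' s) (at s)"
    unfolding retarded_def[abs_def] using I d[of "- L"] by (intro DERIV_add) simp_all
qed

text \<open>Time reversal exchanges the two sides of the equation, so that solving backwards is solving forwards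
  with the kernels exchanged.\<close>

lemma retarded_reflect:
  "retarded L \<beta> h t = advanced L (\<lambda>x. \<beta> (- x)) (\<lambda>r. h (- r)) (- t)"
  "advanced L \<beta> h t = retarded L (\<lambda>x. \<beta> (- x)) (\<lambda>r. h (- r)) (- t)"
proof -
  have "integral {-1..1} (\<lambda>x. \<beta> (- x) * h (- (- t + L * x))) = integral {- 1..- (- 1)} (\<lambda>x. (\<lambda>x. \<beta> x * h (t + L * x)) (- x))"
    by simp
  also have "\<dots> = conv L \<beta> h t"
    by (rule Henstock_Kurzweil_Integration.integral_reflect_real)
  finally have "integral {-1..1} (\<lambda>x. \<beta> (- x) * h (- (- t + L * x))) = conv L \<beta> h t" .
  then show "retarded L \<beta> h t = advanced L (\<lambda>x. \<beta> (- x)) (\<lambda>r. h (- r)) (- t)"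
    "advanced L \<beta> h t = retarded L (\<lambda>x. \<beta> (- x)) (\<lambda>r. h (- r)) (- t)"
    unfolding advanced_def retarded_def by (simp_all add: add.commute)
qed

lemma retarded_uminus:
  "retarded L \<beta> (\<lambda>r. - h r) t = - retarded L \<beta> h t"
  "advanced L \<beta> (\<lambda>r. - h r) t = - advanced L \<beta> h t"
  unfolding advanced_def retarded_def by simp_all

definition with_derivative :: "real \<Rightarrow> real \<Rightarrow> (real \<Rightarrow> real) \<Rightarrow> real \<Rightarrow> real" where
  "with_derivative r y v t = y + prim v t - prim v r"

lemma C1_with_derivative:
  assumes "continuous_on UNIV v"
  shows "C1 (with_derivative r y v) v"
  unfolding C1_def with_derivative_def[abs_def]
  using assms by (auto intro!: derivative_eq_intros DERIV_prim)

lemma with_derivative_eq: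
  assumes h: "C1 h h'" and v: "continuous_on UNIV v"
    and eq: "\<And>x. min r t \<le> x \<Longrightarrow> x \<le> max r t \<Longrightarrow> v x = h' x"
  shows "with_derivative r (h r) v t = h t"
proof -
  have "integral {min r t..max r t} v = integral {min r t..max r t} h'"
    by (rule integral_eqI) (use eq in auto)
  moreover have "integral {min r t..max r t} v = prim v (max r t) - prim v (min r t)"
    by (rule integral_prim[OF v]) simp
  moreover have "integral {min r t..max r t} h' = h (max r t) - h (min r t)"
    by (rule integral_unique, rule has_integral_C1[OF h]) simp
  ultimately show ?thesis by (cases "r \<le> t") (auto simp: with_derivative_def max_def min_def)
qed

text \<open>The derivative of the equation is a Volterra equation for \<open>h'\<close>. Its solution is found
  as \<open>h0' + z\<close> where \<open>z\<close> vanishes on the past; the second compatibility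
  condition says that the source of the equation for \<open>z\<close> starts from \<open>0\<close>.
  Integrating gives a \<open>C\<^sup>1\<close> function, and the first condition fixes the constant
  of integration in the equation itself.\<close>

lemma extend_solution:
  fixes c \<Theta> \<Theta>' h0 h0' \<alpha> \<beta> :: "real \<Rightarrow> real"
  assumes L: "0 < L" and \<alpha>: "continuous_on UNIV \<alpha>" and \<beta>: "continuous_on UNIV \<beta>"
    and c: "continuous_on UNIV c" "\<And>s. c s \<le> max S0 s" "\<And>s. s \<le> S0 \<Longrightarrow> c s = S0"
    and \<Theta>: "C1 \<Theta> \<Theta>'" "\<And>s. \<Theta> (c s) \<le> c s" "\<And>s. \<bar>\<Theta>' (c s)\<bar> \<le> a"
    and h0: "C1 h0 h0'"
    and R: "\<And>s. \<bar>\<kappa> * \<Theta>' (c s) * retarded L \<beta> h0' (\<Theta> (c s)) - advanced L \<alpha> h0' (c s)\<bar> \<le> b"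
    and compat: "advanced L \<alpha> h0 S0 = \<kappa> * retarded L \<beta> h0 (\<Theta> S0)"
      "advanced L \<alpha> h0' S0 = \<kappa> * \<Theta>' S0 * retarded L \<beta> h0' (\<Theta> S0)"
  obtains h h' where "C1 h h'" "\<And>t. t \<le> S0 + L \<Longrightarrow> h t = h0 t"
    "\<And>s. S0 \<le> s \<Longrightarrow> (\<And>r. r \<in> {S0..s} \<Longrightarrow> c r = r) \<Longrightarrow> advanced L \<alpha> h s = \<kappa> * retarded L \<beta> h (\<Theta> s)"
proof -
  define Rf where "Rf = (\<lambda>s. \<kappa> * \<Theta>' (c s) * retarded L \<beta> h0' (\<Theta> (c s)) - advanced L \<alpha> h0' (c s))"
  have cT: "continuous_on UNIV (\<lambda>s. \<Theta> (c s))" "continuous_on UNIV (\<lambda>s. \<Theta>' (c s))"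
    by (rule continuous_on_UNIV_compose[OF C1_cont[OF \<Theta>(1)] c(1)],
        rule continuous_on_UNIV_compose[OF C1_cont'[OF \<Theta>(1)] c(1)])
  note h0' = C1_cont'[OF h0]
  obtain z where z: "continuous_on UNIV z" "\<And>t. t \<le> S0 + L \<Longrightarrow> z t = 0"
    "\<And>s. z (s + L) = Rf s - conv L \<alpha> z (c s)
      + (\<kappa> * \<Theta>' (c s)) * retarded L \<beta> z (\<Theta> (c s))"
  proof (rule volterra_solution[OF L \<alpha> \<beta> c(1,2) cT(1) \<Theta>(2)])
    show "continuous_on UNIV (\<lambda>s. \<kappa> * \<Theta>' (c s))" by (intro continuous_intros cT)
    show "\<bar>\<kappa> * \<Theta>' (c s)\<bar> \<le> \<bar>\<kappa>\<bar> * a" for s unfolding abs_mult by (intro mult_left_mono \<Theta>) auto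
    show "continuous_on UNIV Rf" unfolding Rf_def
      by (intro continuous_intros cT continuous_on_advanced[OF \<alpha> h0' c(1)] continuous_on_advanced[OF \<beta> h0' cT(1)])
    show "\<bar>Rf s\<bar> \<le> b" for s unfolding Rf_def by (rule R)
    show "Rf s = 0" if "s \<le> S0" for s using compat(2) c(3)[OF that] by (simp add: Rf_def)
  qed blast
  define v where "v = (\<lambda>t. h0' t + z t)"
  have v: "continuous_on UNIV v" unfolding v_def by (intro continuous_intros z h0')
  define h where "h = with_derivative (S0 + L) (h0 (S0 + L)) v"
  have h: "C1 h v" unfolding h_def by (rule C1_with_derivative[OF v])
  have hh0: "h t = h0 t" if "t \<le> S0 + L" for t
    unfolding h_def by (rule with_derivative_eq[OF h0 v]) (use that z(2) in \<open>auto simp: v_def\<close>)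
  have eqv: "advanced L \<alpha> v s = \<kappa> * \<Theta>' s * retarded L \<beta> v (\<Theta> s)" if "c s = s" for s
    unfolding v_def advanced_add[OF \<alpha> h0' z(1)] advanced_add[OF \<beta> h0' z(1)]
    using z(3)[of s] that by (simp add: Rf_def advanced_def[of L \<alpha> z] algebra_simps)
  show thesis
  proof (rule that[OF h hh0])
    fix s assume s: "S0 \<le> s" "\<And>r. r \<in> {S0..s} \<Longrightarrow> c r = r"
    define F where "F = (\<lambda>s. advanced L \<alpha> h s - \<kappa> * retarded L \<beta> h (\<Theta> s))"
    have DF: "(F has_real_derivative advanced L \<alpha> v r - \<kappa> * (retarded L \<beta> v (\<Theta> r) * \<Theta>' r)) (at r)" for r
      unfolding F_def
      by (intro DERIV_diff DERIV_cmult DERIV_advanced[OF h] \<alpha> DERIV_chain2[OF DERIV_advanced(2)[OF h \<beta>]] C1_deriv[OF \<Theta>(1)])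
    have DF0: "(F has_real_derivative 0) (at r)" if "r \<in> {S0..s}" for r
      using DF[of r] eqv[OF s(2)[OF that]] by (simp add: algebra_simps)
    have "F s = F S0"
    proof (cases "S0 = s")
      case False
      show ?thesis
      proof (rule DERIV_isconst_end[where f = F])
        show "S0 < s" using False s(1) by simp
        show "continuous_on {S0..s} F"
          by (intro continuous_at_imp_continuous_on ballI DERIV_isCont[OF DF])
        show "(F has_real_derivative 0) (at x)" if "S0 < x" "x < s" for x using DF0 that by auto
      qed
    qed simp
    also have "F S0 = advanced L \<alpha> h0 S0 - \<kappa> * retarded L \<beta> h0 (\<Theta> S0)"
    proof -
      have T: "\<Theta> S0 \<le> S0" using \<Theta>(2)[of S0] c(3)[of S0] by simp
      have "advanced L \<alpha> h S0 = advanced L \<alpha> h0 S0"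
        by (rule advanced_cong(1)) (use L in \<open>auto intro!: hh0\<close>)
      moreover have "retarded L \<beta> h (\<Theta> S0) = retarded L \<beta> h0 (\<Theta> S0)"
        by (rule advanced_cong(2)) (use L T in \<open>auto intro!: hh0\<close>)
      ultimately show ?thesis by (simp add: F_def)
    qed
    finally show "advanced L \<alpha> h s = \<kappa> * retarded L \<beta> h (\<Theta> s)" using compat(1) by (simp add: F_def)
  qed
qed

section \<open>Continuation forwards and backwards in time\<close>

lemma retarded_bounded:
  assumes \<beta>: "continuous_on UNIV \<beta>" and v: "continuous_on UNIV v" "\<And>t. \<bar>v t\<bar> \<le> V"
  obtains W where "\<And>t. \<bar>retarded L \<beta> v t\<bar> \<le> W" "\<And>t. \<bar>advanced L \<beta> v t\<bar> \<le> W"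
proof -
  obtain K where K: "0 < K" "\<And>x. x \<in> {-1..1} \<Longrightarrow> \<bar>\<beta> x\<bar> \<le> K" using compact_kernel_bound[OF \<beta>] by blast
  have V: "0 \<le> V" using v(2)[of 0] by linarith
  have I: "\<bar>conv L \<beta> v t\<bar> \<le> K * V * 2" for t
  proof -
    have "norm (conv L \<beta> v t) \<le> integral {-1..1} (\<lambda>x::real. K * V)"
    proof (rule integral_norm_bound_integral)
      show "(\<lambda>x. \<beta> x * v (t + L * x)) integrable_on {-1..1}"
        by (intro integrable_continuous_real continuous_intros continuous_on_UNIV_compose[OF v(1)]
            continuous_on_subset[OF \<beta>]) auto
      show "norm (\<beta> x * v (t + L * x)) \<le> K * V" if "x \<in> {-1..1}" for x
        using mult_mono[OF K(2)[OF that] v(2)[of "t + L * x"]] K(1) by (simp add: abs_mult)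
    qed auto
    then show ?thesis by simp
  qed
  show thesis
  proof (rule that[of "V + K * V * 2"])
    show "\<bar>retarded L \<beta> v t\<bar> \<le> V + K * V * 2" for t
      unfolding retarded_def using I[of t] v(2)[of "t - L"] by linarith
    show "\<bar>advanced L \<beta> v t\<bar> \<le> V + K * V * 2" for t
      unfolding advanced_def using I[of t] v(2)[of "t + L"] by linarith
  qed
qed

text \<open>Only the values of the data on \<open>[m - L, S0 + L]\<close> enter. Outside, they are replaced by a
  linear continuation, which makes the source term bounded.\<close>

lemma extend_forward:
  fixes \<Theta> \<Theta>' h0 h0' \<alpha> \<beta> :: "real \<Rightarrow> real"
  assumes L: "0 < L" and \<alpha>: "continuous_on UNIV \<alpha>" and \<beta>: "continuous_on UNIV \<beta>"
    and \<Theta>: "C1 \<Theta> \<Theta>'" "\<And>s. S0 \<le> s \<Longrightarrow> m \<le> \<Theta> s" "\<And>s. S0 \<le> s \<Longrightarrow> \<Theta> s \<le> s" "\<And>s. S0 \<le> s \<Longrightarrow> \<bar>\<Theta>' s\<bar> \<le> a"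
    and h0: "C1 h0 h0'"
    and compat: "advanced L \<alpha> h0 S0 = \<kappa> * retarded L \<beta> h0 (\<Theta> S0)"
      "advanced L \<alpha> h0' S0 = \<kappa> * \<Theta>' S0 * retarded L \<beta> h0' (\<Theta> S0)"
  obtains h h' where "C1 h h'" "\<And>t. m - L \<le> t \<Longrightarrow> t \<le> S0 + L \<Longrightarrow> h t = h0 t"
    "\<And>s. S0 \<le> s \<Longrightarrow> advanced L \<alpha> h s = \<kappa> * retarded L \<beta> h (\<Theta> s)"
proof -
  have mS: "m \<le> \<Theta> S0" "\<Theta> S0 \<le> S0" "m \<le> S0"
    using \<Theta>(2,3)[of S0] by auto
  define v where "v = (\<lambda>t. h0' (max (m - L) (min (S0 + L) t)))"
  have v: "continuous_on UNIV v" unfolding v_def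
    by (intro continuous_on_UNIV_compose[OF C1_cont'[OF h0]] continuous_intros)
  define g where "g = with_derivative (S0 + L) (h0 (S0 + L)) v"
  have g: "C1 g v" unfolding g_def by (rule C1_with_derivative[OF v])
  have v0: "v t = h0' t" if "m - L \<le> t" "t \<le> S0 + L" for t using that by (simp add: v_def)
  have g0: "g t = h0 t" if "m - L \<le> t" "t \<le> S0 + L" for t
    unfolding g_def by (rule with_derivative_eq[OF h0 v]) (use that in \<open>auto simp: v0\<close>)
  have "bounded (h0' ` {m - L..S0 + L})"
    by (intro compact_imp_bounded compact_continuous_image continuous_on_subset[OF C1_cont'[OF h0]]) auto
  then obtain V where V: "\<forall>y\<in>h0' ` {m - L..S0 + L}. norm y \<le> V" unfolding bounded_iff by blast
  have vV: "\<bar>v t\<bar> \<le> V" for t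
  proof -
    have "max (m - L) (min (S0 + L) t) \<in> {m - L..S0 + L}" using mS L by auto
    then show ?thesis using V by (auto simp: v_def)
  qed
  obtain W where W: "\<And>t. \<bar>retarded L \<beta> v t\<bar> \<le> W"
    using retarded_bounded[OF \<beta> v vV, where L = L] by metis
  obtain W' where W': "\<And>t. \<bar>advanced L \<alpha> v t\<bar> \<le> W'"
    using retarded_bounded[OF \<alpha> v vV, where L = L] by metis
  have same: "advanced L \<gamma> g s = advanced L \<gamma> h0 s" "retarded L \<gamma> g s = retarded L \<gamma> h0 s"
    "advanced L \<gamma> v s = advanced L \<gamma> h0' s" "retarded L \<gamma> v s = retarded L \<gamma> h0' s"
    if s: "m \<le> s" "s \<le> S0" for s \<gamma>
    by (rule advanced_cong; use s L in \<open>auto simp: g0 v0\<close>)+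
  have a: "0 \<le> a" using \<Theta>(4)[of S0] by linarith
  have W0: "0 \<le> W" using W[of 0] by linarith
  obtain h h' where hh: "C1 h h'" "\<And>t. t \<le> S0 + L \<Longrightarrow> h t = g t"
    "\<And>s. S0 \<le> s \<Longrightarrow> (\<And>r. r \<in> {S0..s} \<Longrightarrow> max S0 r = r) \<Longrightarrow> advanced L \<alpha> h s = \<kappa> * retarded L \<beta> h (\<Theta> s)"
  proof (rule extend_solution[OF L \<alpha> \<beta>, where c = "max S0" and ?S0.0 = S0 and \<Theta> = \<Theta> and \<Theta>' = \<Theta>' and a = a
        and ?h0.0 = g and ?h0' = v and \<kappa> = \<kappa> and b = "\<bar>\<kappa>\<bar> * a * W + W'"])
    show "\<bar>\<kappa> * \<Theta>' (max S0 s) * retarded L \<beta> v (\<Theta> (max S0 s)) - advanced L \<alpha> v (max S0 s)\<bar> \<le> \<bar>\<kappa>\<bar> * a * W + W'" for s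
    proof -
      have "\<bar>\<kappa> * \<Theta>' (max S0 s) * retarded L \<beta> v (\<Theta> (max S0 s))\<bar> \<le> \<bar>\<kappa>\<bar> * a * W"
        unfolding abs_mult using a W0 by (intro mult_mono W \<Theta>) auto
      then show ?thesis using W'[of "max S0 s"] by linarith
    qed
  qed (use \<Theta> g compat mS in \<open>auto simp: same intro!: continuous_intros\<close>)
  show thesis
    by (rule that[OF hh(1)]) (use hh(2,3) g0 in auto)
qed

lemma C1_inverse:
  fixes F d :: "real \<Rightarrow> real"
  assumes F: "C1 F d" and m: "0 < m" "\<And>s. m \<le> d s"
  obtains \<sigma> where "\<And>s. \<sigma> (F s) = s" "\<And>t. F (\<sigma> t) = t" "C1 \<sigma> (\<lambda>t. 1 / d (\<sigma> t))" "mono \<sigma>"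
proof -
  have inc: "m * (s - r) \<le> F s - F r" if "r \<le> s" for r s
  proof -
    have "F r - m * r \<le> F s - m * s"
    proof (rule DERIV_nonneg_imp_nondecreasing[where f = "\<lambda>s. F s - m * s"])
      fix x
      have "((\<lambda>s. F s - m * s) has_real_derivative d x - m) (at x)"
        by (auto intro!: derivative_eq_intros C1_deriv[OF F])
      then show "\<exists>y. ((\<lambda>s. F s - m * s) has_real_derivative y) (at x) \<and> 0 \<le> y"
        using m(2)[of x] by (intro exI[of _ "d x - m"]) auto
    qed (rule that)
    then show ?thesis by (simp add: algebra_simps)
  qed
  have "inj F"
  proof (rule injI)
    fix x y assume "F x = F y"
    then have "m * (max x y - min x y) \<le> 0" using inc[of "min x y" "max x y"] by (auto simp: max_def min_def)
    then show "x = y" using m(1) by (auto simp: mult_le_0_iff max_def min_def split: if_splits)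
  qed
  have surj: "\<exists>s. F s = t" for t
  proof -
    define b where "b = \<bar>t - F 0\<bar> / m"
    have b: "0 \<le> b" "m * b = \<bar>t - F 0\<bar>" using m(1) by (auto simp: b_def)
    have "F (- b) \<le> t" "t \<le> F b" using inc[of "- b" 0] inc[of 0 b] b by auto
    then have "\<exists>x. - b \<le> x \<and> x \<le> b \<and> F x = t"
      using b(1) by (intro IVT') (auto intro: continuous_on_subset[OF C1_cont[OF F]])
    then show ?thesis by blast
  qed
  define \<sigma> where "\<sigma> = inv F"
  have s1: "\<sigma> (F s) = s" for s using \<open>inj F\<close> by (simp add: \<sigma>_def)
  have s2: "F (\<sigma> t) = t" for t unfolding \<sigma>_def by (rule f_inv_into_f) (use surj[of t] in force)
  have mono: "\<sigma> t \<le> \<sigma> r" if "t \<le> r" for t r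
  proof (rule ccontr)
    assume "\<not> \<sigma> t \<le> \<sigma> r"
    then have "0 < m * (\<sigma> t - \<sigma> r)" "m * (\<sigma> t - \<sigma> r) \<le> F (\<sigma> t) - F (\<sigma> r)"
      using m(1) by (auto intro!: inc)
    then show False using that by (simp add: s2)
  qed
  have lip: "\<bar>\<sigma> t - \<sigma> r\<bar> \<le> \<bar>t - r\<bar> / m" for t r
    using inc[of "\<sigma> r" "\<sigma> t"] inc[of "\<sigma> t" "\<sigma> r"] m(1)
    by (cases "\<sigma> r \<le> \<sigma> t") (auto simp: s2 field_simps abs_if)
  have cont: "isCont \<sigma> t" for t
    unfolding continuous_at_eps_delta
  proof (intro allI impI)
    fix e :: real assume "0 < e"
    have "\<bar>\<sigma> x' - \<sigma> t\<bar> < e" if "\<bar>x' - t\<bar> < m * e" for x'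
    proof -
      have "\<bar>x' - t\<bar> / m < e" using that m(1) by (simp add: divide_less_eq mult.commute)
      then show ?thesis using lip[of x' t] by linarith
    qed
    then show "\<exists>d>0. \<forall>x'. dist x' t < d \<longrightarrow> dist (\<sigma> x') (\<sigma> t) < e"
      using m(1) \<open>0 < e\<close> by (intro exI[of _ "m * e"]) (auto simp: dist_real_def)
  qed
  have "C1 \<sigma> (\<lambda>t. 1 / d (\<sigma> t))"
    unfolding C1_def
  proof (intro conjI allI)
    fix t
    have "d (\<sigma> t) \<noteq> 0" using m(1) m(2)[of "\<sigma> t"] by linarith
    then show "(\<sigma> has_real_derivative 1 / d (\<sigma> t)) (at t)"
      using DERIV_inverse_function[of F "d (\<sigma> t)" \<sigma> t "t - 1" "t + 1"] C1_deriv[OF F, of "\<sigma> t" UNIV] cont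
      by (simp add: s2 inverse_eq_divide)
    have "continuous_on UNIV \<sigma>" using cont by (auto intro: continuous_at_imp_continuous_on)
    moreover have "d (\<sigma> t) \<noteq> 0" for t using m(1) m(2)[of "\<sigma> t"] by linarith
    ultimately show "continuous_on UNIV (\<lambda>t. 1 / d (\<sigma> t))"
      by (intro continuous_intros continuous_on_UNIV_compose[OF C1_cont'[OF F]]) auto
  qed
  then show thesis using that[of \<sigma>] s1 s2 mono by (auto simp: mono_def)
qed

lemma C1_positive_extension:
  fixes \<Theta> \<Theta>' :: "real \<Rightarrow> real"
  assumes \<Theta>: "C1 \<Theta> \<Theta>'" and pos: "\<And>s. s \<in> {a..b} \<Longrightarrow> 0 < \<Theta>' s" and ab: "a \<le> b"
  obtains F d m where "C1 F d" "0 < m" "\<And>s. m \<le> d s"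
    "\<And>s. s \<in> {a..b} \<Longrightarrow> F s = \<Theta> s" "\<And>s. s \<in> {a..b} \<Longrightarrow> d s = \<Theta>' s"
proof -
  define d where "d = (\<lambda>s. \<Theta>' (max a (min b s)))"
  have d: "continuous_on UNIV d" unfolding d_def
    by (intro continuous_on_UNIV_compose[OF C1_cont'[OF \<Theta>]] continuous_intros)
  have "\<exists>x\<in>{a..b}. \<forall>y\<in>{a..b}. \<Theta>' x \<le> \<Theta>' y"
    using ab by (intro continuous_attains_inf continuous_on_subset[OF C1_cont'[OF \<Theta>]]) auto
  then obtain x where x: "x \<in> {a..b}" "\<And>y. y \<in> {a..b} \<Longrightarrow> \<Theta>' x \<le> \<Theta>' y" by blast
  define F where "F = with_derivative a (\<Theta> a) d"
  have dd: "d s = \<Theta>' s" if "s \<in> {a..b}" for s using that by (simp add: d_def)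
  show thesis
  proof (rule that[of F d "\<Theta>' x"])
    show "C1 F d" unfolding F_def by (rule C1_with_derivative[OF d])
    show "0 < \<Theta>' x" using pos x by blast
    show "\<Theta>' x \<le> d s" for s unfolding d_def by (rule x(2)) (use ab in auto)
    show "F s = \<Theta> s" if "s \<in> {a..b}" for s
      unfolding F_def by (rule with_derivative_eq[OF \<Theta> d]) (use that dd in auto)
  qed (rule dd)
qed

text \<open>For nonzero \<open>k\<close> and an invertible \<open>\<Theta>\<close>, the equation determines
  \<open>h\<close> at \<open>\<Theta> s - L\<close> from later values. After the change of variables
  \<open>u = - \<Theta> s\<close> it has the form treated above: the kernels are exchanged, the
  factor is \<open>1 / k\<close>, and the delayed time is \<open>G u = - \<sigma> (- u)\<close> with
  \<open>\<sigma>\<close> the inverse function of \<open>\<Theta>\<close>. The condition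
  \<open>\<Theta> s \<le> s\<close> is exactly causality for the reversed equation.\<close>

lemma extend_backward:
  fixes \<Theta> \<Theta>' h0 h0' \<alpha> \<beta> :: "real \<Rightarrow> real"
  assumes L: "0 < L" and \<alpha>: "continuous_on UNIV \<alpha>" and \<beta>: "continuous_on UNIV \<beta>" and k: "k \<noteq> 0"
    and \<Theta>: "C1 \<Theta> \<Theta>'" "\<And>s. s \<in> {0..S0} \<Longrightarrow> 0 < \<Theta>' s" "\<And>s. s \<in> {0..S0} \<Longrightarrow> \<Theta> s \<le> s" and S0: "0 \<le> S0"
    and h0: "C1 h0 h0'"
    and compat: "advanced L \<alpha> h0 S0 = k * retarded L \<beta> h0 (\<Theta> S0)"
      "advanced L \<alpha> h0' S0 = k * \<Theta>' S0 * retarded L \<beta> h0' (\<Theta> S0)"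
  obtains h h' where "C1 h h'" "\<And>t. \<Theta> S0 - L \<le> t \<Longrightarrow> h t = h0 t"
    "\<And>s. s \<in> {0..S0} \<Longrightarrow> advanced L \<alpha> h s = k * retarded L \<beta> h (\<Theta> s)"
proof -
  obtain F d m where F: "C1 F d" "0 < m" "\<And>s. m \<le> d s"
    "\<And>s. s \<in> {0..S0} \<Longrightarrow> F s = \<Theta> s" "\<And>s. s \<in> {0..S0} \<Longrightarrow> d s = \<Theta>' s"
    using C1_positive_extension[OF \<Theta>(1,2) S0] by blast
  obtain \<sigma> where \<sigma>: "\<And>s. \<sigma> (F s) = s" "\<And>t. F (\<sigma> t) = t" "C1 \<sigma> (\<lambda>t. 1 / d (\<sigma> t))" "mono \<sigma>"
    using C1_inverse[OF F(1,2,3)] by blast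
  define T0 where "T0 = \<Theta> S0"
  have FT: "F 0 = \<Theta> 0" "F S0 = T0" using F(4) S0 by (auto simp: T0_def)
  have sg: "\<sigma> (\<Theta> 0) = 0" "\<sigma> T0 = S0" using \<sigma>(1)[of 0] \<sigma>(1)[of S0] FT by auto
  have T0: "\<Theta> 0 \<le> T0"
  proof (rule ccontr)
    assume "\<not> \<Theta> 0 \<le> T0"
    then have "S0 \<le> 0" using monoD[OF \<sigma>(4), of T0 "\<Theta> 0"] sg by simp
    then show False using S0 \<open>\<not> \<Theta> 0 \<le> T0\<close> by (simp add: T0_def)
  qed
  have s_in: "\<sigma> t \<in> {0..S0}" if "t \<in> {\<Theta> 0..T0}" for t
    using monoD[OF \<sigma>(4), of "\<Theta> 0" t] monoD[OF \<sigma>(4), of t T0] sg that by auto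
  have s_ge: "t \<le> \<sigma> t" if "t \<in> {\<Theta> 0..T0}" for t
    using \<Theta>(3)[OF s_in[OF that]] F(4)[OF s_in[OF that]] \<sigma>(2)[of t] by simp
  \<comment> \<open>Beyond \<open>- \<Theta> 0\<close>, that is for negative times \<open>s\<close>, nothing
    is required; the clamp keeps all coefficients bounded.\<close>
  define c where "c = (\<lambda>u. min (- \<Theta> 0) (max (- T0) u))"
  have c: "continuous_on UNIV c" unfolding c_def by (intro continuous_intros)
  have c_in: "- c u \<in> {\<Theta> 0..T0}" for u using T0 by (auto simp: c_def)
  define G G' where "G = (\<lambda>u. - \<sigma> (- u))" and "G' = (\<lambda>u. 1 / d (\<sigma> (- u)))"
  have "C1 (\<lambda>r. \<sigma> (- r)) (\<lambda>r. - (1 / d (\<sigma> (- r))))" by (rule C1_reflect[OF \<sigma>(3)])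
  then have G: "C1 G G'" unfolding C1_def G_def G'_def
    by (auto intro!: derivative_eq_intros dest: continuous_on_minus)
  define g where "g = (\<lambda>r. h0 (- r))"
  define g' where "g' = (\<lambda>r. - h0' (- r))"
  have g: "C1 g g'" unfolding g_def g'_def by (rule C1_reflect[OF h0])
  define \<alpha>' \<beta>' where "\<alpha>' = (\<lambda>x. \<beta> (- x))" and "\<beta>' = (\<lambda>x. \<alpha> (- x))"
  have cont: "continuous_on UNIV \<alpha>'" "continuous_on UNIV \<beta>'" unfolding \<alpha>'_def \<beta>'_def
    by (intro continuous_on_UNIV_compose[OF \<alpha>] continuous_on_UNIV_compose[OF \<beta>] continuous_intros)+
  have gg: "advanced L \<alpha>' g (- t) = retarded L \<beta> h0 t" "retarded L \<beta>' g (- t) = advanced L \<alpha> h0 t"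
    "advanced L \<alpha>' g' (- t) = - retarded L \<beta> h0' t" "retarded L \<beta>' g' (- t) = - advanced L \<alpha> h0' t" for t
    using retarded_uminus(2)[of L \<alpha>' "\<lambda>r. h0' (- r)" "- t"] retarded_uminus(1)[of L \<beta>' "\<lambda>r. h0' (- r)" "- t"]
    by (simp_all add: retarded_reflect(1)[of L \<beta> h0 t] retarded_reflect(2)[of L \<alpha> h0 t]
        retarded_reflect(1)[of L \<beta> h0' t] retarded_reflect(2)[of L \<alpha> h0' t] g_def g'_def \<alpha>'_def \<beta>'_def)
  define R where "R = (\<lambda>u. 1 / k * G' u * retarded L \<beta>' g' (G u) - advanced L \<alpha>' g' u)"
  have "continuous_on UNIV R" unfolding R_def
    by (intro continuous_intros C1_cont'[OF G] continuous_on_advanced[OF cont(2) C1_cont'[OF g] C1_cont[OF G]]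
        continuous_on_advanced[OF cont(1) C1_cont'[OF g]])
  then have "bounded (R ` {- T0..- \<Theta> 0})"
    by (intro compact_imp_bounded compact_continuous_image) (auto intro: continuous_on_subset)
  then obtain b where b: "\<forall>y\<in>R ` {- T0..- \<Theta> 0}. norm y \<le> b" unfolding bounded_iff by blast
  have Rb: "\<bar>R (c u)\<bar> \<le> b" for u
  proof -
    have "c u \<in> {- T0..- \<Theta> 0}" using c_in[of u] by auto
    then show ?thesis using b by auto
  qed
  obtain h h' where h: "C1 h h'" "\<And>t. t \<le> - T0 + L \<Longrightarrow> h t = g t"
    "\<And>u. - T0 \<le> u \<Longrightarrow> (\<And>r. r \<in> {- T0..u} \<Longrightarrow> c r = r) \<Longrightarrow> advanced L \<alpha>' h u = 1 / k * retarded L \<beta>' h (G u)"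
  proof (rule extend_solution[OF L cont c _ _ G _ _ g])
    show "c s \<le> max (- T0) s" for s unfolding c_def by (rule min.cobounded2)
    show "c s = - T0" if "s \<le> - T0" for s using that T0 by (auto simp: c_def)
    show "G (c u) \<le> c u" for u using s_ge[OF c_in[of u]] by (simp add: G_def)
    show "\<bar>G' (c u)\<bar> \<le> 1 / m" for u
    proof -
      have "0 < d (\<sigma> (- c u))" using F(2) F(3)[of "\<sigma> (- c u)"] by linarith
      then show ?thesis using F(2) F(3)[of "\<sigma> (- c u)"] by (simp add: G'_def frac_le)
    qed
    show "\<bar>1 / k * G' (c s) * retarded L \<beta>' g' (G (c s)) - advanced L \<alpha>' g' (c s)\<bar> \<le> b" for s
      using Rb[of s] by (simp add: R_def)
    have GT: "G (- T0) = - S0" "G' (- T0) = 1 / \<Theta>' S0" using sg F(5)[of S0] S0 by (auto simp: G_def G'_def)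
    show "advanced L \<alpha>' g (- T0) = 1 / k * retarded L \<beta>' g (G (- T0))"
      unfolding GT gg using compat(1) k by (simp add: T0_def)
    show "advanced L \<alpha>' g' (- T0) = 1 / k * G' (- T0) * retarded L \<beta>' g' (G (- T0))"
      unfolding GT gg using compat(2) k \<Theta>(2)[of S0] S0 by (simp add: T0_def field_simps)
  qed blast
  show thesis
  proof (rule that)
    show "C1 (\<lambda>r. h (- r)) (\<lambda>r. - h' (- r))" by (rule C1_reflect[OF h(1)])
    show "h (- t) = h0 t" if "\<Theta> S0 - L \<le> t" for t
      using h(2)[of "- t"] that by (simp add: T0_def g_def)
    fix s assume s: "s \<in> {0..S0}"
    define t where "t = \<Theta> s"
    have Ft: "F s = t" using F(4)[OF s] by (simp add: t_def)
    then have st: "\<sigma> t = s" using \<sigma>(1)[of s] by simp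
    have tT: "t \<in> {\<Theta> 0..T0}"
    proof -
      have Fmono: "F x \<le> F y" if "x \<le> y" for x y
      proof (rule DERIV_nonneg_imp_nondecreasing[where f = F, OF that])
        fix z show "\<exists>w. (F has_real_derivative w) (at z) \<and> 0 \<le> w"
          using C1_deriv[OF F(1), of z UNIV] F(2) F(3)[of z] by (intro exI[of _ "d z"]) auto
      qed
      show ?thesis using Fmono[of 0 s] Fmono[of s S0] s FT Ft by auto
    qed
    have "advanced L \<alpha>' h (- t) = 1 / k * retarded L \<beta>' h (G (- t))"
      by (rule h(3)) (use tT in \<open>auto simp: c_def\<close>)
    moreover have "G (- t) = - s" by (simp add: G_def st)
    moreover have "advanced L \<alpha>' h (- t) = retarded L \<beta> (\<lambda>r. h (- r)) t"
      unfolding retarded_reflect(1)[of L \<beta>] by (simp add: \<alpha>'_def)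
    moreover have "retarded L \<beta>' h (- s) = advanced L \<alpha> (\<lambda>r. h (- r)) s"
      unfolding retarded_reflect(2)[of L \<alpha>] by (simp add: \<beta>'_def)
    ultimately show "advanced L \<alpha> (\<lambda>r. h (- r)) s = k * retarded L \<beta> (\<lambda>r. h (- r)) (\<Theta> s)"
      using k by (simp add: t_def field_simps)
  qed
qed

section \<open>The unstable mode\<close>

definition inlet_kernel :: "real \<Rightarrow> real \<Rightarrow> real \<Rightarrow> real" where
  "inlet_kernel L M x = L * riemann_kernel M L x"

definition outlet_kernel :: "real \<Rightarrow> real \<Rightarrow> real \<Rightarrow> real" where
  "outlet_kernel L M x = L * riemann_kernel (- M) L (- x)"

lemma continuous_inlet_kernel: "continuous_on UNIV (inlet_kernel L M)"
  and continuous_outlet_kernel: "continuous_on UNIV (outlet_kernel L M)"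
  unfolding inlet_kernel_def[abs_def] outlet_kernel_def[abs_def] by (intro continuous_intros)+

lemma inlet_advanced: "inlet L M h s = advanced L (inlet_kernel L M) h s"
  by (simp add: inlet_def wave_def advanced_def inlet_kernel_def)

lemma outlet_retarded: "outlet L M h t = retarded L (outlet_kernel L M) h t"
  unfolding retarded_reflect(1)
  by (simp add: outlet_def wave_def advanced_def outlet_kernel_def)

text \<open>For a constant trace the state does not depend on time, and the system is the rotation
  \<open>p' = M m\<close>, \<open>m' = - M p\<close> in \<open>y\<close>, starting from
  \<open>p = m = 1\<close>; \<open>X\<close> and \<open>Y\<close> are its first integrals.\<close>

lemma inlet_steady: "inlet L M (\<lambda>_. 1) s = cos (M * L) + sin (M * L)"
proof -
  define p m where "p = wave M (\<lambda>_. 1) 0" and "m = wave (- M) (\<lambda>_. 1) 0"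
  have C: "C1 (\<lambda>_. 1) (\<lambda>_. 0)" by (auto simp: C1_def)
  have w0: "wave N (\<lambda>_. 0) t y = 0" for N t y by (simp add: wave_def)
  have "wave_y M (\<lambda>_. 1) (\<lambda>_. 0) 0 y = M * m y" for y
    using wave_transport[OF C, of M 0 y] by (simp add: w0 m_def)
  then have Dp: "(p has_real_derivative M * m y) (at y)" for y
    using DERIV_wave_y[OF C, of M 0 y] by (simp add: p_def)
  have "wave_y (- M) (\<lambda>_. 1) (\<lambda>_. 0) 0 y = - M * p y" for y
    using wave_transport[OF C, of "- M" 0 y] by (simp add: w0 p_def)
  then have Dm: "(m has_real_derivative - M * p y) (at y)" for y
    using DERIV_wave_y[OF C, of "- M" 0 y] by (simp add: m_def)
  have start: "p 0 = 1" "m 0 = 1" by (simp_all add: p_def m_def wave_0)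
  define X Y where "X = (\<lambda>y. cos (M * y) * p y - sin (M * y) * m y)"
    and "Y = (\<lambda>y. sin (M * y) * p y + cos (M * y) * m y)"
  have "(X has_real_derivative 0) (at y)" "(Y has_real_derivative 0) (at y)" for y
    unfolding X_def Y_def by (auto intro!: derivative_eq_intros Dp Dm simp: algebra_simps)
  then have XY: "X L = X 0" "Y L = Y 0" by (auto intro: DERIV_isconst_all)
  then have XY1: "X L = 1" "Y L = 1" by (simp_all add: X_def Y_def start)
  have "cos (M * L) * X L + sin (M * L) * Y L = ((sin (M * L))\<^sup>2 + (cos (M * L))\<^sup>2) * p L"
    unfolding X_def Y_def by algebra
  then have "p L = cos (M * L) + sin (M * L)" by (simp add: XY1)
  moreover have "inlet L M (\<lambda>_. 1) s = p L" by (simp add: inlet_def p_def wave_def)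
  ultimately show ?thesis by simp
qed

lemma advanced_exp:
  "advanced L \<alpha> (\<lambda>t. exp (\<nu> * t)) s = exp (\<nu> * s) * advanced L \<alpha> (\<lambda>t. exp (\<nu> * t)) 0"
  "retarded L \<alpha> (\<lambda>t. exp (\<nu> * t)) s = exp (\<nu> * s) * retarded L \<alpha> (\<lambda>t. exp (\<nu> * t)) 0"
proof -
  have "exp (\<nu> * (s + x)) = exp (\<nu> * s) * exp (\<nu> * x)" for x
    by (simp add: exp_add[symmetric] algebra_simps)
  moreover have "integral {-1..1} (\<lambda>x. \<alpha> x * (exp (\<nu> * s) * exp (\<nu> * (L * x))))
      = exp (\<nu> * s) * integral {-1..1} (\<lambda>x. \<alpha> x * exp (\<nu> * (L * x)))"
  proof -
    have "(\<lambda>x. \<alpha> x * (exp (\<nu> * s) * exp (\<nu> * (L * x)))) = (\<lambda>x. exp (\<nu> * s) * (\<alpha> x * exp (\<nu> * (L * x))))"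
      by (simp add: mult_ac)
    then show ?thesis by (simp only: integral_mult_right)
  qed
  ultimately show
    "advanced L \<alpha> (\<lambda>t. exp (\<nu> * t)) s = exp (\<nu> * s) * advanced L \<alpha> (\<lambda>t. exp (\<nu> * t)) 0"
    "retarded L \<alpha> (\<lambda>t. exp (\<nu> * t)) s = exp (\<nu> * s) * retarded L \<alpha> (\<lambda>t. exp (\<nu> * t)) 0"
    using \<open>exp (\<nu> * (s + - L)) = exp (\<nu> * s) * exp (\<nu> * - L)\<close>
    by (simp_all add: advanced_def retarded_def distrib_left right_diff_distrib)
qed

text \<open>The sign change of \<open>P\<close> is enclosed between \<open>\<nu>1\<close> and
  \<open>\<nu>2\<close>, chosen independently of \<open>k\<close> and \<open>\<tau>\<close>. At
  these two points \<open>exp (- \<nu> * \<tau>) < 1 / (\<nu>1 * \<tau>)\<close> makes the delayed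
  term smaller than \<open>m\<close>, the smaller of the two values \<open>\<bar>P\<bar>\<close>, as
  soon as \<open>\<tau>\<close> exceeds the bound.\<close>

lemma unstable_root:
  fixes \<alpha> \<beta> :: "real \<Rightarrow> real" and khat :: real
  assumes L: "0 < L" and \<alpha>: "continuous_on UNIV \<alpha>" and \<beta>: "continuous_on UNIV \<beta>"
    and neg: "advanced L \<alpha> (\<lambda>_. 1) 0 < 0" and kh: "0 < khat"
  obtains \<tau>0 where "0 < \<tau>0" "\<And>\<tau> k. \<tau>0 \<le> \<tau> \<Longrightarrow> \<bar>k\<bar> < khat \<Longrightarrow>
    \<exists>\<nu>>0. advanced L \<alpha> (\<lambda>t. exp (\<nu> * t)) 0 = k * exp (- \<nu> * \<tau>) * retarded L \<beta> (\<lambda>t. exp (\<nu> * t)) 0"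
proof -
  define P Q where "P = (\<lambda>\<nu>. advanced L \<alpha> (\<lambda>t. exp (\<nu> * t)) 0)"
    and "Q = (\<lambda>\<nu>. retarded L \<beta> (\<lambda>t. exp (\<nu> * t)) 0)"
  have ci: "continuous_on UNIV (\<lambda>\<nu>. integral {-1..1} (\<lambda>x. \<gamma> x * exp (\<nu> * (0 + L * x))))"
    if "continuous_on UNIV \<gamma>" for \<gamma> :: "real \<Rightarrow> real"
  proof (rule continuous_on_integral_param)
    show "continuous_on (UNIV \<times> {-1..1}) (\<lambda>(\<nu>, x). \<gamma> x * exp (\<nu> * (0 + L * x)))"
      unfolding case_prod_beta by (intro continuous_intros continuous_on_UNIV_compose[OF that])
  qed
  have cP: "continuous_on UNIV P" and cQ: "continuous_on UNIV Q"
    unfolding P_def Q_def advanced_def retarded_def by (intro continuous_intros ci \<alpha> \<beta>)+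
  have P0: "P 0 < 0" using neg by (simp add: P_def)
  have "\<forall>\<^sub>F \<nu> in at_right 0. P \<nu> < 0"
  proof (rule order_tendstoD(2))
    show "(P \<longlongrightarrow> P 0) (at_right 0)"
      using cP by (auto simp: continuous_on_def intro: filterlim_at_within_not_equal tendsto_within_subset)
  qed (rule P0)
  then obtain \<nu>1 where l1: "0 < \<nu>1" "P \<nu>1 < 0"
    unfolding eventually_at_right_field by (meson dense)
  obtain K where K: "0 < K" "\<And>x. x \<in> {-1..1} \<Longrightarrow> \<bar>\<alpha> x\<bar> \<le> K" using compact_kernel_bound[OF \<alpha>] by blast
  \<comment> \<open>For such \<open>\<nu>\<close> the leading term \<open>exp (\<nu> * L)\<close> of
    \<open>P \<nu>\<close> dominates the integral.\<close>
  define \<nu>2 where "\<nu>2 = \<nu>1 + K / L"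
  have l2: "\<nu>1 < \<nu>2" "0 < \<nu>2" "K < \<nu>2 * L"
    using l1 K L by (auto simp: \<nu>2_def field_simps add_pos_pos)
  have "\<bar>integral {-1..1} (\<lambda>x. \<alpha> x * exp (\<nu>2 * (0 + L * x)))\<bar> \<le> K / (\<nu>2 * L) * (1 * exp (\<nu>2 * (0 + L)))"
    by (rule conv_weighted_le[OF \<alpha> K(2)]) (use K l2 L in \<open>auto intro!: continuous_intros\<close>)
  also have "\<dots> < 1 * (1 * exp (\<nu>2 * (0 + L)))"
    using l2 L K by (intro mult_strict_right_mono) auto
  finally have P2: "0 < P \<nu>2" unfolding P_def advanced_def by (simp add: abs_less_iff)
  define m where "m = min (- P \<nu>1) (P \<nu>2)"
  define B where "B = max \<bar>Q \<nu>1\<bar> \<bar>Q \<nu>2\<bar> + 1"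
  have m: "0 < m" using l1 P2 by (simp add: m_def)
  have B: "0 < B" by (simp add: B_def add_pos_nonneg less_max_iff_disj add.commute)
  show thesis
  proof (rule that[of "khat * B / (m * \<nu>1)"])
    show "0 < khat * B / (m * \<nu>1)" using kh B m l1 by simp
    fix \<tau> k assume \<tau>: "khat * B / (m * \<nu>1) \<le> \<tau>" and k: "\<bar>k\<bar> < khat"
    have "0 < \<tau>" using \<tau> \<open>0 < khat * B / (m * \<nu>1)\<close> by linarith
    have t1: "khat * B \<le> m * (\<nu>1 * \<tau>)" using \<tau> m l1 by (simp add: divide_le_eq mult_ac)
    have small: "\<bar>k * exp (- \<nu> * \<tau>) * Q \<nu>\<bar> < m" if "\<nu> \<in> {\<nu>1, \<nu>2}" for \<nu>
    proof -
      have le: "\<nu>1 * \<tau> \<le> \<nu> * \<tau>" using that l2 \<open>0 < \<tau>\<close> by (auto intro: mult_right_mono)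
      have "\<nu>1 * \<tau> < exp (\<nu> * \<tau>)" using exp_ge_add_one_self[of "\<nu> * \<tau>"] le by linarith
      then have "m * (\<nu>1 * \<tau>) < m * exp (\<nu> * \<tau>)" using m by simp
      then have e: "khat * B < m * exp (\<nu> * \<tau>)" using t1 by linarith
      have "\<bar>k\<bar> * \<bar>Q \<nu>\<bar> \<le> khat * B" using k that by (intro mult_mono) (auto simp: B_def)
      then have "\<bar>k\<bar> * \<bar>Q \<nu>\<bar> < m * exp (\<nu> * \<tau>)" using e by linarith
      then have "\<bar>k\<bar> * \<bar>Q \<nu>\<bar> / exp (\<nu> * \<tau>) < m" by (simp add: divide_less_eq)
      then show ?thesis by (simp add: abs_mult exp_minus field_simps)
    qed
    have "\<exists>x\<ge>\<nu>1. x \<le> \<nu>2 \<and> (\<lambda>\<nu>. P \<nu> - k * exp (- \<nu> * \<tau>) * Q \<nu>) x = 0"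
    proof (rule IVT')
      show "P \<nu>1 - k * exp (- \<nu>1 * \<tau>) * Q \<nu>1 \<le> 0" "0 \<le> P \<nu>2 - k * exp (- \<nu>2 * \<tau>) * Q \<nu>2"
        using small[of \<nu>1] small[of \<nu>2] by (auto simp: m_def abs_less_iff)
      show "continuous_on {\<nu>1..\<nu>2} (\<lambda>\<nu>. P \<nu> - k * exp (- \<nu> * \<tau>) * Q \<nu>)"
        by (intro continuous_intros continuous_on_subset[OF cP] continuous_on_subset[OF cQ]) auto
    qed (use l2 in simp)
    then obtain \<nu> where "\<nu>1 \<le> \<nu>" "P \<nu> - k * exp (- \<nu> * \<tau>) * Q \<nu> = 0" by auto
    then show "\<exists>\<nu>>0. advanced L \<alpha> (\<lambda>t. exp (\<nu> * t)) 0 = k * exp (- \<nu> * \<tau>) * retarded L \<beta> (\<lambda>t. exp (\<nu> * t)) 0"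
      using l1 by (intro exI[of _ \<nu>]) (auto simp: P_def Q_def)
  qed
qed

text \<open>The condition \<open>\<zeta>' (2 \<tau>) = 0\<close> is what makes the two phases of the delay fit
  together to a \<open>C\<^sup>1\<close> function.\<close>

lemma feedback_time:
  assumes z: "starting_delay \<tau> \<zeta>" and \<tau>: "0 < \<tau>"
  obtains \<Theta> \<Theta>' where "C1 \<Theta> \<Theta>'" "\<And>s. s \<in> {0..2 * \<tau>} \<Longrightarrow> \<Theta> s = s - \<zeta> s"
    "\<And>s. 2 * \<tau> \<le> s \<Longrightarrow> \<Theta> s = s - \<tau>" "\<And>s. 2 * \<tau> \<le> s \<Longrightarrow> \<Theta>' s = 1"
proof -
  define I where "I = {0..2 * \<tau>}"
  obtain D where D: "\<forall>x\<in>I. D 0 x = \<zeta> x"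
    "\<forall>n. \<forall>x\<in>I. (D n has_real_derivative D (Suc n) x) (at x within I)"
    and z0: "\<zeta> 0 = 0" "\<zeta> (2 * \<tau>) = \<tau>" "(\<zeta> has_real_derivative 0) (at (2 * \<tau>) within I)"
    using z unfolding starting_delay_def smooth_real_on_def I_def by blast
  have Dz: "(\<zeta> has_real_derivative D 1 x) (at x within I)" if "x \<in> I" for x
  proof (rule has_field_derivative_transform_within[of "D 0" _ x I 1])
    show "(D 0 has_real_derivative D 1 x) (at x within I)" using D(2) that by force
  qed (use D(1) that in auto)
  have cD: "continuous_on I (D 1)"
    using D(2) by (intro DERIV_continuous_on[of I "D 1" "D 2"]) (simp add: numeral_2_eq_2)
  \<comment> \<open>The one-sided derivative given by smoothness must be the prescribed one, since derivatives
    within a nondegenerate interval are unique.\<close>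
  have "2 * \<tau> islimpt I" using \<tau> by (simp add: I_def islimpt_Icc)
  then have "at (2 * \<tau>) within I \<noteq> bot" by (simp add: trivial_limit_within)
  then have D1: "D 1 (2 * \<tau>) = 0"
    using vector_derivative_unique_within[of "2 * \<tau>" I \<zeta> "D 1 (2 * \<tau>)" 0] Dz[of "2 * \<tau>"] z0(3) \<tau>
    by (simp add: has_real_derivative_iff_has_vector_derivative I_def)
  define v where "v = (\<lambda>s. 1 - D 1 (max 0 (min (2 * \<tau>) s)))"
  have v: "continuous_on UNIV v" unfolding v_def
    by (intro continuous_intros continuous_on_compose2[OF cD]) (use \<tau> in \<open>auto simp: I_def\<close>)
  define \<Theta> where "\<Theta> = with_derivative 0 0 v"
  have pv: "\<Theta> s = prim v s" for s by (simp add: \<Theta>_def with_derivative_def)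
  have T1: "\<Theta> s = s - \<zeta> s" if s: "s \<in> {0..2 * \<tau>}" for s
  proof -
    have "((\<lambda>s. 1 - D 1 s) has_integral (s - \<zeta> s) - (0 - \<zeta> 0)) {0..s}"
    proof (rule fundamental_theorem_of_calculus)
      show "0 \<le> s" using s by simp
      fix x assume "x \<in> {0..s}"
      then have x: "x \<in> I" "{0..s} \<subseteq> I" using s by (auto simp: I_def)
      show "((\<lambda>s. s - \<zeta> s) has_vector_derivative 1 - D 1 x) (at x within {0..s})"
        unfolding has_real_derivative_iff_has_vector_derivative[symmetric]
        by (intro DERIV_diff DERIV_ident DERIV_subset[OF Dz[OF x(1)] x(2)])
    qed
    then have "integral {0..s} (\<lambda>s. 1 - D 1 s) = s - \<zeta> s" using z0(1) by (simp add: integral_unique)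
    moreover have "integral {0..s} v = integral {0..s} (\<lambda>s. 1 - D 1 s)"
      by (rule integral_eqI) (use s in \<open>auto simp: v_def\<close>)
    ultimately show ?thesis using integral_prim[OF v, of 0 s] s by (simp add: pv)
  qed
  have v1: "v s = 1" if "2 * \<tau> \<le> s" for s using that \<tau> D1 by (simp add: v_def)
  show thesis
  proof (rule that[of \<Theta> v])
    show "C1 \<Theta> v" unfolding \<Theta>_def by (rule C1_with_derivative[OF v])
    show "\<Theta> s = s - \<tau>" if s: "2 * \<tau> \<le> s" for s
    proof -
      have "integral {2 * \<tau>..s} v = integral {2 * \<tau>..s} (\<lambda>x. 1)"
        by (rule integral_eqI) (use v1 in auto)
      then have "prim v s - prim v (2 * \<tau>) = s - 2 * \<tau>"
        using integral_prim[OF v s] s by simp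
      moreover have "prim v (2 * \<tau>) = \<tau>" using T1[of "2 * \<tau>"] z0(2) \<tau> by (simp add: pv)
      ultimately show ?thesis by (simp add: pv)
    qed
  qed (use T1 v1 in auto)
qed

section \<open>Signals of short duration\<close>

lemma C1_derivative_unique:
  assumes h: "C1 h h'" and g: "C1 g g'" and eq: "\<And>t. c \<le> t \<Longrightarrow> h t = g t" and t: "c \<le> t"
  shows "h' t = g' t"
proof -
  have "t islimpt {t..t + 1}" by (simp add: islimpt_Icc)
  then have nb: "at t within {t..t + 1} \<noteq> bot" by (simp add: trivial_limit_within)
  have "(h has_vector_derivative g' t) (at t within {t..t + 1})"
  proof (rule has_vector_derivative_transform_within[of g])
    show "(g has_vector_derivative g' t) (at t within {t..t + 1})"
      using C1_deriv[OF g] by (simp add: has_real_derivative_iff_has_vector_derivative)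
    show "(0::real) < 1" by simp
  qed (use eq t in auto)
  moreover have "(h has_vector_derivative h' t) (at t within {t..t + 1})"
    using C1_deriv[OF h] by (simp add: has_real_derivative_iff_has_vector_derivative)
  ultimately show ?thesis using vector_derivative_unique_within[OF nb] by blast
qed

text \<open>Scaling \<open>[-1, 1]\<close> to the window costs the factor \<open>1 / L\<close>, and
  Cauchy-Schwarz on \<open>[-1, 1]\<close> the factor \<open>2\<close>.\<close>

lemma conv_square_le:
  fixes \<alpha> h :: "real \<Rightarrow> real"
  assumes L: "0 < L" and \<alpha>: "continuous_on UNIV \<alpha>" "\<And>x. x \<in> {-1..1} \<Longrightarrow> \<bar>\<alpha> x\<bar> \<le> K" and h: "continuous_on UNIV h"
  shows "(conv L \<alpha> h s)\<^sup>2 \<le> 2 * K\<^sup>2 / L * window L h s"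
proof -
  have c\<alpha>: "continuous_on {-1..1} \<alpha>" by (rule continuous_on_subset[OF \<alpha>(1)]) simp
  have h2: "continuous_on UNIV (\<lambda>r. (h r)\<^sup>2)" by (intro continuous_intros h)
  have "(conv L \<alpha> h s)\<^sup>2 \<le> (1 - (-1)) * integral {-1..1} (\<lambda>x. (\<alpha> x * h (s + L * x))\<^sup>2)"
    by (intro integral_power2_le continuous_intros continuous_on_UNIV_compose[OF h] c\<alpha>) auto
  also have "integral {-1..1} (\<lambda>x. (\<alpha> x * h (s + L * x))\<^sup>2) \<le> integral {-1..1} (\<lambda>x. K\<^sup>2 / L * (L * (h (s + L * x))\<^sup>2))"
  proof (rule integral_le)
    show "(\<alpha> x * h (s + L * x))\<^sup>2 \<le> K\<^sup>2 / L * (L * (h (s + L * x))\<^sup>2)" if "x \<in> {-1..1}" for x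
    proof -
      have "(\<alpha> x)\<^sup>2 \<le> K\<^sup>2" using power_mono[OF \<alpha>(2)[OF that], of 2] by simp
      then have "(\<alpha> x)\<^sup>2 * (h (s + L * x))\<^sup>2 \<le> K\<^sup>2 * (h (s + L * x))\<^sup>2" by (rule mult_right_mono) auto
      then show ?thesis using L by (simp add: power_mult_distrib)
    qed
  qed (intro integrable_continuous_real continuous_intros continuous_on_UNIV_compose[OF h] c\<alpha>)+
  also have "integral {-1..1} (\<lambda>x. K\<^sup>2 / L * (L * (h (s + L * x))\<^sup>2)) = K\<^sup>2 / L * window L h s"
    using integral_scaled[OF h2 less_imp_le[OF L], of s] by (simp only: integral_mult_right window_def)
  finally show ?thesis by simp
qed

definition bump :: "real \<Rightarrow> real \<Rightarrow> real \<Rightarrow> real" where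
  "bump a b t = (max 0 ((t - a) * (b - t)))\<^sup>2"

lemma C1_bump: "C1 (bump a b) (\<lambda>t. 2 * max 0 ((t - a) * (b - t)) * (a + b - 2 * t))"
proof -
  have eq: "(max 0 x)\<^sup>2 = prim (\<lambda>r. 2 * max 0 r) x" for x :: real
  proof (cases "0 \<le> x")
    case True
    have "((\<lambda>r::real. 2 * r) has_integral x\<^sup>2 - 0\<^sup>2) {0..x}"
    proof (rule fundamental_theorem_of_calculus[OF True])
      show "((\<lambda>r. r\<^sup>2) has_vector_derivative 2 * r) (at r within {0..x})" for r
        unfolding has_real_derivative_iff_has_vector_derivative[symmetric]
        by (auto intro!: derivative_eq_intros)
    qed
    then have "integral {0..x} (\<lambda>r. 2 * r) = x\<^sup>2" unfolding zero_power2 diff_zero by (rule integral_unique)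
    moreover have "integral {0..x} (\<lambda>r. 2 * max 0 r) = integral {0..x} (\<lambda>r. 2 * r)"
      by (rule integral_eqI) auto
    moreover have "integral {x..0} (\<lambda>r. 2 * max 0 r) = 0" using True by (cases "x = 0") auto
    ultimately show ?thesis using True by (simp add: prim_def)
  next
    case False
    have "integral {x..0} (\<lambda>r. 2 * max 0 r) = integral {x..0} (\<lambda>r. 0)"
      by (rule integral_eqI) auto
    then show ?thesis using False by (simp add: prim_def)
  qed
  have "continuous_on UNIV (\<lambda>r::real. 2 * max 0 r)" by (intro continuous_intros)
  then have sq: "((\<lambda>x. (max 0 x)\<^sup>2) has_real_derivative 2 * max 0 x) (at x)" for x :: real
    unfolding eq by (rule DERIV_prim)
  show ?thesis unfolding C1_def bump_def[abs_def]
  proof (intro conjI allI)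
    fix t
    have d: "((\<lambda>t. (t - a) * (b - t)) has_real_derivative a + b - 2 * t) (at t)"
      by (rule DERIV_cong[OF DERIV_mult[OF DERIV_diff[OF DERIV_ident DERIV_const] DERIV_diff[OF DERIV_const DERIV_ident]]]) simp
    show "((\<lambda>t. (max 0 ((t - a) * (b - t)))\<^sup>2) has_real_derivative
        2 * max 0 ((t - a) * (b - t)) * (a + b - 2 * t)) (at t)"
      by (rule DERIV_chain2[OF sq d])
  qed (intro continuous_intros)
qed

lemma bump_support:
  assumes "t \<le> a \<or> b \<le> t" "a < b" shows "bump a b t = 0"
proof -
  have "(t - a) * (b - t) \<le> 0" using assms by (auto simp: mult_le_0_iff)
  then show ?thesis by (simp add: bump_def)
qed

lemma bump_pos: "a < t \<Longrightarrow> t < b \<Longrightarrow> 0 < bump a b t"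
  by (simp add: bump_def)

lemma two_equations_three_unknowns:
  fixes u1 u2 u3 v1 v2 v3 :: real
  obtains x y z where "x \<noteq> 0 \<or> y \<noteq> 0 \<or> z \<noteq> 0" "x * u1 + y * u2 + z * u3 = 0" "x * v1 + y * v2 + z * v3 = 0"
proof (cases "u2 * v3 - u3 * v2 = 0 \<and> u3 * v1 - u1 * v3 = 0 \<and> u1 * v2 - u2 * v1 = 0")
  case False
  show thesis
  proof (rule that)
    show "u2 * v3 - u3 * v2 \<noteq> 0 \<or> u3 * v1 - u1 * v3 \<noteq> 0 \<or> u1 * v2 - u2 * v1 \<noteq> 0"
      using False by blast
    show "(u2 * v3 - u3 * v2) * u1 + (u3 * v1 - u1 * v3) * u2 + (u1 * v2 - u2 * v1) * u3 = 0"
      "(u2 * v3 - u3 * v2) * v1 + (u3 * v1 - u1 * v3) * v2 + (u1 * v2 - u2 * v1) * v3 = 0" by algebra+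
  qed
next
  case True
  consider "u1 \<noteq> 0 \<or> u2 \<noteq> 0" | "u1 = 0" "u2 = 0" "v1 \<noteq> 0 \<or> v2 \<noteq> 0" | "u1 = 0" "u2 = 0" "v1 = 0" "v2 = 0" by blast
  then show thesis
  proof cases
    case 1
    have "u2 * u1 + - u1 * u2 + 0 * u3 = 0" "u2 * v1 + - u1 * v2 + 0 * v3 = 0"
      using True by (simp_all add: mult.commute)
    then show thesis using 1 by (intro that[of u2 "- u1" 0]) auto
  next
    case 2
    then have "v2 * u1 + - v1 * u2 + 0 * u3 = 0" "v2 * v1 + - v1 * v2 + 0 * v3 = 0" by simp_all
    then show thesis using 2 by (intro that[of v2 "- v1" 0]) auto
  next
    case 3
    then show thesis by (intro that[of 1 0 0]) simp_all
  qed
qed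

lemma C1_add: "C1 f f' \<Longrightarrow> C1 g g' \<Longrightarrow> C1 (\<lambda>t. f t + g t) (\<lambda>t. f' t + g' t)"
  unfolding C1_def by (auto intro!: derivative_eq_intros continuous_intros)

lemma C1_scale: "C1 f f' \<Longrightarrow> C1 (\<lambda>t. x * f t) (\<lambda>t. x * f' t)"
  unfolding C1_def by (auto intro!: derivative_eq_intros continuous_intros)

lemma advanced_scale:
  "advanced L \<alpha> (\<lambda>t. x * h t) s = x * advanced L \<alpha> h s"
  "retarded L \<alpha> (\<lambda>t. x * h t) s = x * retarded L \<alpha> h s"
proof -
  have "(\<lambda>r. \<alpha> r * (x * h (s + L * r))) = (\<lambda>r. x * (\<alpha> r * h (s + L * r)))" by (simp add: mult_ac)
  then show "advanced L \<alpha> (\<lambda>t. x * h t) s = x * advanced L \<alpha> h s"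
    "retarded L \<alpha> (\<lambda>t. x * h t) s = x * retarded L \<alpha> h s"
    by (simp_all only: advanced_def retarded_def integral_mult_right distrib_left)
qed

text \<open>The two conditions are linear in \<open>g\<close>, so some nontrivial combination of three bumps
  with disjoint supports satisfies both.\<close>

lemma compatible_bump:
  fixes \<alpha> \<beta> :: "real \<Rightarrow> real"
  assumes ab: "a < b" and \<alpha>: "continuous_on UNIV \<alpha>" and \<beta>: "continuous_on UNIV \<beta>"
  obtains g g' where "C1 g g'" "\<And>t. t \<le> a \<or> b \<le> t \<Longrightarrow> g t = 0" "0 < integral {a..b} (\<lambda>t. (g t)\<^sup>2)"
    "advanced L \<alpha> g S = k * retarded L \<beta> g T" "advanced L \<alpha> g' S = k' * retarded L \<beta> g' T"
proof -
  define c1 c2 where "c1 = a + (b - a) / 3" and "c2 = a + 2 * ((b - a) / 3)"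
  have c: "a < c1" "c1 < c2" "c2 < b" using ab by (auto simp: c1_def c2_def field_simps)
  define p1 p2 p3 where "p1 = bump a c1" and "p2 = bump c1 c2" and "p3 = bump c2 b"
  have "\<exists>q. C1 p1 q" "\<exists>q. C1 p2 q" "\<exists>q. C1 p3 q"
    unfolding p1_def p2_def p3_def by (rule exI, rule C1_bump)+
  then obtain q1 q2 q3 where q: "C1 p1 q1" "C1 p2 q2" "C1 p3 q3" by blast
  define l l' where "l = (\<lambda>g. advanced L \<alpha> g S - k * retarded L \<beta> g T)"
    and "l' = (\<lambda>g. advanced L \<alpha> g S - k' * retarded L \<beta> g T)"
  obtain x y z where xyz: "x \<noteq> 0 \<or> y \<noteq> 0 \<or> z \<noteq> 0" "x * l p1 + y * l p2 + z * l p3 = 0"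
    "x * l' q1 + y * l' q2 + z * l' q3 = 0"
    by (rule two_equations_three_unknowns)
  define g where "g = (\<lambda>t. x * p1 t + (y * p2 t + z * p3 t))"
  define g' where "g' = (\<lambda>t. x * q1 t + (y * q2 t + z * q3 t))"
  have C: "C1 g g'" unfolding g_def g'_def by (intro C1_add C1_scale q)
  have cp: "continuous_on UNIV p1" "continuous_on UNIV p2" "continuous_on UNIV p3"
    "continuous_on UNIV q1" "continuous_on UNIV q2" "continuous_on UNIV q3"
    using C1_cont[OF q(1)] C1_cont[OF q(2)] C1_cont[OF q(3)] C1_cont'[OF q(1)] C1_cont'[OF q(2)] C1_cont'[OF q(3)]
    by simp_all
  have adv: "advanced L \<gamma> (\<lambda>t. x * f1 t + (y * f2 t + z * f3 t)) s
        = x * advanced L \<gamma> f1 s + (y * advanced L \<gamma> f2 s + z * advanced L \<gamma> f3 s)"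
    and ret: "retarded L \<gamma> (\<lambda>t. x * f1 t + (y * f2 t + z * f3 t)) s
        = x * retarded L \<gamma> f1 s + (y * retarded L \<gamma> f2 s + z * retarded L \<gamma> f3 s)"
    if \<gamma>: "continuous_on UNIV \<gamma>" and f: "continuous_on UNIV f1" "continuous_on UNIV f2" "continuous_on UNIV f3"
    for \<gamma> f1 f2 f3 :: "real \<Rightarrow> real" and s
  proof -
    have cs: "continuous_on UNIV (\<lambda>t. x * f1 t)" "continuous_on UNIV (\<lambda>t. y * f2 t)"
      "continuous_on UNIV (\<lambda>t. z * f3 t)" "continuous_on UNIV (\<lambda>t. y * f2 t + z * f3 t)"
      by (intro continuous_intros f)+
    show "advanced L \<gamma> (\<lambda>t. x * f1 t + (y * f2 t + z * f3 t)) s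
        = x * advanced L \<gamma> f1 s + (y * advanced L \<gamma> f2 s + z * advanced L \<gamma> f3 s)"
      by (simp only: advanced_add(1)[OF \<gamma> cs(1) cs(4)] advanced_add(1)[OF \<gamma> cs(2) cs(3)] advanced_scale)
    show "retarded L \<gamma> (\<lambda>t. x * f1 t + (y * f2 t + z * f3 t)) s
        = x * retarded L \<gamma> f1 s + (y * retarded L \<gamma> f2 s + z * retarded L \<gamma> f3 s)"
      by (simp only: advanced_add(2)[OF \<gamma> cs(1) cs(4)] advanced_add(2)[OF \<gamma> cs(2) cs(3)] advanced_scale)
  qed
  have "l g = x * l p1 + y * l p2 + z * l p3"
    unfolding l_def g_def adv[OF \<alpha> cp(1,2,3)] ret[OF \<beta> cp(1,2,3)] by (simp add: algebra_simps)
  moreover have "l' g' = x * l' q1 + y * l' q2 + z * l' q3"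
    unfolding l'_def g'_def adv[OF \<alpha> cp(4,5,6)] ret[OF \<beta> cp(4,5,6)] by (simp add: algebra_simps)
  ultimately have "l g = 0" "l' g' = 0" using xyz(2,3) by simp_all
  then have lin: "advanced L \<alpha> g S = k * retarded L \<beta> g T" "advanced L \<alpha> g' S = k' * retarded L \<beta> g' T"
    by (simp_all add: l_def l'_def)
  have supp: "g t = 0" if "t \<le> a \<or> b \<le> t" for t
    using that c by (auto simp: g_def p1_def p2_def p3_def bump_support)
  have "\<exists>t\<in>{a..b}. g t \<noteq> 0"
  proof -
    have m: "bump a c1 ((a + c1) / 2) \<noteq> 0" "bump c1 c2 ((c1 + c2) / 2) \<noteq> 0" "bump c2 b ((c2 + b) / 2) \<noteq> 0"
      using bump_pos[of a "(a + c1) / 2" c1] bump_pos[of c1 "(c1 + c2) / 2" c2] bump_pos[of c2 "(c2 + b) / 2" b] c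
      by auto
    have "g ((a + c1) / 2) = x * bump a c1 ((a + c1) / 2)" "g ((c1 + c2) / 2) = y * bump c1 c2 ((c1 + c2) / 2)"
      "g ((c2 + b) / 2) = z * bump c2 b ((c2 + b) / 2)"
      using c by (auto simp: g_def p1_def p2_def p3_def bump_support)
    then have "g ((a + c1) / 2) \<noteq> 0 \<or> g ((c1 + c2) / 2) \<noteq> 0 \<or> g ((c2 + b) / 2) \<noteq> 0" using xyz(1) m by auto
    moreover have "(a + c1) / 2 \<in> {a..b}" "(c1 + c2) / 2 \<in> {a..b}" "(c2 + b) / 2 \<in> {a..b}" using c by auto
    ultimately show ?thesis by blast
  qed
  moreover have "continuous_on {a..b} (\<lambda>t. (g t)\<^sup>2)"
    by (intro continuous_intros continuous_on_subset[OF C1_cont[OF C]]) auto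
  ultimately have "integral {a..b} (\<lambda>t. (g t)\<^sup>2) \<noteq> 0"
    using integral_eq_0_iff[of a b "\<lambda>t. (g t)\<^sup>2"] ab by auto
  moreover have "0 \<le> integral {a..b} (\<lambda>t. (g t)\<^sup>2)"
    by (intro integral_nonneg integrable_continuous_real continuous_intros continuous_on_subset[OF C1_cont[OF C]]) auto
  ultimately have pos: "0 < integral {a..b} (\<lambda>t. (g t)\<^sup>2)" by simp
  show thesis
    by (rule that[of g g']) (fact C, rule supp, assumption, fact pos, fact lin(1), fact lin(2))
qed

section \<open>The echo of a signal in the past\<close>

lemma square_sum4_le: "(a + b + c + d)\<^sup>2 \<le> 4 * a\<^sup>2 + 4 * b\<^sup>2 + 4 * c\<^sup>2 + 4 * (d::real)\<^sup>2"
proof -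
  have "0 \<le> (a - b)\<^sup>2 + (a - c)\<^sup>2 + (a - d)\<^sup>2 + (b - c)\<^sup>2 + (b - d)\<^sup>2 + (c - d)\<^sup>2" by simp
  then show ?thesis by (simp add: power2_eq_square algebra_simps)
qed

text \<open>The leading term \<open>g(s + L)\<close> contributes the integral of its square over the shifted
  interval, and the integral operator at most a multiple of the window at each time.\<close>

lemma advanced_square_le:
  fixes \<alpha> g :: "real \<Rightarrow> real"
  assumes L: "0 < L" and \<alpha>: "continuous_on UNIV \<alpha>" "\<And>x. x \<in> {-1..1} \<Longrightarrow> \<bar>\<alpha> x\<bar> \<le> K"
    and g: "continuous_on UNIV g" and ab: "a \<le> b" and N: "\<And>s. s \<in> {a..b} \<Longrightarrow> window L g s \<le> N"
  shows "prim (\<lambda>s. (advanced L \<alpha> g s)\<^sup>2) b - prim (\<lambda>s. (advanced L \<alpha> g s)\<^sup>2) a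
    \<le> 2 * (prim_sq g (b + L) - prim_sq g (a + L)) + 4 * K\<^sup>2 / L * N * (b - a)"
proof -
  have ca: "continuous_on UNIV (\<lambda>s. (advanced L \<alpha> g s)\<^sup>2)"
    by (intro continuous_intros continuous_on_advanced[OF \<alpha>(1) g])
  have cg: "continuous_on UNIV (\<lambda>r. (g r)\<^sup>2)" by (intro continuous_intros g)
  define F where "F = (\<lambda>s. 2 * prim_sq g (s + L) + 4 * K\<^sup>2 / L * N * s - prim (\<lambda>s. (advanced L \<alpha> g s)\<^sup>2) s)"
  have "F a \<le> F b"
  proof (rule DERIV_nonneg_imp_nondecreasing[where f = F, OF ab])
    fix s assume s: "a \<le> s" "s \<le> b"
    have d: "((\<lambda>s. prim_sq g (s + L)) has_real_derivative (g (s + L))\<^sup>2) (at s)"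
      by (rule DERIV_chain2[OF DERIV_prim[OF cg], THEN DERIV_cong]) (auto intro!: derivative_eq_intros)
    have "(F has_real_derivative 2 * (g (s + L))\<^sup>2 + 4 * K\<^sup>2 / L * N - (advanced L \<alpha> g s)\<^sup>2) (at s)"
      unfolding F_def using L by (auto intro!: derivative_eq_intros d DERIV_prim[OF ca])
    moreover have "0 \<le> 2 * (g (s + L))\<^sup>2 + 4 * K\<^sup>2 / L * N - (advanced L \<alpha> g s)\<^sup>2"
    proof -
      have "(conv L \<alpha> g s)\<^sup>2 \<le> 2 * K\<^sup>2 / L * window L g s"
        by (rule conv_square_le[OF L \<alpha> g])
      also have "\<dots> \<le> 2 * K\<^sup>2 / L * N" using N[of s] s L by (intro mult_left_mono) auto
      finally have "2 * (conv L \<alpha> g s)\<^sup>2 \<le> 2 * (2 * K\<^sup>2 / L * N)"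
        by (rule mult_left_mono) simp
      also have "\<dots> = 4 * K\<^sup>2 / L * N" using L by (simp add: field_simps)
      finally have "2 * (conv L \<alpha> g s)\<^sup>2 \<le> 4 * K\<^sup>2 / L * N" .
      moreover have "(advanced L \<alpha> g s)\<^sup>2 \<le> 2 * (g (s + L))\<^sup>2 + 2 * (conv L \<alpha> g s)\<^sup>2"
        unfolding advanced_def by (rule square_sum2_le)
      ultimately show ?thesis by linarith
    qed
    ultimately show "\<exists>y. (F has_real_derivative y) (at s) \<and> 0 \<le> y" by blast
  qed
  moreover have "4 * K\<^sup>2 / L * N * (b - a) = 4 * K\<^sup>2 / L * N * b - 4 * K\<^sup>2 / L * N * a"
    by (simp only: right_diff_distrib)
  ultimately show ?thesis unfolding F_def right_diff_distrib by linarith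
qed

text \<open>The trace \<open>h\<close> is the signal \<open>g\<close>, which enters during
  \<open>[a, S0]\<close>, plus its echo \<open>f\<close> in the past. Solving the equation for
  \<open>f(\<Theta> s - L)\<close> and changing variables from \<open>s\<close> to
  \<open>\<Theta> s\<close> in the squared norm produces the factor \<open>\<Theta>'\<close>, which
  is at most \<open>\<eta>\<close> on the only interval where the signal is seen. The terms with
  \<open>f\<close> itself are absorbed by an exponential weight in time, as in Gronwall's
  inequality; \<open>f(s + L)\<close> is one round trip later, so it carries the small factor
  \<open>exp (- 2 q L)\<close>.\<close>

lemma backward_echo_le:
  fixes \<alpha> \<beta> :: "real \<Rightarrow> real"
  assumes L: "0 < L" and \<alpha>: "continuous_on UNIV \<alpha>" and \<beta>: "continuous_on UNIV \<beta>" and k: "k \<noteq> 0"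
    and A: "0 \<le> A" and S: "0 \<le> S"
  obtains B where "0 < B" "\<And>\<Theta> \<Theta>' S0 a \<eta> h g h' g'. C1 \<Theta> \<Theta>' \<Longrightarrow> (\<And>s. s \<in> {0..S0} \<Longrightarrow> 0 \<le> \<Theta>' s \<and> \<Theta>' s \<le> A) \<Longrightarrow>
    (\<And>s. s \<in> {a..S0} \<Longrightarrow> \<Theta>' s \<le> \<eta>) \<Longrightarrow> \<Theta> 0 = 0 \<Longrightarrow> (\<And>s. s \<in> {0..S0} \<Longrightarrow> \<Theta> s \<le> s) \<Longrightarrow>
    0 \<le> a \<Longrightarrow> a \<le> S0 \<Longrightarrow> S0 \<le> S \<Longrightarrow> \<Theta> S0 \<le> a \<Longrightarrow> 0 \<le> \<eta> \<Longrightarrow> C1 h h' \<Longrightarrow> C1 g g' \<Longrightarrow>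
    (\<And>t. t \<le> a + L \<or> S0 + L \<le> t \<Longrightarrow> g t = 0) \<Longrightarrow> (\<And>t. \<Theta> S0 - L \<le> t \<Longrightarrow> h t = g t) \<Longrightarrow>
    (\<And>s. s \<in> {0..S0} \<Longrightarrow> advanced L \<alpha> h s = k * retarded L \<beta> h (\<Theta> s)) \<Longrightarrow>
    window L h 0 \<le> B * \<eta> * integral {a + L..S0 + L} (\<lambda>t. (g t)\<^sup>2)"
proof -
  obtain K1 where K1: "0 < K1" "\<And>x. x \<in> {-1..1} \<Longrightarrow> \<bar>\<alpha> x\<bar> \<le> K1" using compact_kernel_bound[OF \<alpha>] by blast
  obtain K2 where K2: "0 < K2" "\<And>x. x \<in> {-1..1} \<Longrightarrow> \<bar>\<beta> x\<bar> \<le> K2" using compact_kernel_bound[OF \<beta>] by blast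
  define c1 where "c1 = 8 * K2\<^sup>2 / L + 4 / k\<^sup>2 * (2 * K1\<^sup>2 / L)"
  define c2 where "c2 = 4 * A / k\<^sup>2"
  define c3 where "c3 = 4 / k\<^sup>2"
  define C where "C = 2 + 4 * K1\<^sup>2 / L * S"
  have c: "0 < c1" "0 \<le> c2" "0 < c3" "0 < C" using L K1 K2 k A S
    by (auto simp: c1_def c2_def c3_def C_def intro!: add_pos_nonneg divide_pos_pos)
  \<comment> \<open>The rate for which both contributions of \<open>f\<close> to its own estimate add up to at
    most \<open>1 / 2\<close> (the fact \<open>half\<close>).\<close>
  define q where "q = 2 * c1 + c2 / L"
  have q: "0 < q" using c L by (simp add: q_def add_pos_nonneg)
  have half: "c1 / q + c2 * exp (- q * (2 * L)) \<le> 1 / 2"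
  proof -
    have "1 + q * (2 * L) \<le> exp (q * (2 * L))" by (rule exp_ge_add_one_self)
    then have "q * (2 * L) \<le> exp (q * (2 * L))" by linarith
    then have "exp (- q * (2 * L)) \<le> 1 / (q * (2 * L))"
      using q L by (simp add: exp_minus inverse_eq_divide frac_le)
    then have "c2 * exp (- q * (2 * L)) \<le> c2 * (1 / (q * (2 * L)))" using c by (intro mult_left_mono)
    also have "\<dots> = (c2 / L) / 2 / q" using q L by (simp add: field_simps)
    finally have "c1 / q + c2 * exp (- q * (2 * L)) \<le> (c1 + (c2 / L) / 2) / q" by (simp add: add_divide_distrib)
    also have "c1 + (c2 / L) / 2 = q / 2" by (simp add: q_def)
    finally show ?thesis using q by simp
  qed
  show thesis
  proof (rule that[of "2 * c3 * C * exp (q * S)"])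
    show "0 < 2 * c3 * C * exp (q * S)" using c by simp
    fix \<Theta> \<Theta>' :: "real \<Rightarrow> real" and S0 a \<eta> and h g h' g' :: "real \<Rightarrow> real"
    assume \<Theta>: "C1 \<Theta> \<Theta>'" and \<Theta>': "\<And>s. s \<in> {0..S0} \<Longrightarrow> 0 \<le> \<Theta>' s \<and> \<Theta>' s \<le> A"
      and eta: "\<And>s. s \<in> {a..S0} \<Longrightarrow> \<Theta>' s \<le> \<eta>" and \<Theta>0: "\<Theta> 0 = 0" and le: "\<And>s. s \<in> {0..S0} \<Longrightarrow> \<Theta> s \<le> s"
      and a: "0 \<le> a" "a \<le> S0" "S0 \<le> S" "\<Theta> S0 \<le> a" and \<eta>: "0 \<le> \<eta>"
      and h: "C1 h h'" and g: "C1 g g'" and supp: "\<And>t. t \<le> a + L \<or> S0 + L \<le> t \<Longrightarrow> g t = 0"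
      and hg: "\<And>t. \<Theta> S0 - L \<le> t \<Longrightarrow> h t = g t"
      and eq: "\<And>s. s \<in> {0..S0} \<Longrightarrow> advanced L \<alpha> h s = k * retarded L \<beta> h (\<Theta> s)"
    define T0 where "T0 = \<Theta> S0"
    define N where "N = integral {a + L..S0 + L} (\<lambda>t. (g t)\<^sup>2)"
    have cg: "continuous_on UNIV g" and ch: "continuous_on UNIV h" by (rule C1_cont[OF g], rule C1_cont[OF h])
    have cg2: "continuous_on UNIV (\<lambda>r. (g r)\<^sup>2)" by (intro continuous_intros cg)
    define f where "f = (\<lambda>t. h t + - g t)"
    have cf: "continuous_on UNIV f" unfolding f_def by (intro continuous_intros cg ch)
    have cf2: "continuous_on UNIV (\<lambda>r. (f r)\<^sup>2)" by (intro continuous_intros cf)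
    have f0: "f t = 0" if "T0 - L \<le> t" for t using hg[of t] that by (simp add: f_def T0_def)
    have hfg: "h = (\<lambda>t. f t + g t)" by (simp add: f_def)
    define G where "G = prim_sq f"
    \<comment> \<open>The squared norm of the echo from time \<open>t - L\<close> on; the echo ends at
      \<open>T0 - L\<close>.\<close>
    define F where "F = (\<lambda>t. G (T0 - L) - G (t - L))"
    have Gmono: "G x \<le> G y" if "x \<le> y" for x y unfolding G_def by (rule prim_mono[OF cf2 _ that]) simp
    have Gtop: "G x = G (T0 - L)" if "T0 - L \<le> x" for x
    proof -
      have "integral {T0 - L..x} (\<lambda>r. (f r)\<^sup>2) = integral {T0 - L..x} (\<lambda>r. 0)"
        by (rule integral_eqI) (simp add: f0)
      then show ?thesis using integral_prim[OF cf2 that] by (simp add: G_def)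
    qed
    have Fanti: "F y \<le> F x" if "x \<le> y" for x y using Gmono[of "x - L" "y - L"] that by (simp add: F_def)
    have F0: "F t = 0" if "T0 \<le> t" for t using Gtop[of "t - L"] that by (simp add: F_def)
    have Fpos: "0 \<le> F t" for t using Fanti[of t "max t T0"] F0[of "max t T0"] by simp
    have Gle: "G x \<le> G (T0 - L)" for x using Gmono[of x "max x (T0 - L)"] Gtop[of "max x (T0 - L)"] by simp
    have win: "window L f t \<le> F t" for t
      using window_prim[OF cf, of L t] L Gle[of "t + L"] by (simp add: F_def G_def)
    have \<Theta>mono: "\<Theta> x \<le> \<Theta> y" if "0 \<le> x" "x \<le> y" "y \<le> S0" for x y
    proof (rule DERIV_nonneg_imp_nondecreasing[where f = \<Theta>, OF that(2)])
      fix z assume "x \<le> z" "z \<le> y"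
      then show "\<exists>w. (\<Theta> has_real_derivative w) (at z) \<and> 0 \<le> w"
        using \<Theta>'[of z] C1_deriv[OF \<Theta>, of z UNIV] that by (intro exI[of _ "\<Theta>' z"]) auto
    qed
    have T0: "0 \<le> T0" "T0 \<le> a" using \<Theta>mono[of 0 S0] a \<Theta>0 by (auto simp: T0_def)
    have \<Theta>in: "0 \<le> \<Theta> s" "\<Theta> s \<le> T0" if "s \<in> {0..S0}" for s
      using \<Theta>mono[of 0 s] \<Theta>mono[of s S0] that \<Theta>0 by (auto simp: T0_def)
    have ca: "continuous_on UNIV (\<lambda>s. (advanced L \<alpha> g s)\<^sup>2)"
      by (intro continuous_intros continuous_on_advanced[OF \<alpha> cg])
    define H where "H = prim (\<lambda>s. (advanced L \<alpha> g s)\<^sup>2)"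
    have Hmono: "H x \<le> H y" if "x \<le> y" for x y unfolding H_def by (rule prim_mono[OF ca _ that]) simp
    have adv0: "advanced L \<alpha> g s = 0" if "s \<le> a" for s
      by (rule advanced_zero) (use L that supp in auto)
    have Nwin: "window L g s \<le> N" for s
    proof -
      have P0: "prim_sq g y - prim_sq g x = 0" if "x \<le> y" "y \<le> a + L \<or> S0 + L \<le> x" for x y
      proof -
        have "integral {x..y} (\<lambda>r. (g r)\<^sup>2) = integral {x..y} (\<lambda>r. 0)"
          by (rule integral_eqI) (use that supp in auto)
        then show ?thesis using integral_prim[OF cg2 that(1)] by simp
      qed
      define lo hi where "lo = min (s - L) (a + L)" and "hi = max (s + L) (S0 + L)"
      have "prim_sq g (s + L) - prim_sq g (s - L) \<le> prim_sq g hi - prim_sq g lo"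
        using prim_mono[OF cg2, of "s + L" hi] prim_mono[OF cg2, of lo "s - L"] by (simp add: lo_def hi_def)
      also have "\<dots> = prim_sq g (S0 + L) - prim_sq g (a + L)"
        using P0[of lo "a + L"] P0[of "S0 + L" hi] by (simp add: lo_def hi_def)
      also have "\<dots> = N" using integral_prim[OF cg2, of "a + L" "S0 + L"] a by (simp add: N_def)
      finally show ?thesis using window_prim[OF cg, of L s] L by simp
    qed
    have N0: "0 \<le> N" using order_trans[OF window_nonneg Nwin] .
    have HN: "H S0 - H a \<le> C * N"
    proof -
      have "H S0 - H a \<le> 2 * (prim_sq g (S0 + L) - prim_sq g (a + L)) + 4 * K1\<^sup>2 / L * N * (S0 - a)"
        unfolding H_def by (rule advanced_square_le[OF L \<alpha> K1(2) cg a(2) Nwin])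
      moreover have "prim_sq g (S0 + L) - prim_sq g (a + L) = N"
        using integral_prim[OF cg2, of "a + L" "S0 + L"] a by (simp add: N_def)
      moreover have "4 * K1\<^sup>2 / L * N * (S0 - a) \<le> 4 * K1\<^sup>2 / L * N * S"
        using a L N0 by (intro mult_left_mono) auto
      moreover have "C * N = 2 * N + 4 * K1\<^sup>2 / L * N * S"
        by (simp add: C_def distrib_right)
      ultimately show ?thesis by simp
    qed
    have Ha: "H s = H a" if "s \<le> a" for s
    proof -
      have "integral {s..a} (\<lambda>s. (advanced L \<alpha> g s)\<^sup>2) = integral {s..a} (\<lambda>s. 0)"
        by (rule integral_eqI) (simp add: adv0)
      then show ?thesis using integral_prim[OF ca that] by (simp add: H_def)
    qed
    have HN': "H S0 - H s \<le> C * N" for s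
    proof (cases "s \<le> a")
      case True
      then show ?thesis using HN Ha[OF True] by linarith
    next
      case False
      then have "H a \<le> H s" by (intro Hmono) simp
      then show ?thesis using HN by linarith
    qed
    have point: "(f (\<Theta> s - L))\<^sup>2 \<le> c1 * F (\<Theta> s) + c3 * (f (s + L))\<^sup>2 + c3 * (advanced L \<alpha> g s)\<^sup>2"
      if s: "s \<in> {0..S0}" for s
    proof -
      define X Y where "X = conv L \<beta> f (\<Theta> s)"
        and "Y = conv L \<alpha> f s"
      have "retarded L \<beta> g (\<Theta> s) = 0"
        by (rule advanced_zero) (use L supp \<Theta>in[OF s] T0 in auto)
      then have "retarded L \<beta> h (\<Theta> s) = f (\<Theta> s - L) + X"
        unfolding hfg advanced_add[OF \<beta> cf cg] by (simp add: retarded_def X_def)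
      moreover have "advanced L \<alpha> h s = f (s + L) + Y + advanced L \<alpha> g s"
        unfolding hfg advanced_add[OF \<alpha> cf cg] by (simp add: advanced_def[of L \<alpha> f] Y_def)
      ultimately have "f (s + L) + Y + advanced L \<alpha> g s = k * (f (\<Theta> s - L) + X)" using eq[OF s] by simp
      then have "f (\<Theta> s - L) = - X + f (s + L) / k + Y / k + advanced L \<alpha> g s / k"
        using k by (simp add: field_simps)
      then have "(f (\<Theta> s - L))\<^sup>2 \<le> 4 * (- X)\<^sup>2 + 4 * (f (s + L) / k)\<^sup>2 + 4 * (Y / k)\<^sup>2 + 4 * (advanced L \<alpha> g s / k)\<^sup>2"
        using square_sum4_le by metis
      also have "\<dots> = 4 * X\<^sup>2 + c3 * (f (s + L))\<^sup>2 + c3 * Y\<^sup>2 + c3 * (advanced L \<alpha> g s)\<^sup>2"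
        by (simp add: c3_def power_divide)
      finally have le4: "(f (\<Theta> s - L))\<^sup>2 \<le> 4 * X\<^sup>2 + c3 * (f (s + L))\<^sup>2 + c3 * Y\<^sup>2 + c3 * (advanced L \<alpha> g s)\<^sup>2" .
      have "X\<^sup>2 \<le> 2 * K2\<^sup>2 / L * F (\<Theta> s)"
        unfolding X_def using L by (intro order_trans[OF conv_square_le[OF L \<beta> K2(2) cf] mult_left_mono[OF win]]) auto
      moreover have "Y\<^sup>2 \<le> 2 * K1\<^sup>2 / L * F (\<Theta> s)"
        unfolding Y_def using L order_trans[OF win[of s] Fanti[OF le[OF s]]]
        by (intro order_trans[OF conv_square_le[OF L \<alpha> K1(2) cf] mult_left_mono]) auto
      then have "c3 * Y\<^sup>2 \<le> c3 * (2 * K1\<^sup>2 / L * F (\<Theta> s))" using c(3) by (intro mult_left_mono) auto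
      moreover have "c1 * F (\<Theta> s) = 4 * (2 * K2\<^sup>2 / L * F (\<Theta> s)) + c3 * (2 * K1\<^sup>2 / L * F (\<Theta> s))"
        unfolding c1_def c3_def by (simp add: distrib_right)
      ultimately show ?thesis using le4 by linarith
    qed
    \<comment> \<open>The maximum \<open>m\<close> of the weighted norm; it is estimated below by one half of
      itself plus the contribution of the signal.\<close>
    have "\<exists>s\<in>{0..S0}. \<forall>r\<in>{0..S0}. exp (- q * (T0 - \<Theta> r)) * F (\<Theta> r) \<le> exp (- q * (T0 - \<Theta> s)) * F (\<Theta> s)"
    proof (rule continuous_attains_sup)
      have cG: "continuous_on UNIV G" unfolding G_def by (rule C1_cont[OF C1_prim[OF cf2]])
      have c\<Theta>: "continuous_on {0..S0} \<Theta>" by (rule continuous_on_subset[OF C1_cont[OF \<Theta>]]) simp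
      then have "continuous_on {0..S0} (\<lambda>s. G (\<Theta> s - L))"
        by (intro continuous_on_UNIV_compose[OF cG] continuous_on_diff continuous_on_const)
      then show "continuous_on {0..S0} (\<lambda>s. exp (- q * (T0 - \<Theta> s)) * F (\<Theta> s))"
        unfolding F_def using c\<Theta> by (intro continuous_intros)
    qed (use a in auto)
    then obtain sm where sm: "sm \<in> {0..S0}"
      "\<And>r. r \<in> {0..S0} \<Longrightarrow> exp (- q * (T0 - \<Theta> r)) * F (\<Theta> r) \<le> exp (- q * (T0 - \<Theta> sm)) * F (\<Theta> sm)" by blast
    define m where "m = exp (- q * (T0 - \<Theta> sm)) * F (\<Theta> sm)"
    have m0: "0 \<le> m" using Fpos by (simp add: m_def)
    have Fm: "F t \<le> m * exp (q * (T0 - t))" if "0 \<le> t" for t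
    proof (cases "t \<le> T0")
      case True
      have "\<exists>s. 0 \<le> s \<and> s \<le> S0 \<and> \<Theta> s = t"
        using that True \<Theta>0 a by (intro IVT' continuous_on_subset[OF C1_cont[OF \<Theta>]]) (auto simp: T0_def)
      then obtain s where "s \<in> {0..S0}" "\<Theta> s = t" by auto
      then have "exp (- q * (T0 - t)) * F t \<le> m" using sm(2)[of s] by (simp add: m_def)
      then have "F t / exp (q * (T0 - t)) \<le> m" by (simp add: exp_minus divide_inverse mult.commute)
      then show ?thesis by (simp add: divide_le_eq)
    qed (use F0[of t] m0 in simp)
    have main: "F (\<Theta> s) \<le> m / 2 * exp (q * (T0 - \<Theta> s)) + c3 * \<eta> * (C * N)" if s: "s \<in> {0..S0}" for s
    proof -
      \<comment> \<open>Multiplying the pointwise bound by \<open>\<Theta>'\<close> and integrating over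
        \<open>[s, S0]\<close> amounts to the monotonicity of \<open>W\<close>.\<close>
      define W where "W = (\<lambda>s. F (\<Theta> s) - c1 * m / q * exp (q * (T0 - \<Theta> s)) + c2 * G (s + L) + c3 * \<eta> * H s)"
      have "W s \<le> W S0"
      proof (rule DERIV_nonneg_imp_nondecreasing[where f = W])
        show "s \<le> S0" using s by simp
        fix r assume "s \<le> r" "r \<le> S0"
        then have r: "r \<in> {0..S0}" using s by auto
        have dG: "(G has_real_derivative (f x)\<^sup>2) (at x)" for x unfolding G_def by (rule DERIV_prim[OF cf2])
        have dH: "(H has_real_derivative (advanced L \<alpha> g x)\<^sup>2) (at x)" for x unfolding H_def by (rule DERIV_prim[OF ca])
        have d1: "((\<lambda>s. G (\<Theta> s - L)) has_real_derivative (f (\<Theta> r - L))\<^sup>2 * \<Theta>' r) (at r)"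
          by (rule DERIV_chain2[OF dG]) (auto intro!: derivative_eq_intros C1_deriv[OF \<Theta>])
        have d2: "((\<lambda>s. G (s + L)) has_real_derivative (f (r + L))\<^sup>2) (at r)"
          by (rule DERIV_chain2[OF dG, THEN DERIV_cong]) (auto intro!: derivative_eq_intros)
        have d3: "((\<lambda>s. exp (q * (T0 - \<Theta> s))) has_real_derivative - (q * exp (q * (T0 - \<Theta> r)) * \<Theta>' r)) (at r)"
          by (auto intro!: derivative_eq_intros C1_deriv[OF \<Theta>] simp: algebra_simps)
        define e where "e = exp (q * (T0 - \<Theta> r))"
        define D where "D = - ((f (\<Theta> r - L))\<^sup>2 * \<Theta>' r) + c1 * m * (e * \<Theta>' r) + c2 * (f (r + L))\<^sup>2 + c3 * \<eta> * (advanced L \<alpha> g r)\<^sup>2"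
        have "(W has_real_derivative (0 - (f (\<Theta> r - L))\<^sup>2 * \<Theta>' r) - c1 * m / q * (- (q * e * \<Theta>' r))
            + c2 * (f (r + L))\<^sup>2 + c3 * \<eta> * (advanced L \<alpha> g r)\<^sup>2) (at r)"
          unfolding W_def F_def e_def
          by (intro DERIV_add DERIV_diff DERIV_cmult DERIV_const d1 d2 d3 dH)
        then have "(W has_real_derivative D) (at r)"
          by (rule DERIV_cong) (use q in \<open>simp add: D_def\<close>)
        moreover have "0 \<le> D"
        proof -
          have t0: "0 \<le> \<Theta>' r" "\<Theta>' r \<le> A" using \<Theta>'[OF r] by auto
          have "F (\<Theta> r) \<le> m * e" using Fm[OF \<Theta>in(1)[OF r]] by (simp add: e_def)
          then have "c1 * F (\<Theta> r) \<le> c1 * (m * e)" using c by (intro mult_left_mono) auto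
          then have "(f (\<Theta> r - L))\<^sup>2 \<le> c1 * (m * e) + c3 * (f (r + L))\<^sup>2 + c3 * (advanced L \<alpha> g r)\<^sup>2"
            using point[OF r] by linarith
          then have "(f (\<Theta> r - L))\<^sup>2 * \<Theta>' r \<le> (c1 * (m * e) + c3 * (f (r + L))\<^sup>2 + c3 * (advanced L \<alpha> g r)\<^sup>2) * \<Theta>' r"
            using t0 by (intro mult_right_mono)
          also have "\<dots> = c1 * m * (e * \<Theta>' r) + c3 * (f (r + L))\<^sup>2 * \<Theta>' r + c3 * (advanced L \<alpha> g r)\<^sup>2 * \<Theta>' r"
            by (simp add: algebra_simps)
          finally have le3: "(f (\<Theta> r - L))\<^sup>2 * \<Theta>' r
              \<le> c1 * m * (e * \<Theta>' r) + c3 * (f (r + L))\<^sup>2 * \<Theta>' r + c3 * (advanced L \<alpha> g r)\<^sup>2 * \<Theta>' r" .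
          have "c3 * (f (r + L))\<^sup>2 * \<Theta>' r \<le> c3 * (f (r + L))\<^sup>2 * A" using t0 c by (intro mult_left_mono) auto
          moreover have "c3 * (f (r + L))\<^sup>2 * A = c2 * (f (r + L))\<^sup>2" by (simp add: c2_def c3_def)
          moreover have "c3 * (advanced L \<alpha> g r)\<^sup>2 * \<Theta>' r \<le> c3 * (advanced L \<alpha> g r)\<^sup>2 * \<eta>"
          proof (cases "r \<le> a")
            case False
            then show ?thesis using eta[of r] r c by (intro mult_left_mono) auto
          qed (simp add: adv0)
          moreover have "c3 * (advanced L \<alpha> g r)\<^sup>2 * \<eta> = c3 * \<eta> * (advanced L \<alpha> g r)\<^sup>2" by simp
          ultimately show ?thesis using le3 unfolding D_def by linarith
        qed
        ultimately show "\<exists>y. (W has_real_derivative y) (at r) \<and> 0 \<le> y" by blast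
      qed
      moreover have "W S0 = - (c1 * m / q) + c2 * G (S0 + L) + c3 * \<eta> * H S0"
        using F0[of T0] by (simp add: W_def T0_def[symmetric])
      ultimately have "F (\<Theta> s) \<le> c1 * m / q * exp (q * (T0 - \<Theta> s)) - c1 * m / q + c2 * (G (S0 + L) - G (s + L)) + c3 * \<eta> * (H S0 - H s)"
        by (simp add: W_def algebra_simps)
      moreover have "0 \<le> c1 * m / q" using c m0 q by simp
      moreover have "c2 * (G (S0 + L) - G (s + L)) \<le> c2 * (m * (exp (- q * (2 * L)) * exp (q * (T0 - \<Theta> s))))"
      proof (rule mult_left_mono)
        have "G (S0 + L) = G (T0 - L)" using T0 a L by (intro Gtop) linarith
        moreover have "s + 2 * L - L = s + L" by simp
        ultimately have "G (S0 + L) - G (s + L) = F (s + 2 * L)" by (simp only: F_def)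
        also have "\<dots> \<le> F (\<Theta> s + 2 * L)" using le[OF s] by (intro Fanti) simp
        also have "\<dots> \<le> m * exp (q * (T0 - (\<Theta> s + 2 * L)))" using \<Theta>in[OF s] L by (intro Fm) auto
        also have "exp (q * (T0 - (\<Theta> s + 2 * L))) = exp (- q * (2 * L)) * exp (q * (T0 - \<Theta> s))"
          by (simp add: exp_add[symmetric] algebra_simps)
        finally show "G (S0 + L) - G (s + L) \<le> m * (exp (- q * (2 * L)) * exp (q * (T0 - \<Theta> s)))" .
      qed (rule c)
      moreover have "c3 * \<eta> * (H S0 - H s) \<le> c3 * \<eta> * (C * N)" using c \<eta> by (intro mult_left_mono HN') auto
      ultimately have "F (\<Theta> s) \<le> c1 * m / q * exp (q * (T0 - \<Theta> s))
          + c2 * (m * (exp (- q * (2 * L)) * exp (q * (T0 - \<Theta> s)))) + c3 * \<eta> * (C * N)" by linarith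
      also have "c1 * m / q * exp (q * (T0 - \<Theta> s)) + c2 * (m * (exp (- q * (2 * L)) * exp (q * (T0 - \<Theta> s))))
          = (c1 / q + c2 * exp (- q * (2 * L))) * (m * exp (q * (T0 - \<Theta> s)))" by (simp add: algebra_simps)
      also have "\<dots> \<le> 1 / 2 * (m * exp (q * (T0 - \<Theta> s)))" using m0 by (intro mult_right_mono half) auto
      finally show ?thesis by simp
    qed
    have m_le: "m \<le> 2 * (c3 * \<eta> * (C * N))"
    proof -
      define e where "e = exp (q * (T0 - \<Theta> sm))"
      have e: "1 \<le> e" using q \<Theta>in(2)[OF sm(1)] by (simp add: e_def)
      have "m = F (\<Theta> sm) / e" by (simp add: m_def e_def exp_minus divide_inverse mult.commute)
      then have "m * e = F (\<Theta> sm)" using e by simp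
      then have "m * e \<le> m / 2 * e + c3 * \<eta> * (C * N)" using main[OF sm(1)] by (simp add: e_def)
      then have "m / 2 * e \<le> c3 * \<eta> * (C * N)" by simp
      moreover have "m / 2 * 1 \<le> m / 2 * e" using e m0 by (intro mult_left_mono) auto
      ultimately show ?thesis by simp
    qed
    have "window L h 0 = window L f 0"
      unfolding window_def
      by (rule integral_eqI) (use supp a in \<open>auto simp: f_def\<close>)
    also have "\<dots> \<le> F 0" by (rule win)
    also have "\<dots> \<le> m * exp (q * (T0 - 0))" by (rule Fm) simp
    also have "\<dots> \<le> 2 * (c3 * \<eta> * (C * N)) * exp (q * S)"
      using m0 m_le q T0 a by (intro mult_mono) auto
    finally show "window L h 0 \<le> 2 * c3 * C * exp (q * S) * \<eta> * integral {a + L..S0 + L} (\<lambda>t. (g t)\<^sup>2)"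
      by (simp add: N_def mult_ac)
  qed
qed

section \<open>Instability for each kind of starting phase\<close>

definition trajectory ::
  "real \<Rightarrow> (real \<Rightarrow> real) \<Rightarrow> (real \<Rightarrow> real) \<Rightarrow> real \<Rightarrow> (real \<Rightarrow> real) \<Rightarrow> (real \<Rightarrow> real) \<Rightarrow> bool" where
  "trajectory L \<alpha> \<beta> k \<Theta> h \<longleftrightarrow>
     (\<exists>h'. C1 h h') \<and> (\<forall>s\<ge>0. advanced L \<alpha> h s = k * retarded L \<beta> h (\<Theta> s))"

text \<open>What exponential stability says about the scalar equation when its rate is forgotten.\<close>

definition bounded_windows ::
  "real \<Rightarrow> (real \<Rightarrow> real) \<Rightarrow> (real \<Rightarrow> real) \<Rightarrow> real \<Rightarrow> (real \<Rightarrow> real) \<Rightarrow> real \<Rightarrow> bool" where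
  "bounded_windows L \<alpha> \<beta> k \<Theta> C \<longleftrightarrow>
     (\<forall>h T. trajectory L \<alpha> \<beta> k \<Theta> h \<longrightarrow> 0 \<le> T \<longrightarrow> window L h T \<le> C * window L h 0)"

lemma trajectory_continuous: "trajectory L \<alpha> \<beta> k \<Theta> h \<Longrightarrow> continuous_on UNIV h"
  unfolding trajectory_def by (auto intro: C1_cont)

text \<open>Because \<open>exp x \<ge> 1 + x\<close>, the windows of the mode exceed a linear function of time.\<close>

lemma growing_trajectory:
  assumes st: "bounded_windows L \<alpha> \<beta> k \<Theta> C" and L: "0 < L" and \<nu>: "0 < \<nu>"
    and h: "trajectory L \<alpha> \<beta> k \<Theta> h" and grow: "\<And>t. t0 \<le> t \<Longrightarrow> h t = exp (\<nu> * t)"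
  shows False
proof -
  define w where "w = C * window L h 0"
  define T where "T = max 0 t0 + L + (\<bar>w\<bar> + 1) / (4 * L * \<nu>)"
  have p: "0 < 4 * L * \<nu>" using L \<nu> by simp
  then have q: "0 \<le> (\<bar>w\<bar> + 1) / (4 * L * \<nu>)" by simp
  have T: "0 \<le> T" "t0 \<le> T - L" "0 \<le> T - L" "(\<bar>w\<bar> + 1) / (4 * L * \<nu>) \<le> T - L"
    using L q by (simp_all add: T_def)
  have "\<bar>w\<bar> + 1 \<le> (T - L) * (4 * L * \<nu>)" using T(4) p by (simp only: pos_divide_le_eq)
  also have "\<dots> = integral {T - L..T + L} (\<lambda>t. 2 * \<nu> * (T - L))" using L by simp
  also have "\<dots> \<le> integral {T - L..T + L} (\<lambda>t. (h t)\<^sup>2)"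
  proof (rule integral_le)
    show "(\<lambda>t. (h t)\<^sup>2) integrable_on {T - L..T + L}"
      by (intro integrable_continuous_real continuous_intros continuous_on_subset[OF trajectory_continuous[OF h]]) simp
    fix t assume t: "t \<in> {T - L..T + L}"
    have "2 * \<nu> * (T - L) \<le> 2 * \<nu> * t" using t \<nu> by (intro mult_left_mono) auto
    also have "\<dots> \<le> exp (2 * \<nu> * t)" using exp_ge_add_one_self[of "2 * \<nu> * t"] by linarith
    also have "\<dots> = (h t)\<^sup>2" using grow[of t] t T by (simp add: power2_eq_square exp_add[symmetric])
    finally show "2 * \<nu> * (T - L) \<le> (h t)\<^sup>2" .
  qed (rule integrable_const_ivl)
  also have "\<dots> \<le> w" using st h T(1) unfolding bounded_windows_def w_def window_def by blast
  finally show False by simp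
qed

text \<open>The mode solves the equation for \<open>s \<ge> 2 \<tau>\<close> if it is left unchanged from time
  \<open>\<tau> - L\<close> on. It also solves the equation and its derivative at
  \<open>s = 2 \<tau>\<close>, since there the lag has the value \<open>\<tau>\<close> and
  derivative \<open>0\<close>, which are the conditions for the backward continuation.\<close>

lemma invertible_delay_not_stable:
  fixes \<alpha> \<beta> :: "real \<Rightarrow> real"
  assumes st: "bounded_windows L \<alpha> \<beta> k \<Theta> C" and L: "0 < L"
    and \<alpha>: "continuous_on UNIV \<alpha>" and \<beta>: "continuous_on UNIV \<beta>" and k: "k \<noteq> 0" and \<tau>: "0 < \<tau>"
    and \<Theta>: "C1 \<Theta> \<Theta>'" "\<And>s. 0 \<le> s \<Longrightarrow> \<Theta> s \<le> s" "\<And>s. 2 * \<tau> \<le> s \<Longrightarrow> \<Theta> s = s - \<tau>" "\<Theta>' (2 * \<tau>) = 1"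
    and pos: "\<And>s. s \<in> {0..2 * \<tau>} \<Longrightarrow> 0 < \<Theta>' s"
    and \<nu>: "0 < \<nu>" and root: "advanced L \<alpha> (\<lambda>t. exp (\<nu> * t)) 0 = k * exp (- \<nu> * \<tau>) * retarded L \<beta> (\<lambda>t. exp (\<nu> * t)) 0"
  shows False
proof -
  define e where "e = (\<lambda>t. exp (\<nu> * t))"
  have e: "C1 e (\<lambda>t. \<nu> * e t)" unfolding C1_def e_def
    by (auto intro!: derivative_eq_intros continuous_intros)
  have eig: "advanced L \<alpha> e s = k * retarded L \<beta> e (s - \<tau>)" for s
  proof -
    have "exp (\<nu> * (s - \<tau>)) = exp (\<nu> * s) * exp (- \<nu> * \<tau>)" by (simp add: exp_add[symmetric] algebra_simps)
    then show ?thesis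
      unfolding e_def advanced_exp(1)[of L \<alpha> \<nu> s] advanced_exp(2)[of L \<beta> \<nu> "s - \<tau>"] root by simp
  qed
  have S: "\<Theta> (2 * \<tau>) = \<tau>" using \<Theta>(3)[of "2 * \<tau>"] by simp
  obtain h h' where h: "C1 h h'" "\<And>t. \<tau> - L \<le> t \<Longrightarrow> h t = e t"
    "\<And>s. s \<in> {0..2 * \<tau>} \<Longrightarrow> advanced L \<alpha> h s = k * retarded L \<beta> h (\<Theta> s)"
  proof (rule extend_backward[OF L \<alpha> \<beta> k \<Theta>(1) pos _ _ e, of "2 * \<tau>"])
    show "advanced L \<alpha> e (2 * \<tau>) = k * retarded L \<beta> e (\<Theta> (2 * \<tau>))"
      using eig[of "2 * \<tau>"] by (simp add: S)
    then show "advanced L \<alpha> (\<lambda>t. \<nu> * e t) (2 * \<tau>) = k * \<Theta>' (2 * \<tau>) * retarded L \<beta> (\<lambda>t. \<nu> * e t) (\<Theta> (2 * \<tau>))"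
      by (simp add: advanced_scale \<Theta>(4))
  qed (use \<tau> \<Theta>(2) S in auto)
  have "advanced L \<alpha> h s = k * retarded L \<beta> h (\<Theta> s)" if s: "0 \<le> s" for s
  proof (cases "s \<le> 2 * \<tau>")
    case False
    have "advanced L \<alpha> h s = advanced L \<alpha> e s" "retarded L \<beta> h (s - \<tau>) = retarded L \<beta> e (s - \<tau>)"
      by (rule advanced_cong; use False L \<tau> h(2) in force)+
    then show ?thesis using eig[of s] \<Theta>(3)[of s] False by simp
  qed (use h(3) s in simp)
  then have "trajectory L \<alpha> \<beta> k \<Theta> h" unfolding trajectory_def using h(1) by blast
  from growing_trajectory[OF st L \<nu> this, of "\<tau> - L"] h(2) show False by (simp add: e_def)
qed

text \<open>A signal that enters in a short interval \<open>[a, S0]\<close> just before \<open>s1\<close>, where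
  \<open>\<Theta>'\<close> is at most \<open>\<eta>\<close>, has an echo in the past whose squared
  norm is a multiple of \<open>\<eta>\<close>. The initial state consists of this echo alone, while
  the window at time \<open>S0\<close> contains the whole signal. The ratio tends to infinity as
  \<open>\<eta>\<close> tends to \<open>0\<close>.\<close>

lemma folding_delay_not_stable:
  fixes \<alpha> \<beta> :: "real \<Rightarrow> real"
  assumes st: "bounded_windows L \<alpha> \<beta> k \<Theta> C" and C: "0 < C" and L: "0 < L"
    and \<alpha>: "continuous_on UNIV \<alpha>" and \<beta>: "continuous_on UNIV \<beta>" and k: "k \<noteq> 0"
    and \<Theta>: "C1 \<Theta> \<Theta>'" "\<Theta> 0 = 0" "\<And>s. 0 \<le> s \<Longrightarrow> 0 \<le> \<Theta> s" "\<And>s. 0 \<le> s \<Longrightarrow> \<Theta> s \<le> s"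
      "\<And>s. 0 \<le> s \<Longrightarrow> \<bar>\<Theta>' s\<bar> \<le> A"
    and s1: "0 < s1" "\<Theta>' s1 = 0" "\<And>s. 0 \<le> s \<Longrightarrow> s < s1 \<Longrightarrow> 0 < \<Theta>' s"
  shows False
proof -
  \<comment> \<open>Where the lag is zero it is minimal, so that \<open>\<Theta>'\<close> equals
    \<open>1\<close> there; hence the lag is positive at \<open>s1\<close>, and the echo of a
    late enough signal has left the outlet before the signal enters.\<close>
  have lag: "\<Theta> s1 < s1"
  proof (rule ccontr)
    assume "\<not> \<Theta> s1 < s1"
    then have eq: "\<Theta> s1 = s1" using \<Theta>(4)[of s1] s1(1) by simp
    have "((\<lambda>s. \<Theta> s - s) has_real_derivative \<Theta>' s1 - 1) (at s1)"
      by (auto intro!: derivative_eq_intros C1_deriv[OF \<Theta>(1)])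
    moreover have "\<forall>y. \<bar>s1 - y\<bar> < s1 \<longrightarrow> \<Theta> y - y \<le> \<Theta> s1 - s1"
    proof (intro allI impI)
      fix y assume "\<bar>s1 - y\<bar> < s1"
      then have "0 \<le> y" by linarith
      then show "\<Theta> y - y \<le> \<Theta> s1 - s1" using \<Theta>(4)[of y] eq by simp
    qed
    ultimately have "\<Theta>' s1 - 1 = 0" using DERIV_local_max[of "\<lambda>s. \<Theta> s - s"] s1(1) by blast
    then show False using s1(2) by simp
  qed
  have A: "0 \<le> A" using \<Theta>(5)[of 0] by linarith
  show False
  proof (rule backward_echo_le[OF L \<alpha> \<beta> k A less_imp_le[OF s1(1)]])
    fix B assume B: "0 < B" "\<And>\<Theta> \<Theta>' S0 a \<eta> h g h' g'. C1 \<Theta> \<Theta>' \<Longrightarrow> (\<And>s. s \<in> {0..S0} \<Longrightarrow> 0 \<le> \<Theta>' s \<and> \<Theta>' s \<le> A) \<Longrightarrow>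
    (\<And>s. s \<in> {a..S0} \<Longrightarrow> \<Theta>' s \<le> \<eta>) \<Longrightarrow> \<Theta> 0 = 0 \<Longrightarrow> (\<And>s. s \<in> {0..S0} \<Longrightarrow> \<Theta> s \<le> s) \<Longrightarrow>
    0 \<le> a \<Longrightarrow> a \<le> S0 \<Longrightarrow> S0 \<le> s1 \<Longrightarrow> \<Theta> S0 \<le> a \<Longrightarrow> 0 \<le> \<eta> \<Longrightarrow> C1 h h' \<Longrightarrow> C1 g g' \<Longrightarrow>
    (\<And>t. t \<le> a + L \<or> S0 + L \<le> t \<Longrightarrow> g t = 0) \<Longrightarrow> (\<And>t. \<Theta> S0 - L \<le> t \<Longrightarrow> h t = g t) \<Longrightarrow>
    (\<And>s. s \<in> {0..S0} \<Longrightarrow> advanced L \<alpha> h s = k * retarded L \<beta> h (\<Theta> s)) \<Longrightarrow>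
    window L h 0 \<le> B * \<eta> * integral {a + L..S0 + L} (\<lambda>t. (g t)\<^sup>2)"
    define \<eta> where "\<eta> = 1 / (2 * C * B)"
    have \<eta>: "0 < \<eta>" using B(1) C by (simp add: \<eta>_def)
    have "isCont \<Theta>' s1" using C1_cont'[OF \<Theta>(1)] by (simp add: continuous_on_eq_continuous_at)
    then obtain r where r: "0 < r" "\<And>s. \<bar>s - s1\<bar> < r \<Longrightarrow> \<bar>\<Theta>' s - \<Theta>' s1\<bar> < \<eta>"
      using \<eta> unfolding continuous_at_eps_delta dist_real_def by blast
    \<comment> \<open>Short enough for the slope bound, for the echo to have left before time
      \<open>a\<close>, and for the signal to lie in the window of \<open>S0\<close>.\<close>
    define d where "d = min (r / 2) (min ((s1 - \<Theta> s1) / 2) (min (s1 / 2) L))"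
    have d: "0 < d" "d < r" "d < s1 - \<Theta> s1" "d < s1" "d \<le> L"
      using r(1) lag s1(1) L by (auto simp: d_def min_less_iff_disj)
    define a S0 where "a = s1 - d" and "S0 = s1 - d / 2"
    have aS: "0 < a" "a < S0" "S0 < s1" "\<Theta> s1 < a" "S0 - L \<le> a" using d by (auto simp: a_def S0_def)
    have mono: "\<Theta> S0 \<le> \<Theta> s1"
    proof (rule DERIV_nonneg_imp_nondecreasing[where f = \<Theta>])
      fix x assume x: "S0 \<le> x" "x \<le> s1"
      have "0 \<le> \<Theta>' x" using s1(2) s1(3)[of x] x aS by (cases "x = s1") (auto intro: less_imp_le)
      then show "\<exists>y. (\<Theta> has_real_derivative y) (at x) \<and> 0 \<le> y" using C1_deriv[OF \<Theta>(1)] by blast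
    qed (use aS in simp)
    define T0 where "T0 = \<Theta> S0"
    have T0: "T0 < a" "0 \<le> T0" using mono aS \<Theta>(3)[of S0] by (auto simp: T0_def)
    have ab: "a + L < S0 + L" using aS by simp
    obtain g g' where g: "C1 g g'" "\<And>t. t \<le> a + L \<or> S0 + L \<le> t \<Longrightarrow> g t = 0"
      "0 < integral {a + L..S0 + L} (\<lambda>t. (g t)\<^sup>2)"
      "advanced L \<alpha> g S0 = k * retarded L \<beta> g T0" "advanced L \<alpha> g' S0 = (k * \<Theta>' S0) * retarded L \<beta> g' T0"
      by (rule compatible_bump[OF ab \<alpha> \<beta>, where L = L and S = S0 and T = T0 and k = k and k' = "k * \<Theta>' S0"],
        rule that) simp_all
    define N where "N = integral {a + L..S0 + L} (\<lambda>t. (g t)\<^sup>2)"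
    obtain h1 h1' where h1: "C1 h1 h1'" "\<And>t. T0 - L \<le> t \<Longrightarrow> h1 t = g t"
      "\<And>s. s \<in> {0..S0} \<Longrightarrow> advanced L \<alpha> h1 s = k * retarded L \<beta> h1 (\<Theta> s)"
    proof (rule extend_backward[OF L \<alpha> \<beta> k \<Theta>(1) _ _ _ g(1), of S0])
      show "advanced L \<alpha> g S0 = k * retarded L \<beta> g (\<Theta> S0)" using g(4) by (simp add: T0_def)
      show "advanced L \<alpha> g' S0 = k * \<Theta>' S0 * retarded L \<beta> g' (\<Theta> S0)" using g(5) by (simp add: T0_def)
    qed (use s1(3) aS \<Theta>(4) in \<open>auto simp: T0_def\<close>)
    have h1': "h1' t = g' t" if "T0 - L \<le> t" for t
      by (rule C1_derivative_unique[OF h1(1) g(1) h1(2) that])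
    have S0le: "T0 \<le> S0" using T0 aS by simp
    have cong': "advanced L \<alpha> h1' S0 = advanced L \<alpha> g' S0" "retarded L \<beta> h1' T0 = retarded L \<beta> g' T0"
      by (rule advanced_cong; use L S0le h1' in simp)+
    obtain h h' where h: "C1 h h'" "\<And>t. 0 - L \<le> t \<Longrightarrow> t \<le> S0 + L \<Longrightarrow> h t = h1 t"
      "\<And>s. S0 \<le> s \<Longrightarrow> advanced L \<alpha> h s = k * retarded L \<beta> h (\<Theta> s)"
    proof (rule extend_forward[OF L \<alpha> \<beta> \<Theta>(1) _ _ _ h1(1), of S0 0 A])
      show "advanced L \<alpha> h1 S0 = k * retarded L \<beta> h1 (\<Theta> S0)" using h1(3)[of S0] aS by simp
      show "advanced L \<alpha> h1' S0 = k * \<Theta>' S0 * retarded L \<beta> h1' (\<Theta> S0)"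
        using cong' g(5) by (simp add: T0_def)
    qed (use \<Theta>(3,4,5) aS in auto)
    have "advanced L \<alpha> h s = k * retarded L \<beta> h (\<Theta> s)" if s: "0 \<le> s" for s
    proof (cases "s \<le> S0")
      case True
      have "advanced L \<alpha> h s = advanced L \<alpha> h1 s"
        by (rule advanced_cong) (use L s True h(2) in auto)
      moreover have "retarded L \<beta> h (\<Theta> s) = retarded L \<beta> h1 (\<Theta> s)"
        by (rule advanced_cong) (use L s True h(2) \<Theta>(3)[OF s] \<Theta>(4)[OF s] in auto)
      ultimately show ?thesis using h1(3)[of s] s True by simp
    qed (use h(3) in simp)
    then have "trajectory L \<alpha> \<beta> k \<Theta> h" unfolding trajectory_def using h(1) by blast
    then have dec: "window L h S0 \<le> C * window L h 0" using st aS unfolding bounded_windows_def by simp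
    note ch = C1_cont[OF h(1)]
    have ch2: "continuous_on UNIV (\<lambda>r. (h r)\<^sup>2)" by (intro continuous_intros ch)
    have "N = integral {a + L..S0 + L} (\<lambda>t. (h t)\<^sup>2)"
      unfolding N_def by (rule integral_eqI) (use h(2) h1(2) aS T0 L in auto)
    also have "\<dots> = prim_sq h (S0 + L) - prim_sq h (a + L)"
      by (rule integral_prim[OF ch2]) (use aS in simp)
    also have "\<dots> \<le> prim_sq h (S0 + L) - prim_sq h (S0 - L)"
      using prim_mono[OF ch2, of "S0 - L" "a + L"] aS L by simp
    also have "\<dots> = window L h S0" using window_prim[OF ch, of L S0] L by simp
    also have "\<dots> \<le> C * window L h1 0"
    proof -
      have "window L h 0 = window L h1 0"
        unfolding window_def by (rule integral_eqI) (use h(2) aS in auto)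
      then show ?thesis using dec by simp
    qed
    also have "\<dots> \<le> C * (B * \<eta> * N)"
    proof (rule mult_left_mono)
      show "window L h1 0 \<le> B * \<eta> * N" unfolding N_def
      proof (rule B(2)[OF \<Theta>(1) _ _ \<Theta>(2) _ _ _ _ _ _ h1(1) g(1) g(2)])
        show "0 \<le> \<Theta>' s \<and> \<Theta>' s \<le> A" if "s \<in> {0..S0}" for s
          using s1(3)[of s] \<Theta>(5)[of s] that aS by auto
        show "\<Theta>' s \<le> \<eta>" if "s \<in> {a..S0}" for s
          using r(2)[of s] that s1(2) d aS by (auto simp: a_def)
        show "h1 t = g t" if "\<Theta> S0 - L \<le> t" for t using h1(2) that by (simp add: T0_def)
      qed (use aS T0 \<eta> \<Theta>(4) h1(3) in \<open>auto simp: T0_def\<close>)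
    qed (use C in simp)
    also have "\<dots> = N / 2" using C B(1) by (simp add: \<eta>_def)
    finally show False using g(3) by (simp add: N_def)
  qed
qed

lemma first_point_above:
  fixes f :: "real \<Rightarrow> real"
  assumes f: "continuous_on UNIV f" and b: "0 \<le> b" "y \<le> f b"
  obtains d where "0 \<le> d" "d \<le> b" "y \<le> f d" "\<And>s. 0 \<le> s \<Longrightarrow> s < d \<Longrightarrow> f s < y"
proof -
  define Z where "Z = {0..b} \<inter> {s. y \<le> f s}"
  have "closed {s. y \<le> f s}" by (rule closed_Collect_le) (intro continuous_intros f)+
  then have "compact Z" unfolding Z_def by (intro compact_Int_closed) auto
  moreover have "Z \<noteq> {}" using b by (auto simp: Z_def)
  ultimately have "\<exists>d\<in>Z. \<forall>s\<in>Z. d \<le> s"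
    by (rule compact_attains_inf)
  then obtain d where d: "d \<in> Z" "\<And>s. s \<in> Z \<Longrightarrow> d \<le> s" by blast
  show thesis
  proof (rule that[of d])
    show "f s < y" if "0 \<le> s" "s < d" for s
    proof (rule ccontr)
      assume "\<not> f s < y"
      then have "s \<in> Z" using that d(1) by (auto simp: Z_def)
      then show False using d(2)[of s] that by simp
    qed
  qed (use d(1) in \<open>auto simp: Z_def\<close>)
qed

lemma window_sum_le:
  assumes st: "bounded_windows L \<alpha> \<beta> k \<Theta> C" and L: "0 < L" and h: "trajectory L \<alpha> \<beta> k \<Theta> h"
  shows "prim_sq h (2 * real n * L - L) - prim_sq h (- L) \<le> real n * (C * window L h 0)"
proof (induction n)
  case (Suc n)
  define G where "G = prim_sq h"
  have "window L h (2 * real n * L) \<le> C * window L h 0"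
    using st h L unfolding bounded_windows_def by simp
  then have "G (2 * real n * L + L) - G (2 * real n * L - L) \<le> C * window L h 0"
    using window_prim[OF trajectory_continuous[OF h], of L "2 * real n * L"] L by (simp add: G_def)
  moreover have "G (2 * real n * L - L) - G (- L) \<le> real n * (C * window L h 0)"
    using Suc.IH unfolding G_def .
  ultimately have "G (2 * real n * L + L) - G (- L) \<le> real (Suc n) * (C * window L h 0)"
    by (simp add: distrib_right)
  moreover have "2 * real (Suc n) * L - L = 2 * real n * L + L" by (simp add: algebra_simps)
  ultimately show ?case unfolding G_def by (simp only:)
qed simp

text \<open>The initial state is a signal \<open>g\<close> at the outlet that leaves during
  \<open>[0, w]\<close>. While the slope of \<open>\<Theta>\<close> stays below
  \<open>\<eta>\<close>, up to the time \<open>\<delta>\<close> of the first slope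
  \<open>\<eta>\<close>, the controller plays the beginning of the output in slow motion, which
  multiplies its squared norm by at least \<open>k\<^sup>2 / \<eta>\<close>. But the squared norm of
  the input up to \<open>\<delta>\<close> is bounded by a constant times the initial window,
  independently of \<open>\<eta>\<close>, because it is covered by a fixed number of windows. So the
  output up to time \<open>\<Theta> \<delta>\<close> is small compared with the initial state. Yet
  for \<open>w\<close> at most \<open>\<Theta> \<delta>\<close> this output contains the signal
  itself, up to an integral over a time of length \<open>w\<close>, which is negligible for small
  \<open>w\<close>.\<close>

lemma flat_start_not_stable:
  fixes \<alpha> \<beta> :: "real \<Rightarrow> real"
  assumes st: "bounded_windows L \<alpha> \<beta> k \<Theta> C" and C: "0 < C" and L: "0 < L"
    and \<alpha>: "continuous_on UNIV \<alpha>" and \<beta>: "continuous_on UNIV \<beta>" and k: "k \<noteq> 0"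
    and \<Theta>: "C1 \<Theta> \<Theta>'" "\<Theta> 0 = 0" "\<And>s. 0 \<le> s \<Longrightarrow> 0 \<le> \<Theta> s" "\<And>s. 0 \<le> s \<Longrightarrow> \<Theta> s \<le> s"
      "\<And>s. 0 \<le> s \<Longrightarrow> \<bar>\<Theta>' s\<bar> \<le> A"
    and flat: "\<Theta>' 0 \<le> 0" and S: "0 \<le> S" "\<Theta>' S = 1"
  shows False
proof -
  obtain K1 where K1: "0 < K1" "\<And>x. x \<in> {-1..1} \<Longrightarrow> \<bar>\<alpha> x\<bar> \<le> K1" using compact_kernel_bound[OF \<alpha>] by blast
  obtain K2 where K2: "0 < K2" "\<And>x. x \<in> {-1..1} \<Longrightarrow> \<bar>\<beta> x\<bar> \<le> K2" using compact_kernel_bound[OF \<beta>] by blast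
  obtain n :: nat where n: "(S + 2 * L) / (2 * L) \<le> real n" using real_arch_simple by blast
  have n': "S + L \<le> 2 * real n * L - L" using n L by (simp add: pos_divide_le_eq algebra_simps)
  \<comment> \<open>The squared norm of the input up to time \<open>S\<close> is at most \<open>D\<close>
    times the initial window: the trace up to \<open>S + L\<close> is covered by
    \<open>n\<close> windows.\<close>
  define D where "D = 2 * (real n * C) + 4 * K1\<^sup>2 / L * C * S"
  have npos: "0 < real n"
  proof -
    have "0 < (S + 2 * L) / (2 * L)" using S L by (simp add: add_nonneg_pos)
    then show ?thesis using n by linarith
  qed
  have D: "0 < D" using npos C K1 L S by (simp add: D_def add_pos_nonneg)
  \<comment> \<open>With this slope the output up to \<open>\<Theta> \<delta>\<close> has at most one eighth
    of the squared norm of the signal.\<close>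
  define \<eta> where "\<eta> = min (1 / 2) (k\<^sup>2 / (8 * D))"
  have \<eta>: "0 < \<eta>" "\<eta> \<le> 1" "\<eta> * (8 * D) \<le> k\<^sup>2"
  proof -
    show "0 < \<eta>" "\<eta> \<le> 1" using D k by (simp_all add: \<eta>_def)
    have "\<eta> \<le> k\<^sup>2 / (8 * D)" by (simp add: \<eta>_def)
    then show "\<eta> * (8 * D) \<le> k\<^sup>2" using D by (simp add: pos_le_divide_eq)
  qed
  obtain \<delta> where \<delta>: "0 \<le> \<delta>" "\<delta> \<le> S" "\<eta> \<le> \<Theta>' \<delta>" "\<And>s. 0 \<le> s \<Longrightarrow> s < \<delta> \<Longrightarrow> \<Theta>' s < \<eta>"
    by (rule first_point_above[OF C1_cont'[OF \<Theta>(1)] S(1), of \<eta>]) (use \<eta> S in auto)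
  have \<delta>0: "0 < \<delta>" using \<delta>(1,3) flat \<eta>(1) by (cases "\<delta> = 0") auto
  have slope: "\<Theta>' s \<le> \<eta>" if "0 \<le> s" "s \<le> \<delta>" for s
  proof (cases "s = \<delta>")
    case True
    have "\<exists>r. 0 \<le> r \<and> r \<le> \<delta> \<and> \<Theta>' r = \<eta>"
      using flat \<eta>(1) \<delta> by (intro IVT' continuous_on_subset[OF C1_cont'[OF \<Theta>(1)]]) auto
    then obtain r where "0 \<le> r" "r \<le> \<delta>" "\<Theta>' r = \<eta>" by blast
    then show ?thesis using \<delta>(4)[of r] True by (cases "r = \<delta>") auto
  qed (use \<delta>(4)[of s] that in auto)
  \<comment> \<open>If no output were played up to that time, \<open>\<Theta>\<close> would have a minimum
    there and slope \<open>0\<close> instead of \<open>\<eta>\<close>.\<close>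
  have w0: "0 < \<Theta> \<delta>"
  proof (rule ccontr)
    assume "\<not> 0 < \<Theta> \<delta>"
    then have z: "\<Theta> \<delta> = 0" using \<Theta>(3)[of \<delta>] \<delta>0 by simp
    have "\<forall>y. \<bar>\<delta> - y\<bar> < \<delta> \<longrightarrow> \<Theta> \<delta> \<le> \<Theta> y"
    proof (intro allI impI)
      fix y assume "\<bar>\<delta> - y\<bar> < \<delta>"
      then have "0 \<le> y" by linarith
      then show "\<Theta> \<delta> \<le> \<Theta> y" using \<Theta>(3)[of y] z by simp
    qed
    then have "\<Theta>' \<delta> = 0" using DERIV_local_min[OF C1_deriv[OF \<Theta>(1)] \<delta>0] by blast
    then show False using \<delta>(3) \<eta>(1) by simp
  qed
  \<comment> \<open>The last entry makes the integral term of the output at most one half of the signal.\<close>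
  define w where "w = min (\<Theta> \<delta>) (min L (L / (8 * K2\<^sup>2 * C)))"
  have w: "0 < w" "w \<le> \<Theta> \<delta>" "w \<le> L" "w * (8 * K2\<^sup>2 * C) \<le> L"
  proof -
    have p: "0 < 8 * K2\<^sup>2 * C" using K2 C by simp
    show "0 < w" "w \<le> \<Theta> \<delta>" "w \<le> L" using w0 L p by (auto simp: w_def)
    have "w \<le> L / (8 * K2\<^sup>2 * C)" by (simp add: w_def)
    then show "w * (8 * K2\<^sup>2 * C) \<le> L" using p by (simp only: pos_le_divide_eq)
  qed
  have ab: "- L < - L + w" using w by simp
  obtain g g' where g: "C1 g g'" "\<And>t. t \<le> - L \<or> - L + w \<le> t \<Longrightarrow> g t = 0"
    "0 < integral {- L..- L + w} (\<lambda>t. (g t)\<^sup>2)"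
    "advanced L \<alpha> g 0 = k * retarded L \<beta> g 0" "advanced L \<alpha> g' 0 = (k * \<Theta>' 0) * retarded L \<beta> g' 0"
    by (rule compatible_bump[OF ab \<alpha> \<beta>, where L = L and S = 0 and T = 0 and k = k and k' = "k * \<Theta>' 0"],
        rule that) simp_all
  define N where "N = integral {- L..- L + w} (\<lambda>t. (g t)\<^sup>2)"
  have N: "0 < N" using g(3) by (simp add: N_def)
  obtain h h' where h: "C1 h h'" "\<And>t. 0 - L \<le> t \<Longrightarrow> t \<le> 0 + L \<Longrightarrow> h t = g t"
    "\<And>s. 0 \<le> s \<Longrightarrow> advanced L \<alpha> h s = k * retarded L \<beta> h (\<Theta> s)"
    by (rule extend_forward[OF L \<alpha> \<beta> \<Theta>(1) _ _ _ g(1), of 0 0 A k])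
      (use \<Theta> g(4,5) that in auto)
  have tr: "trajectory L \<alpha> \<beta> k \<Theta> h" unfolding trajectory_def using h by blast
  note ch = C1_cont[OF h(1)]
  have ch2: "continuous_on UNIV (\<lambda>r. (h r)\<^sup>2)" by (intro continuous_intros ch)
  define G where "G = prim_sq h"
  have Gmono: "G x \<le> G y" if "x \<le> y" for x y unfolding G_def by (rule prim_mono[OF ch2 _ that]) simp
  have GN: "G (- L + w) - G (- L) = N"
  proof -
    have "integral {- L..- L + w} (\<lambda>t. (h t)\<^sup>2) = N"
      unfolding N_def by (rule integral_eqI) (use h(2) w in auto)
    then show ?thesis using integral_prim[OF ch2, of "- L" "- L + w"] w by (simp add: G_def)
  qed
  have "integral {- L + w..L} (\<lambda>t. (h t)\<^sup>2) = integral {- L + w..L} (\<lambda>t. 0)"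
    by (rule integral_eqI) (use h(2) g(2) w in auto)
  then have "G L - G (- L + w) = 0" using integral_prim[OF ch2, of "- L + w" L] w L by (simp add: G_def)
  then have win0: "window L h 0 = N" using GN window_prim[OF ch, of L 0] L by (simp add: G_def)
  have win: "window L h t \<le> C * N" if "0 \<le> t" for t
    using st tr that unfolding bounded_windows_def win0[symmetric] by blast
  define P Q where "P = advanced L \<alpha> h" and "Q = retarded L \<beta> h"
  have cP: "continuous_on UNIV (\<lambda>s. (P s)\<^sup>2)" and cQ: "continuous_on UNIV (\<lambda>s. (Q s)\<^sup>2)"
    unfolding P_def Q_def
    by (intro continuous_intros continuous_on_advanced(1)[OF \<alpha> ch] continuous_on_advanced(2)[OF \<beta> ch])+
  have PQ: "P s = k * Q (\<Theta> s)" if "0 \<le> s" for s using h(3)[OF that] by (simp add: P_def Q_def)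
  have "prim (\<lambda>s. (P s)\<^sup>2) \<delta> - prim (\<lambda>s. (P s)\<^sup>2) 0 \<le> 2 * (G (\<delta> + L) - G (0 + L)) + 4 * K1\<^sup>2 / L * (C * N) * (\<delta> - 0)"
    unfolding P_def G_def by (rule advanced_square_le[OF L \<alpha> K1(2) ch \<delta>(1)]) (use win in auto)
  also have "\<dots> \<le> D * N"
  proof -
    have "G (\<delta> + L) - G (0 + L) \<le> G (2 * real n * L - L) - G (- L)"
      using Gmono[of "\<delta> + L" "2 * real n * L - L"] Gmono[of "- L" "0 + L"] n' \<delta>(2) L by simp
    also have "\<dots> \<le> real n * (C * N)"
      using window_sum_le[OF st L tr, of n] unfolding G_def win0 .
    finally have "2 * (G (\<delta> + L) - G (0 + L)) \<le> 2 * (real n * (C * N))" by simp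
    moreover have "4 * K1\<^sup>2 / L * (C * N) * (\<delta> - 0) \<le> 4 * K1\<^sup>2 / L * (C * N) * S"
      using \<delta>(2) L C N by (intro mult_left_mono) auto
    moreover have "D * N = 2 * (real n * (C * N)) + 4 * K1\<^sup>2 / L * (C * N) * S"
      by (simp add: D_def algebra_simps)
    ultimately show ?thesis by linarith
  qed
  finally have Ple: "prim (\<lambda>s. (P s)\<^sup>2) \<delta> \<le> D * N" by simp
  have "prim (\<lambda>s. (Q s)\<^sup>2) (\<Theta> \<delta>) \<le> \<eta> / k\<^sup>2 * prim (\<lambda>s. (P s)\<^sup>2) \<delta>"
  proof -
    define W where "W = (\<lambda>s. \<eta> / k\<^sup>2 * prim (\<lambda>s. (P s)\<^sup>2) s - prim (\<lambda>s. (Q s)\<^sup>2) (\<Theta> s))"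
    have "W 0 \<le> W \<delta>"
    proof (rule DERIV_nonneg_imp_nondecreasing[where f = W, OF \<delta>(1)])
      fix s assume s: "0 \<le> s" "s \<le> \<delta>"
      have "(W has_real_derivative \<eta> / k\<^sup>2 * (P s)\<^sup>2 - (Q (\<Theta> s))\<^sup>2 * \<Theta>' s) (at s)"
        unfolding W_def
        by (intro DERIV_diff DERIV_cmult DERIV_prim[OF cP] DERIV_chain2[OF DERIV_prim[OF cQ]] C1_deriv[OF \<Theta>(1)])
      moreover have "\<eta> / k\<^sup>2 * (P s)\<^sup>2 - (Q (\<Theta> s))\<^sup>2 * \<Theta>' s = (Q (\<Theta> s))\<^sup>2 * (\<eta> - \<Theta>' s)"
        using k PQ[OF s(1)] by (simp add: power_mult_distrib algebra_simps)
      moreover have "0 \<le> (Q (\<Theta> s))\<^sup>2 * (\<eta> - \<Theta>' s)" using slope[OF s] by simp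
      ultimately show "\<exists>y. (W has_real_derivative y) (at s) \<and> 0 \<le> y" by metis
    qed
    then show ?thesis by (simp add: W_def \<Theta>(2))
  qed
  also have "\<dots> \<le> \<eta> / k\<^sup>2 * (D * N)" using \<eta>(1) Ple by (intro mult_left_mono) auto
  also have "\<dots> \<le> N / 8"
  proof -
    have "\<eta> * (8 * D) * N \<le> k\<^sup>2 * N" using \<eta>(3) N by (intro mult_right_mono) auto
    then show ?thesis using k by (simp add: field_simps)
  qed
  finally have Qle: "prim (\<lambda>s. (Q s)\<^sup>2) (\<Theta> \<delta>) \<le> N / 8" .
  define E where "E = 2 * K2\<^sup>2 / L * (C * N)"
  have "G (w - L) - G (0 - L) \<le> 2 * prim (\<lambda>s. (Q s)\<^sup>2) w + 2 * E * w"
  proof -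
    define W where "W = (\<lambda>t. 2 * prim (\<lambda>s. (Q s)\<^sup>2) t + 2 * E * t - G (t - L))"
    have "W 0 \<le> W w"
    proof (rule DERIV_nonneg_imp_nondecreasing[where f = W])
      show "0 \<le> w" using w by simp
      fix t assume t: "0 \<le> t" "t \<le> w"
      have dG: "((\<lambda>t. G (t - L)) has_real_derivative (h (t - L))\<^sup>2) (at t)"
        unfolding G_def by (rule DERIV_chain2[OF DERIV_prim[OF ch2], THEN DERIV_cong]) (auto intro!: derivative_eq_intros)
      have "(W has_real_derivative 2 * (Q t)\<^sup>2 + 2 * E - (h (t - L))\<^sup>2) (at t)"
        unfolding W_def using dG
        by (auto intro!: derivative_eq_intros DERIV_prim[OF cQ])
      moreover have "0 \<le> 2 * (Q t)\<^sup>2 + 2 * E - (h (t - L))\<^sup>2"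
      proof -
        define X where "X = conv L \<beta> h t"
        have "X\<^sup>2 \<le> 2 * K2\<^sup>2 / L * window L h t" unfolding X_def by (rule conv_square_le[OF L \<beta> K2(2) ch])
        also have "\<dots> \<le> E" unfolding E_def using win[OF t(1)] L by (intro mult_left_mono) auto
        finally have "X\<^sup>2 \<le> E" .
        moreover have "(Q t + - X)\<^sup>2 \<le> 2 * (Q t)\<^sup>2 + 2 * (- X)\<^sup>2" by (rule square_sum2_le)
        moreover have "Q t + - X = h (t - L)" by (simp add: Q_def retarded_def X_def)
        ultimately show ?thesis by simp
      qed
      ultimately show "\<exists>y. (W has_real_derivative y) (at t) \<and> 0 \<le> y" by blast
    qed
    then show ?thesis by (simp add: W_def)
  qed
  moreover have "prim (\<lambda>s. (Q s)\<^sup>2) w \<le> prim (\<lambda>s. (Q s)\<^sup>2) (\<Theta> \<delta>)"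
    by (rule prim_mono[OF cQ _ w(2)]) simp
  moreover have "2 * E * w \<le> N / 2"
  proof -
    have "w * (8 * K2\<^sup>2 * C) * N \<le> L * N" using w(4) N by (intro mult_right_mono) auto
    then show ?thesis using L by (simp add: E_def field_simps)
  qed
  moreover have "G (w - L) - G (0 - L) = N" using GN by simp
  ultimately show False using Qle N by linarith
qed

lemma cos_plus_sin_neg:
  assumes "x \<in> {3 / 4 * pi<..<pi}"
  shows "cos x + sin x < 0"
proof -
  define y where "y = pi - x"
  have y: "0 < y" "y < pi / 4" using assms by (auto simp: y_def)
  have "sin y < sin (pi / 4)" using y by (intro sin_monotone_2pi) auto
  moreover have "cos (pi / 4) < cos y" using y by (intro cos_monotone_0_pi) auto
  moreover have "sin x = sin y" "cos x = - cos y" by (simp_all add: y_def)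
  ultimately show ?thesis by (simp add: sin_45 cos_45)
qed

theorem proposition5:
  fixes L M khat :: real
  assumes "L > 0" and "M > 0" and "khat > 0"
    and "M * L \<in> {3 / 4 * pi<..<pi}"
  shows "\<exists>\<tau>0>0. \<forall>\<tau>\<ge>\<tau>0. \<forall>\<zeta>. starting_delay \<tau> \<zeta> \<longrightarrow>
           \<not> (\<exists>k\<in>{-khat<..<khat}. exponentially_stable L M k \<tau> \<zeta>)"
proof -
  define \<alpha> \<beta> where "\<alpha> = inlet_kernel L M" and "\<beta> = outlet_kernel L M"
  have \<alpha>: "continuous_on UNIV \<alpha>" and \<beta>: "continuous_on UNIV \<beta>"
    unfolding \<alpha>_def \<beta>_def by (rule continuous_inlet_kernel, rule continuous_outlet_kernel)
  have "advanced L \<alpha> (\<lambda>_. 1) 0 = cos (M * L) + sin (M * L)"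
    using inlet_steady[of L M 0] by (simp add: inlet_advanced \<alpha>_def)
  then have neg: "advanced L \<alpha> (\<lambda>_. 1) 0 < 0" using cos_plus_sin_neg[OF assms(4)] by simp
  obtain \<tau>0 where \<tau>0: "0 < \<tau>0" "\<And>\<tau> k. \<tau>0 \<le> \<tau> \<Longrightarrow> \<bar>k\<bar> < khat \<Longrightarrow>
    \<exists>\<nu>>0. advanced L \<alpha> (\<lambda>t. exp (\<nu> * t)) 0 = k * exp (- \<nu> * \<tau>) * retarded L \<beta> (\<lambda>t. exp (\<nu> * t)) 0"
    by (rule unstable_root[OF assms(1) \<alpha> \<beta> neg assms(3)]) (rule that, assumption, blast)
  show ?thesis
  proof (intro exI[of _ \<tau>0] conjI allI impI notI)
    show "0 < \<tau>0" by (rule \<tau>0)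
    fix \<tau> \<zeta> assume \<tau>: "\<tau>0 \<le> \<tau>" and \<zeta>: "starting_delay \<tau> \<zeta>"
      and "\<exists>k\<in>{-khat<..<khat}. exponentially_stable L M k \<tau> \<zeta>"
    then obtain k where k: "\<bar>k\<bar> < khat" and stable: "exponentially_stable L M k \<tau> \<zeta>" by force
    have \<tau>pos: "0 < \<tau>" using \<tau> \<tau>0(1) by simp
    obtain \<Theta> \<Theta>' where \<Theta>: "C1 \<Theta> \<Theta>'" "\<And>s. s \<in> {0..2 * \<tau>} \<Longrightarrow> \<Theta> s = s - \<zeta> s"
      "\<And>s. 2 * \<tau> \<le> s \<Longrightarrow> \<Theta> s = s - \<tau>" "\<And>s. 2 * \<tau> \<le> s \<Longrightarrow> \<Theta>' s = 1"
      using feedback_time[OF \<zeta> \<tau>pos] by metis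
    have \<zeta>0: "\<zeta> 0 = 0" and \<zeta>le: "\<And>t. t \<in> {0..2 * \<tau>} \<Longrightarrow> 0 \<le> \<zeta> t \<and> \<zeta> t \<le> t"
      using \<zeta> unfolding starting_delay_def by auto
    have \<Theta>0: "\<Theta> 0 = 0" using \<Theta>(2)[of 0] \<zeta>0 \<tau>pos by simp
    have \<Theta>ge: "0 \<le> \<Theta> s" and \<Theta>le: "\<Theta> s \<le> s" if "0 \<le> s" for s
      using \<Theta>(2)[of s] \<Theta>(3)[of s] \<zeta>le[of s] that \<tau>pos by (cases "s \<le> 2 * \<tau>"; simp)+
    obtain C \<mu> where C: "0 < C" "0 < \<mu>" and window: "\<And>h h' T. C1 h h' \<Longrightarrow>
        (\<And>s. s \<in> {0..<2 * \<tau>} \<Longrightarrow> inlet L M h s = k * outlet L M h (s - \<zeta> s)) \<Longrightarrow>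
        (\<And>s. 2 * \<tau> \<le> s \<Longrightarrow> inlet L M h s = k * outlet L M h (s - \<tau>)) \<Longrightarrow> 0 \<le> T \<Longrightarrow>
        window L h T \<le> C * exp (- \<mu> * T) * window L h 0"
      apply (rule exponentially_stable_window[OF stable assms(1) \<tau>pos \<zeta>0])
      subgoal premises p by (rule that) (fact p)+
      done
    have st: "bounded_windows L \<alpha> \<beta> k \<Theta> C"
      unfolding bounded_windows_def
    proof (intro allI impI)
      fix h T assume h: "trajectory L \<alpha> \<beta> k \<Theta> h" and T: "(0::real) \<le> T"
      from h obtain h' where h': "C1 h h'" and eq: "\<And>s. 0 \<le> s \<Longrightarrow> advanced L \<alpha> h s = k * retarded L \<beta> h (\<Theta> s)"
        unfolding trajectory_def by blast
      have "window L h T \<le> C * exp (- \<mu> * T) * window L h 0"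
      proof (rule window[OF h' _ _ T])
        show "inlet L M h s = k * outlet L M h (s - \<zeta> s)" if "s \<in> {0..<2 * \<tau>}" for s
          using eq[of s] \<Theta>(2)[of s] that by (simp add: inlet_advanced outlet_retarded \<alpha>_def \<beta>_def)
        show "inlet L M h s = k * outlet L M h (s - \<tau>)" if "2 * \<tau> \<le> s" for s
          using eq[of s] \<Theta>(3)[of s] that \<tau>pos by (simp add: inlet_advanced outlet_retarded \<alpha>_def \<beta>_def)
      qed
      also have "\<dots> \<le> C * 1 * window L h 0"
        using C T window_nonneg[of L h 0] by (intro mult_right_mono mult_left_mono) auto
      finally show "window L h T \<le> C * window L h 0" by simp
    qed
    obtain \<nu> where \<nu>: "0 < \<nu>"
      "advanced L \<alpha> (\<lambda>t. exp (\<nu> * t)) 0 = k * exp (- \<nu> * \<tau>) * retarded L \<beta> (\<lambda>t. exp (\<nu> * t)) 0"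
      using \<tau>0(2)[OF \<tau> k] by blast
    show False
    proof (cases "k = 0")
      case True
      have "C1 (\<lambda>t. exp (\<nu> * t)) (\<lambda>t. \<nu> * exp (\<nu> * t))"
        unfolding C1_def by (auto intro!: derivative_eq_intros continuous_intros)
      moreover have "advanced L \<alpha> (\<lambda>t. exp (\<nu> * t)) s = 0" for s
        unfolding advanced_exp(1)[of L \<alpha> \<nu> s] \<nu>(2) True by simp
      ultimately have "trajectory L \<alpha> \<beta> k \<Theta> (\<lambda>t. exp (\<nu> * t))"
        unfolding trajectory_def True by auto
      then show False by (rule growing_trajectory[OF st assms(1) \<nu>(1)]) simp
    next
      case False
      have "bounded (\<Theta>' ` {0..2 * \<tau>})"
        by (intro compact_imp_bounded compact_continuous_image continuous_on_subset[OF C1_cont'[OF \<Theta>(1)]]) auto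
      then obtain A where A: "\<forall>y\<in>\<Theta>' ` {0..2 * \<tau>}. norm y \<le> A" unfolding bounded_iff by blast
      have "2 * \<tau> \<in> {0..2 * \<tau>}" using \<tau>pos by simp
      then have "norm (\<Theta>' (2 * \<tau>)) \<le> A" using A by blast
      then have A1: "1 \<le> A" using \<Theta>(4)[of "2 * \<tau>"] by simp
      have bound: "\<bar>\<Theta>' s\<bar> \<le> A" if "0 \<le> s" for s
        using A A1 \<Theta>(4)[of s] that by (cases "s \<le> 2 * \<tau>") auto
      show False
      proof (cases "\<forall>s\<in>{0..2 * \<tau>}. 0 < \<Theta>' s")
        case True
        show False
          by (rule invertible_delay_not_stable[OF st assms(1) \<alpha> \<beta> False \<tau>pos \<Theta>(1) \<Theta>le \<Theta>(3) _ _ \<nu>])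
            (use True \<Theta>(4) in auto)
      next
        case not_inc: False
        then obtain b where b: "b \<in> {0..2 * \<tau>}" "\<Theta>' b \<le> 0" by force
        have "continuous_on UNIV (\<lambda>s. - \<Theta>' s)" by (intro continuous_intros C1_cont'[OF \<Theta>(1)])
        \<comment> \<open>The kind of the starting phase is decided by the first point at which the slope of
          \<open>\<Theta>\<close> is not positive.\<close>
        then obtain s1 where s1: "0 \<le> s1" "s1 \<le> b" "0 \<le> - \<Theta>' s1" "\<And>s. 0 \<le> s \<Longrightarrow> s < s1 \<Longrightarrow> - \<Theta>' s < 0"
          using first_point_above[of "\<lambda>s. - \<Theta>' s" b 0] b by auto
        show False
        proof (cases "s1 = 0")
          case True
          show False
            by (rule flat_start_not_stable[OF st C(1) assms(1) \<alpha> \<beta> False \<Theta>(1) \<Theta>0 \<Theta>ge \<Theta>le bound, of "2 * \<tau>"])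
              (use s1(3) True \<tau>pos \<Theta>(4) in auto)
        next
          case pos: False
          then have s1pos: "0 < s1" using s1(1) by simp
          have "\<exists>r. 0 \<le> r \<and> r \<le> s1 \<and> (\<lambda>s. - \<Theta>' s) r = 0"
            using s1(3) s1(4)[of 0] s1pos \<open>continuous_on UNIV (\<lambda>s. - \<Theta>' s)\<close>
            by (intro IVT') (auto intro: continuous_on_subset)
          then obtain r where "0 \<le> r" "r \<le> s1" "\<Theta>' r = 0" by auto
          then have zero: "\<Theta>' s1 = 0" using s1(4)[of r] by (cases "r = s1") auto
          show False
            by (rule folding_delay_not_stable[OF st C(1) assms(1) \<alpha> \<beta> False \<Theta>(1) \<Theta>0 \<Theta>ge \<Theta>le bound s1pos zero])
              (use s1(4) in force)+
        qed
      qed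
    qed
  qed
qed

end
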